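(* There exist constants $c_1,C_1,C_2>0$ such that the following holds. Let $S\subseteq\{1,\dots,n\}$ with $|S|=s$, let $x\in\mathbb{R}^n$ or $\mathbb{C}^n$ be supported on $S$ and satisfy the random sign assumption, let $A$ be the random sensing matrix of the setting, and let $y=Ax+\epsilon$ with $\|\epsilon\|_2\le\eta$. For every $0<\varepsilon<1$, if $$m\ge c_1\max_{j\in S^c}\Lambda(S\cup\{j\},F)\,\ln\!\left(\tfrac{6(s+1)(n-s)}{\varepsilon}\right)\ln\!\left(\tfrac{6n}{\varepsilon}\right),$$ then with probability at least $1-\varepsilon$ every minimizer $x^\sharp$ of (qBP) satisfies $\|x-x^\sharp\|_2\le(C_1+C_2\sqrt s)\eta$. In the noiseless case $\eta=0$, one may take $c_1=19$, and then $x$ is exactly recovered as the unique minimizer of (BP) with probability at least $1-\varepsilon$.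
   Context: Setting: Let $n,m\ge 1$. For $\ell=1,\dots,m$ let $F_\ell$ be a probability distribution on $\mathbb{C}^{p_\ell\times n}$ ($p_\ell\ge1$), $F=(F_\ell)_{\ell=1}^m$, let $B_1,\dots,B_m$ be independent random matrices with $B_\ell\sim F_\ell$, and $A=\frac{1}{\sqrt m}\begin{pmatrix}B_1\\ \vdots\\ B_m\end{pmatrix}$. Isotropy is assumed: $\mathbb{E}(A^*A)=\frac1m\sum_{\ell=1}^m\mathbb{E}(B_\ell^*B_\ell)=\mathrm{Id}_n$. For $T\subseteq\{1,\dots,n\}$, $P_T$ is the restriction $P_Tx=x_T$, $M_T:=MP_T^*$, $B_{\ell,T}=B_\ell P_T^*$, and $\Lambda(T,F)$ denotes any positive real number such that almost surely $\|B_{\ell,T}^*B_{\ell,T}\|_{2\to2}\le\Lambda(T,F)$ for all $\ell$. Random sign assumption: the vector $(x_i/|x_i|)_{i\in S}$ is a Rademacher sequence (independent uniform $\pm1$ entries) if $x$ is real, or a Steinhaus sequence (independent entries uniform on the complex unit circle) if $x$ is complex, independent of $A$. (BP): $\min_{z\in\mathbb{C}^n}\|z\|_1$ s.t. $Az=y$. (qBP): $\min_{z\in\mathbb{C}^n}\|z\|_1$ s.t. $\|y-Az\|_2\le\eta$. *)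

theory Defs
  imports "HOL-Probability.Probability" "Jordan_Normal_Form.Matrix"
begin

definition cadj :: "complex mat \<Rightarrow> complex mat" where
  "cadj B = mat (dim_col B) (dim_row B) (\<lambda>(i,j). cnj (B $$ (j,i)))"

definition l2norm :: "complex vec \<Rightarrow> real" where
  "l2norm v = sqrt (\<Sum>i<dim_vec v. (cmod (v $ i))\<^sup>2)"

definition l1norm :: "complex vec \<Rightarrow> real" where
  "l1norm v = (\<Sum>i<dim_vec v. cmod (v $ i))"

definition opnorm22 :: "complex mat \<Rightarrow> real" where
  "opnorm22 M = Sup {l2norm (M *\<^sub>v v) | v. v \<in> carrier_vec (dim_col M) \<and> l2norm v \<le> 1}"

definition embedT :: "nat \<Rightarrow> nat set \<Rightarrow> complex mat" where
  "embedT n T = mat n (card T) (\<lambda>(i,k). if i = sorted_list_of_set T ! k then 1 else 0)"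

definition restrT :: "complex mat \<Rightarrow> nat set \<Rightarrow> complex mat" where
  "restrT B T = B * embedT (dim_col B) T"

definition sensing_matrix :: "nat \<Rightarrow> nat \<Rightarrow> (nat \<Rightarrow> complex mat) \<Rightarrow> complex mat" where
  "sensing_matrix n m B =
     complex_of_real (1 / sqrt (real m)) \<cdot>\<^sub>m foldr (\<lambda>l M. B l @\<^sub>r M) [1..<m+1] (0\<^sub>m 0 n)"

definition rademacher :: "complex measure" where
  "rademacher = measure_pmf (pmf_of_set {1, -1})"

definition steinhaus :: "complex measure" where
  "steinhaus = distr (uniform_measure lborel {0..<2*pi}) borel (\<lambda>t. cis t)"

definition qBP_minimizer :: "complex mat \<Rightarrow> complex vec \<Rightarrow> real \<Rightarrow> complex vec \<Rightarrow> bool" where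
  "qBP_minimizer A y \<eta> z \<longleftrightarrow>
     z \<in> carrier_vec (dim_col A) \<and> l2norm (y - A *\<^sub>v z) \<le> \<eta> \<and>
     (\<forall>w \<in> carrier_vec (dim_col A). l2norm (y - A *\<^sub>v w) \<le> \<eta> \<longrightarrow> l1norm z \<le> l1norm w)"

definition BP_minimizer :: "complex mat \<Rightarrow> complex vec \<Rightarrow> complex vec \<Rightarrow> bool" where
  "BP_minimizer A y z \<longleftrightarrow>
     z \<in> carrier_vec (dim_col A) \<and> A *\<^sub>v z = y \<and>
     (\<forall>w \<in> carrier_vec (dim_col A). A *\<^sub>v w = y \<longrightarrow> l1norm z \<le> l1norm w)"

definition setting_ok ::
  "nat \<Rightarrow> nat \<Rightarrow> (nat \<Rightarrow> nat) \<Rightarrow> (nat \<Rightarrow> complex mat measure) \<Rightarrow> nat set \<Rightarrow> (nat set \<Rightarrow> real) \<Rightarrow> bool"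
  where
  "setting_ok n m p F S Lam \<longleftrightarrow>
     n \<ge> 1 \<and> m \<ge> 1 \<and>
     (\<forall>l \<in> {1..m}. p l \<ge> 1 \<and> prob_space (F l) \<and> space (F l) \<subseteq> carrier_mat (p l) n) \<and>
     \<comment> \<open>isotropy: (1/m) sum_l E(B_l^* B_l) = Id_n\<close>
     (\<forall>i<n. \<forall>k<n. (\<forall>l \<in> {1..m}. integrable (F l) (\<lambda>B. (cadj B * B) $$ (i,k))) \<and>
        (1 / of_nat m) * (\<Sum>l=1..m. (\<integral>B. (cadj B * B) $$ (i,k) \<partial>F l)) = (if i = k then 1 else (0::complex))) \<and>
     \<comment> \<open>Lam(S u {j}, F) for j in S^c: positive a.s. bounds\<close>
     (\<forall>j \<in> {0..<n} - S. Lam (S \<union> {j}) > 0 \<and>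
        (\<forall>l \<in> {1..m}. AE B in F l. opnorm22 (cadj (restrT B (S \<union> {j})) * restrT B (S \<union> {j})) \<le> Lam (S \<union> {j})))"

definition joint_law :: "nat \<Rightarrow> (nat \<Rightarrow> complex mat measure) \<Rightarrow> nat set \<Rightarrow> bool \<Rightarrow>
    ((nat \<Rightarrow> complex mat) \<times> (nat \<Rightarrow> complex)) measure" where
  "joint_law m F S real_case =
     (PiM {1..m} F) \<Otimes>\<^sub>M (PiM S (\<lambda>_. if real_case then rademacher else steinhaus))"

definition signal :: "nat \<Rightarrow> nat set \<Rightarrow> (nat \<Rightarrow> real) \<Rightarrow> (nat \<Rightarrow> complex) \<Rightarrow> complex vec" where
  "signal n S r \<sigma> = vec n (\<lambda>i. if i \<in> S then complex_of_real (r i) * \<sigma> i else 0)"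

definition sample_bound :: "nat \<Rightarrow> nat set \<Rightarrow> (nat set \<Rightarrow> real) \<Rightarrow> real \<Rightarrow> real" where
  "sample_bound n S Lam \<epsilon> =
     Max ((\<lambda>j. Lam (S \<union> {j})) ` ({0..<n} - S)) *
     ln (6 * (real (card S) + 1) * (real n - real (card S)) / \<epsilon>) * ln (6 * real n / \<epsilon>)"

end

theory Submission
  imports Defs "HOL-Library.Function_Algebras"
begin

text \<open>
  Write $X = A_T^*A_T - I$ for $T = S \cup \{j\}$, a centred sum of independent positive semidefinite
  matrices bounded by $R = \Lambda/m$. Resampling one summand at a time and the trace inequality
  $\mathrm{tr}\,(A-B)(A^{2p-1}-B^{2p-1}) \le \frac{2p-1}{2}\,\mathrm{tr}\,(A-B)^2(A^{2p-2}+B^{2p-2})$ give the recursion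
  $E\,\mathrm{tr} X^{2p} \le (2p-1) R\, E\,\mathrm{tr} (X+2)X^{2p-2}$; this replaces the matrix Bernstein inequality
  and needs no matrix exponentials. Markov's inequality at $p \approx \ln(6(s+1)(n-s)/\varepsilon)$ then yields
  $\|X\| < \delta$ with $1/\delta^2 \approx 1 + 2\ln(6n/\varepsilon)$. For such $X$ the regression coefficients
  $w_j = (A_S^*A_S)^{-1}A_S^*a_j$ satisfy $\|w_j\|^2 < \delta^2/(1-\delta^2)$, so the entries
  $\langle w_j, \mathrm{sgn}(x)\rangle$ of the dual vector $A^*A_S(A_S^*A_S)^{-1}\mathrm{sgn}(x)$ off $S$ have modulus below
  the required threshold by a Hoeffding-type bound over the random signs. This dual certificate forces exact and
  stable recovery.
\<close>

section \<open>Matrices over a finite index set\<close>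

text \<open>\<open>Lam\<close> controls only s+1 columns at a time, so a bound on all of A is out of
  reach. One matrix X per j still suffices: for T = S \<union> {j} it contains both
  \<open>A_S^* A_S - I\<close> and the coupling \<open>A_S^* a_j\<close>. Positivity closes the
  recursion: \<open>(Y - Y')^2\<close> is dominated by \<open>2 R (Y + Y')\<close>, and summing this
  over the blocks, with Y' averaged to its mean, produces X + 2. The odd trace that appears is
  absorbed by a weighted arithmetic-geometric mean. In the code d stands for delta^2. With L =
  ln(6n/eps), the choice d = 1/(1 + 2 kappa L) gives d/(1-d) = 1/(2 kappa L), so at threshold 1/sqrt
  kappa the sign tail is exactly 4 exp(-L). The union over j then costs at most eps/6 for the traces
  and 4 eps/6 for the signs. The explicit constant 19 forces every numerical constant to be tracked.
  Empty S is treated separately: the logarithms may then be too small for these estimates, but the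
  signal is zero.\<close>

definition mmul :: "nat set \<Rightarrow> (nat \<Rightarrow> nat \<Rightarrow> complex) \<Rightarrow> (nat \<Rightarrow> nat \<Rightarrow> complex) \<Rightarrow> nat \<Rightarrow> nat \<Rightarrow> complex" where
  "mmul T A B = (\<lambda>i j. \<Sum>k\<in>T. A i k * B k j)"

definition idm :: "nat set \<Rightarrow> nat \<Rightarrow> nat \<Rightarrow> complex" where
  "idm T = (\<lambda>i j. if i = j \<and> i \<in> T then 1 else 0)"

text \<open>The real part of the Hilbert-Schmidt inner product tr(\<open>A^* B\<close>); for
  Hermitian A it is Re tr(AB), so all traces of powers are expressed through it.\<close>

definition ip :: "nat set \<Rightarrow> (nat \<Rightarrow> nat \<Rightarrow> complex) \<Rightarrow> (nat \<Rightarrow> nat \<Rightarrow> complex) \<Rightarrow> real" where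
  "ip T A B = (\<Sum>i\<in>T. \<Sum>j\<in>T. Re (cnj (A i j) * B i j))"

definition herm :: "(nat \<Rightarrow> nat \<Rightarrow> complex) \<Rightarrow> bool" where
  "herm A \<longleftrightarrow> (\<forall>i j. A j i = cnj (A i j))"

text \<open>Matrices are total functions on pairs of naturals. Vanishing outside T makes
  \<open>idm T\<close> a two-sided unit, so that identities of matrices are equalities of
  functions.\<close>

definition supp :: "nat set \<Rightarrow> (nat \<Rightarrow> nat \<Rightarrow> complex) \<Rightarrow> bool" where
  "supp T A \<longleftrightarrow> (\<forall>i j. i \<notin> T \<or> j \<notin> T \<longrightarrow> A i j = 0)"

definition adj :: "(nat \<Rightarrow> nat \<Rightarrow> complex) \<Rightarrow> nat \<Rightarrow> nat \<Rightarrow> complex" where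
  "adj A = (\<lambda>i j. cnj (A j i))"

definition mpow :: "nat set \<Rightarrow> (nat \<Rightarrow> nat \<Rightarrow> complex) \<Rightarrow> nat \<Rightarrow> nat \<Rightarrow> nat \<Rightarrow> complex" where
  "mpow T A p = (mmul T A ^^ p) (idm T)"

lemma hermD: "herm A \<Longrightarrow> cnj (A i j) = A j i"
  unfolding herm_def by metis

lemma hermI: "(\<And>i j. cnj (A i j) = A j i) \<Longrightarrow> herm A"
  unfolding herm_def by metis

lemma mmul_assoc: "mmul T (mmul T A B) C = mmul T A (mmul T B C)"
proof (intro ext)
  fix i j
  have "(\<Sum>k\<in>T. (\<Sum>l\<in>T. A i l * B l k) * C k j) = (\<Sum>k\<in>T. \<Sum>l\<in>T. A i l * B l k * C k j)"
    by (simp add: sum_distrib_right)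
  also have "\<dots> = (\<Sum>l\<in>T. \<Sum>k\<in>T. A i l * B l k * C k j)"
    by (rule sum.swap)
  finally show "mmul T (mmul T A B) C i j = mmul T A (mmul T B C) i j"
    by (simp add: mmul_def sum_distrib_left mult.assoc)
qed

lemma mmul_add_left: "mmul T (A + B) C = mmul T A C + mmul T B C"
  and mmul_diff_left: "mmul T (A - B) C = mmul T A C - mmul T B C"
  and mmul_diff_right: "mmul T A (B - C) = mmul T A B - mmul T A C"
  by (auto simp: mmul_def fun_eq_iff sum.distrib sum_subtractf algebra_simps)

lemma mmul_zero_left [simp]: "mmul T 0 C = 0"
  by (auto simp: mmul_def fun_eq_iff)

lemma mmul_sum_left: "mmul T (\<Sum>k\<in>I. A k) C = (\<Sum>k\<in>I. mmul T (A k) C)"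
  by (induction I rule: infinite_finite_induct)
    (simp_all add: mmul_add_left del: plus_fun_apply zero_fun_apply)

lemma mmul_idm_right:
  assumes "finite T" "supp T A" shows "mmul T A (idm T) = A"
proof (intro ext)
  fix i j
  have "mmul T A (idm T) i j = (\<Sum>k\<in>T. if k = j then A i j else 0)"
    unfolding mmul_def idm_def by (intro sum.cong) auto
  then show "mmul T A (idm T) i j = A i j" using assms by (auto simp: supp_def)
qed

lemma mmul_idm_left:
  assumes "finite T" "supp T A" shows "mmul T (idm T) A = A"
proof (intro ext)
  fix i j
  have "mmul T (idm T) A i j = (\<Sum>k\<in>T. if k = i then A i j else 0)"
    unfolding mmul_def idm_def by (intro sum.cong) auto
  then show "mmul T (idm T) A i j = A i j" using assms by (auto simp: supp_def)
qed

lemma supp_idm [simp]: "supp T (idm T)"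
  by (auto simp: supp_def idm_def)

lemma supp_mmul: "supp T A \<Longrightarrow> supp T B \<Longrightarrow> supp T (mmul T A B)"
  by (auto simp: supp_def mmul_def)

lemma supp_mpow: "supp T A \<Longrightarrow> supp T (mpow T A p)"
  by (induction p) (auto simp: mpow_def supp_mmul)

lemma ip_commute: "ip T A B = ip T B A"
  unfolding ip_def by (intro sum.cong refl) (simp add: algebra_simps)

lemma ip_add_left: "ip T (A + B) C = ip T A C + ip T B C"
  and ip_add_right: "ip T A (B + C) = ip T A B + ip T A C"
  and ip_diff_left: "ip T (A - B) C = ip T A C - ip T B C"
  and ip_diff_right: "ip T A (B - C) = ip T A B - ip T A C"
  by (auto simp: ip_def sum.distrib sum_subtractf algebra_simps)

lemma ip_zero_left [simp]: "ip T 0 C = 0" and ip_zero_right [simp]: "ip T C 0 = 0"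
  by (auto simp: ip_def)

lemma ip_sum_right: "ip T C (\<Sum>k\<in>I. A k) = (\<Sum>k\<in>I. ip T C (A k))"
  by (induction I rule: infinite_finite_induct)
    (simp_all add: ip_add_right del: plus_fun_apply zero_fun_apply)

lemma ip_sum_left: "ip T (\<Sum>k\<in>I. A k) C = (\<Sum>k\<in>I. ip T (A k) C)"
  by (induction I rule: infinite_finite_induct)
    (simp_all add: ip_add_left del: plus_fun_apply zero_fun_apply)

lemma ip_self: "ip T A A = (\<Sum>i\<in>T. \<Sum>j\<in>T. (cmod (A i j))\<^sup>2)"
  unfolding ip_def by (intro sum.cong refl) (simp add: cmod_power2, simp add: power2_eq_square)

lemma ip_nonneg: "ip T A A \<ge> 0"
  unfolding ip_self by (intro sum_nonneg) auto

lemma ip_le: "2 * ip T A B \<le> ip T A A + ip T B B"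
proof -
  have "0 \<le> ip T (A - B) (A - B)" by (rule ip_nonneg)
  then show ?thesis by (simp add: ip_diff_left ip_diff_right ip_commute[of T B A])
qed

lemma ip_scale_left: "ip T (\<lambda>i j. complex_of_real c * A i j) B = c * ip T A B"
  by (simp add: ip_def sum_distrib_left algebra_simps)

lemma ip_cauchy: "(ip T A B)\<^sup>2 \<le> ip T A A * ip T B B"
proof -
  define a where "a = ip T A A" define b where "b = ip T B B" define x where "x = ip T A B"
  have q: "0 \<le> c\<^sup>2 * a - 2 * c * d * x + d\<^sup>2 * b" for c d
  proof -
    let ?A = "\<lambda>i j. complex_of_real c * A i j" and ?B = "\<lambda>i j. complex_of_real d * B i j"
    have "0 \<le> ip T (?A - ?B) (?A - ?B)" by (rule ip_nonneg)
    also have "\<dots> = ip T ?A ?A - 2 * ip T ?A ?B + ip T ?B ?B"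
      by (simp add: ip_diff_left ip_diff_right ip_commute[of T ?B ?A])
    also have "\<dots> = c\<^sup>2 * a - 2 * c * d * x + d\<^sup>2 * b"
      by (simp add: ip_scale_left ip_commute[of T _ ?A] ip_commute[of T _ ?B] a_def b_def x_def
          ip_commute[of T B A] power2_eq_square)
    finally show ?thesis .
  qed
  have a: "a \<ge> 0" and b: "b \<ge> 0" by (auto simp: a_def b_def ip_nonneg)
  have "x\<^sup>2 \<le> a * b"
  proof (cases "b = 0")
    case True
    have "x = 0"
    proof (rule ccontr)
      assume "x \<noteq> 0"
      \<comment> \<open>When b vanishes the form is linear in its second argument; this witness
        makes its value -1.\<close>
      have "0 \<le> a - 2 * ((a + 1) / (2 * x)) * x" using q[of 1 "(a+1)/(2*x)"] True by simp
      then show False using \<open>x \<noteq> 0\<close> by simp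
    qed
    then show ?thesis using True by simp
  next
    case False
    have "0 \<le> b * (a * b - x\<^sup>2)" using q[of b x] by (simp add: power2_eq_square algebra_simps)
    then show ?thesis using False b by (simp add: zero_le_mult_iff)
  qed
  then show ?thesis by (simp add: a_def b_def x_def)
qed

lemma ip_mmul_left:
  assumes "herm A" shows "ip T (mmul T A X) Y = ip T X (mmul T A Y)"
proof -
  have "ip T (mmul T A X) Y = (\<Sum>i\<in>T. \<Sum>j\<in>T. \<Sum>k\<in>T. Re (A k i * cnj (X k j) * Y i j))"
    by (simp only: ip_def mmul_def cnj_sum complex_cnj_mult hermD[OF assms] sum_distrib_right Re_sum)
  also have "\<dots> = (\<Sum>j\<in>T. \<Sum>i\<in>T. \<Sum>k\<in>T. Re (A k i * cnj (X k j) * Y i j))"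
    by (rule sum.swap)
  also have "\<dots> = (\<Sum>j\<in>T. \<Sum>k\<in>T. \<Sum>i\<in>T. Re (A k i * cnj (X k j) * Y i j))"
    by (intro sum.cong refl sum.swap)
  also have "\<dots> = (\<Sum>k\<in>T. \<Sum>j\<in>T. \<Sum>i\<in>T. Re (A k i * cnj (X k j) * Y i j))"
    by (rule sum.swap)
  also have "\<dots> = ip T X (mmul T A Y)"
    by (simp only: ip_def mmul_def sum_distrib_left Re_sum mult.assoc mult.left_commute)
  finally show ?thesis .
qed

lemma ip_adj: "ip T (adj X) (adj Y) = ip T X Y"
  unfolding ip_def adj_def by (subst sum.swap) (simp add: mult.commute)

lemma adj_mmul: "adj (mmul T X Y) = mmul T (adj Y) (adj X)"
  by (auto simp: adj_def mmul_def fun_eq_iff mult.commute)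

lemma adj_herm: "herm A \<Longrightarrow> adj A = A"
  by (simp add: adj_def hermD)

lemma herm_idm [simp]: "herm (idm T)"
  by (rule hermI) (auto simp: idm_def)

lemma herm_diff: "herm A \<Longrightarrow> herm B \<Longrightarrow> herm (A - B)"
  by (rule hermI) (simp add: hermD)

lemma herm_sum: "(\<And>k. k \<in> I \<Longrightarrow> herm (A k)) \<Longrightarrow> herm (\<Sum>k\<in>I. A k)"
  by (induction I rule: infinite_finite_induct) (auto intro!: hermI simp: hermD)

lemma supp_diff: "supp T A \<Longrightarrow> supp T B \<Longrightarrow> supp T (A - B)"
  by (auto simp: supp_def)

lemma supp_sum: "(\<And>k. k \<in> I \<Longrightarrow> supp T (A k)) \<Longrightarrow> supp T (\<Sum>k\<in>I. A k)"
  by (induction I rule: infinite_finite_induct) (auto simp: supp_def)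

lemma ip_mmul_right:
  assumes "herm B" shows "ip T (mmul T X B) Y = ip T X (mmul T Y B)"
proof -
  have "ip T (mmul T X B) Y = ip T (mmul T B (adj X)) (adj Y)"
    by (simp add: ip_adj[of T "mmul T X B", symmetric] adj_mmul adj_herm assms)
  also have "\<dots> = ip T (adj X) (adj (mmul T Y B))"
    by (simp add: adj_mmul adj_herm assms ip_mmul_left)
  finally show ?thesis by (simp add: ip_adj)
qed

section \<open>Iterated left and right multiplication as operators on matrices\<close>

lemma ip_lpow: "herm A \<Longrightarrow> ip T ((mmul T A ^^ p) X) Y = ip T X ((mmul T A ^^ p) Y)"
  by (induction p arbitrary: X Y) (auto simp: ip_mmul_left funpow_swap1)

lemma ip_rpow: "herm B \<Longrightarrow> ip T (((\<lambda>X. mmul T X B) ^^ p) X) Y = ip T X (((\<lambda>X. mmul T X B) ^^ p) Y)"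
proof (induction p arbitrary: X Y)
  case (Suc p)
  let ?f = "\<lambda>X. mmul T X B"
  have "ip T ((?f ^^ Suc p) X) Y = ip T ((?f ^^ p) X) (?f Y)"
    using Suc.prems by (simp add: ip_mmul_right)
  also have "\<dots> = ip T X ((?f ^^ p) (?f Y))" by (rule Suc.IH[OF Suc.prems])
  also have "(?f ^^ p) (?f Y) = (?f ^^ Suc p) Y" by (simp add: funpow_Suc_right del: funpow.simps)
  finally show ?case .
qed simp

lemma lpow_mmul: "(mmul T A ^^ p) (mmul T X Y) = mmul T ((mmul T A ^^ p) X) Y"
  by (induction p) (auto simp: mmul_assoc)

lemma rpow_mmul: "((\<lambda>X. mmul T X B) ^^ p) (mmul T X Y) = mmul T X (((\<lambda>X. mmul T X B) ^^ p) Y)"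
  by (induction p) (auto simp: mmul_assoc)

text \<open>Left multiplication by A and right multiplication by B commute by associativity even
  when A and B do not. This is what allows exponents of A and B to be added separately in
  expressions such as \<open>A^a D B^c\<close>.\<close>

lemma lpow_rpow_commute:
  "(mmul T A ^^ p) (((\<lambda>X. mmul T X B) ^^ q) X) = ((\<lambda>X. mmul T X B) ^^ q) ((mmul T A ^^ p) X)"
  by (induction q) (auto simp: lpow_mmul)

lemma lpow_diff: "(mmul T A ^^ p) (X - Y) = (mmul T A ^^ p) X - (mmul T A ^^ p) Y"
  by (induction p) (simp_all add: mmul_diff_right del: minus_apply)

lemma rpow_diff: "((\<lambda>X. mmul T X B) ^^ p) (X - Y) = ((\<lambda>X. mmul T X B) ^^ p) X - ((\<lambda>X. mmul T X B) ^^ p) Y"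
  by (induction p) (simp_all add: mmul_diff_left del: minus_apply)

lemma mpow_eq_rpow:
  assumes "finite T" "supp T A" shows "((\<lambda>X. mmul T X A) ^^ p) (idm T) = mpow T A p"
proof (induction p)
  case (Suc p)
  have "((\<lambda>X. mmul T X A) ^^ Suc p) (idm T) = mmul T ((mmul T A ^^ p) (idm T)) A"
    using Suc by (simp add: mpow_def)
  also have "\<dots> = (mmul T A ^^ p) (mmul T A (idm T))"
    using assms by (simp add: lpow_mmul[symmetric] mmul_idm_left mmul_idm_right)
  finally show ?case by (simp add: mpow_def funpow_swap1)
qed (simp add: mpow_def)

lemma rpow_eq_mmul:
  assumes "finite T" "supp T A" "supp T X" shows "((\<lambda>X. mmul T X A) ^^ p) X = mmul T X (mpow T A p)"
  using rpow_mmul[of p T A X "idm T"] mpow_eq_rpow[OF assms(1,2), of p] assms by (simp add: mmul_idm_right)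

lemma adj_lpow: "herm A \<Longrightarrow> adj ((mmul T A ^^ p) X) = ((\<lambda>X. mmul T X A) ^^ p) (adj X)"
  by (induction p) (auto simp: adj_mmul adj_herm)

text \<open>The increments are nondecreasing, so the increment at i dominates the average increment
  before i and is dominated by the average one after i. Multiplying through by M keeps the statement
  free of division.\<close>

lemma convex_seq_le_chord:
  fixes f :: "nat \<Rightarrow> real"
  assumes conv: "\<And>i. 0 < i \<Longrightarrow> i < M \<Longrightarrow> 2 * f i \<le> f (i - 1) + f (i + 1)" and "i \<le> M"
  shows "real M * f i \<le> real (M - i) * f 0 + real i * f M"
proof -
  have inc: "f (Suc j) - f j \<le> f (Suc k) - f k" if "j \<le> k" "k < M" for j k
    using that
  proof (induction k)
    case (Suc k)
    show ?case
    proof (cases "j = Suc k")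
      case False
      then have "f (Suc j) - f j \<le> f (Suc k) - f k" using Suc by auto
      also have "\<dots> \<le> f (Suc (Suc k)) - f (Suc k)" using conv[of "Suc k"] Suc.prems by auto
      finally show ?thesis .
    qed auto
  qed auto
  show ?thesis
  proof (cases "i = 0 \<or> i = M")
    case False
    then have i: "0 < i" "i < M" using assms by auto
    define d where "d = f (Suc i) - f i"
    have 1: "f i - f 0 = (\<Sum>j<i. f (Suc j) - f j)" by (simp add: sum_lessThan_telescope)
    have 2: "f M - f i = (\<Sum>j=i..<M. f (Suc j) - f j)" using i by (simp add: sum_Suc_diff')
    have a: "f i - f 0 \<le> real i * d"
      unfolding 1 d_def using sum_bounded_above[of "{..<i}" "\<lambda>j. f (Suc j) - f j" "f (Suc i) - f i"] inc i
      by auto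
    have b: "real (M - i) * d \<le> f M - f i"
      unfolding 2 d_def using sum_bounded_below[of "{i..<M}" "f (Suc i) - f i" "\<lambda>j. f (Suc j) - f j"] inc i
      by auto
    have "real (M - i) * (f i - f 0) \<le> real (M - i) * (real i * d)"
      by (intro mult_left_mono a) auto
    also have "\<dots> = real i * (real (M - i) * d)" by simp
    also have "\<dots> \<le> real i * (f M - f i)" by (intro mult_left_mono b) auto
    finally show ?thesis using i by (simp add: of_nat_diff algebra_simps)
  qed auto
qed

text \<open>The sequence $j \mapsto \mathrm{tr}(D A^j D B^{2M-j})$ is convex along even $j$ by
  Cauchy--Schwarz, and its odd terms are at most the average of their neighbours. So its sum, which
  is the left-hand side, is at most the trapezoidal bound from the two extreme terms.\<close>

lemma trace_power_diff_le:
  assumes T: "finite T" and A: "herm A" "supp T A" and B: "herm B" "supp T B"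
  defines "D \<equiv> A - B"
  shows "ip T D (mpow T A (2*M+1) - mpow T B (2*M+1)) \<le>
    (2 * real M + 1) / 2 * (ip T (mmul T D (mpow T A M)) (mmul T D (mpow T A M)) +
                  ip T (mmul T D (mpow T B M)) (mmul T D (mpow T B M)))"
proof -
  let ?L = "\<lambda>p. mmul T A ^^ p" and ?R = "\<lambda>p. (\<lambda>X. mmul T X B) ^^ p"
  define h where "h a c = ?L a (?R c D)" for a c
  define e where "e a c = ?L a (?R c (idm T))" for a c
  define g where "g j = ip T D (h j (2*M - j))" for j
  have D: "herm D" "supp T D" using A B by (auto simp: D_def herm_diff supp_diff)
  \<comment> \<open>Here \<open>h a c\<close> is \<open>A^a D B^c\<close>. Moving powers across the
    inner product shows that a pairing depends only on the two total exponents, so one term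
    \<open>g j\<close> can be factored in several ways.\<close>
  have gh: "ip T (h a c) (h a' c') = ip T D (h (a + a') (c + c'))" for a c a' c'
  proof -
    have "ip T (h a c) (h a' c') = ip T (?R c D) (?L a (?L a' (?R c' D)))"
      by (simp add: h_def ip_lpow[OF A(1)])
    also have "\<dots> = ip T (?R c D) (?R c' (?L (a + a') D))"
      by (simp add: lpow_rpow_commute funpow_add)
    also have "\<dots> = ip T D (?R (c + c') (?L (a + a') D))"
      by (simp add: ip_rpow[OF B(1)] funpow_add)
    finally show ?thesis by (simp add: h_def lpow_rpow_commute)
  qed
  \<comment> \<open>Splitting D = A - B turns the sum of all \<open>A^j D B^(2M-j)\<close> into a
    telescoping sum of the products \<open>A^a B^c\<close>.\<close>
  have hd: "h a c = e (Suc a) c - e a (Suc c)" for a c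
  proof -
    have "A = ?L 1 (idm T)" "B = ?R 1 (idm T)" using T A B by (auto simp: mmul_idm_left mmul_idm_right)
    then have "h a c = ?L a (?R c (?L 1 (idm T))) - ?L a (?R c (?R 1 (idm T)))"
      unfolding h_def D_def by (simp only: lpow_diff[symmetric] rpow_diff[symmetric])
    also have "\<dots> = e (Suc a) c - e a (Suc c)"
      unfolding e_def lpow_rpow_commute
      by (simp add: funpow_Suc_right funpow_swap1 del: funpow.simps)
    finally show ?thesis .
  qed
  have "(\<Sum>j\<le>2*M. h j (2*M - j)) = (\<Sum>j\<le>2*M. e (Suc j) (2*M - j) - e j (Suc (2*M) - j))"
  proof (intro sum.cong refl)
    fix j assume "j \<in> {..2*M}"
    then have "Suc (2*M - j) = Suc (2*M) - j" by auto
    then show "h j (2*M - j) = e (Suc j) (2*M - j) - e j (Suc (2*M) - j)" by (simp only: hd)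
  qed
  also have "\<dots> = (\<Sum>j<Suc (2*M). e (Suc j) (Suc (2*M) - Suc j) - e j (Suc (2*M) - j))"
    by (intro sum.cong) auto
  also have "\<dots> = e (2*M+1) 0 - e 0 (2*M+1)"
    by (subst sum_lessThan_telescope) auto
  also have "e (2*M+1) 0 = mpow T A (2*M+1)" by (simp add: e_def mpow_def)
  also have "e 0 (2*M+1) = mpow T B (2*M+1)"
    using mpow_eq_rpow[OF T B(2), of "2*M+1"] by (simp add: e_def)
  finally have lhs: "ip T D (mpow T A (2*M+1) - mpow T B (2*M+1)) = (\<Sum>j\<le>2*M. g j)"
    by (simp only: g_def ip_sum_right[symmetric])
  define f where "f i = g (2 * i)" for i
  have fe: "f i = ip T (h i (M - i)) (h i (M - i))" if "i \<le> M" for i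
    using that by (simp add: f_def g_def gh mult_2[symmetric] diff_mult_distrib2)
  have odd: "2 * g (2*i+1) \<le> f i + f (i+1)" if "i < M" for i
  proof -
    have "g (2*i+1) = ip T (h i (M - i)) (h (i+1) (M - (i+1)))"
    proof -
      have *: "i + (i + 1) = 2 * i + 1" "M - i + (M - (i + 1)) = 2 * M - (2 * i + 1)" using that by auto
      show ?thesis unfolding gh * g_def ..
    qed
    then show ?thesis using ip_le[of T "h i (M - i)" "h (i+1) (M - (i+1))"] that by (simp add: fe)
  qed
  \<comment> \<open>The exponents also split as (i-1) + (i+1), so \<open>f i\<close> is the inner
    product of the two neighbours, whose squared norms are \<open>f (i-1)\<close> and
    \<open>f (i+1)\<close>.\<close>
  have even: "2 * f i \<le> f (i - 1) + f (i + 1)" if "0 < i" "i < M" for i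
  proof -
    have *: "i - 1 + (i + 1) = 2 * i" "M - (i - 1) + (M - (i + 1)) = 2 * M - 2 * i" using that by auto
    have "f i = ip T (h (i-1) (M - (i-1))) (h (i+1) (M - (i+1)))"
      unfolding gh * f_def g_def by simp
    moreover have "i - 1 \<le> M" "i + 1 \<le> M" using that by auto
    ultimately show ?thesis using ip_le[of T "h (i-1) (M - (i-1))" "h (i+1) (M - (i+1))"]
      by (simp only: fe)
  qed
  have sum_eq: "(\<Sum>j\<le>2*M. g j) = (\<Sum>i\<le>M. f i) + (\<Sum>i<M. g (2*i+1))"
    by (induction M) (auto simp: f_def)
  \<comment> \<open>Sum of the chord bounds: both end values receive total weight M(M+1)/2.\<close>
  have fsum: "2 * (\<Sum>i\<le>M. f i) \<le> (real M + 1) * (f 0 + f M)"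
  proof (cases "M = 0")
    case False
    have "real M * (\<Sum>i\<le>M. f i) \<le> (\<Sum>i\<le>M. real (M - i) * f 0 + real i * f M)"
      unfolding sum_distrib_left by (intro sum_mono convex_seq_le_chord even) auto
    also have "\<dots> = (\<Sum>i\<le>M. real (M - i)) * f 0 + (\<Sum>i\<le>M. real i) * f M"
      by (simp add: sum.distrib sum_distrib_right)
    also have "(\<Sum>i\<le>M. real (M - i)) = (\<Sum>i\<le>M. real i)"
      by (rule sum.reindex_bij_witness[of _ "\<lambda>i. M - i" "\<lambda>i. M - i"]) auto
    also have "(\<Sum>i\<le>M. real i) = real M * (real M + 1) / 2"
      by (induction M) (auto simp: field_simps)
    finally have "real M * (2 * (\<Sum>i\<le>M. f i)) \<le> real M * ((real M + 1) * (f 0 + f M))"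
      by (simp add: field_simps)
    then show ?thesis using False by simp
  qed simp
  have "2 * (\<Sum>i<M. g (2*i+1)) \<le> (\<Sum>i<M. f i + f (i+1))"
    unfolding sum_distrib_left by (intro sum_mono odd) auto
  also have "\<dots> = 2 * (\<Sum>i\<le>M. f i) - f 0 - f M"
  proof -
    have "(\<Sum>i<M. f (i+1)) = (\<Sum>i\<le>M. f i) - f 0"
      by (induction M) auto
    moreover have "(\<Sum>i<M. f i) = (\<Sum>i\<le>M. f i) - f M"
      by (simp add: lessThan_Suc_atMost[symmetric])
    ultimately show ?thesis by (simp add: sum.distrib)
  qed
  \<comment> \<open>Even and odd terms together are at most 2 sum f - (f 0 + f M)/2, and twice the
    sum of f is at most (M+1)(f 0 + f M).\<close>
  finally have "(\<Sum>j\<le>2*M. g j) \<le> (2 * real M + 1) / 2 * (f M + f 0)"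
    using fsum unfolding sum_eq by (simp add: algebra_simps)
  moreover have "f 0 = ip T (mmul T D (mpow T B M)) (mmul T D (mpow T B M))"
    by (simp add: fe h_def rpow_eq_mmul[OF T B(2) D(2)])
  \<comment> \<open>The extreme term is \<open>A^M D\<close>, while the claim has
    \<open>D A^M\<close>; taking adjoints exchanges the two without changing the norm.\<close>
  moreover have "f M = ip T (mmul T D (mpow T A M)) (mmul T D (mpow T A M))"
  proof -
    have "f M = ip T (adj (?L M D)) (adj (?L M D))" by (simp add: fe h_def ip_adj)
    then show ?thesis by (simp add: adj_lpow A adj_herm D rpow_eq_mmul[OF T A(2) D(2)])
  qed
  ultimately show ?thesis using lhs by simp
qed

section \<open>Bounded measurable functions and resampling\<close>

text \<open>The bound holds everywhere and not merely almost surely, so the class is stable under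
  products and under composition with any measurable map, and its members are integrable for every
  probability measure.\<close>

definition bdd_meas :: "'a measure \<Rightarrow> ('a \<Rightarrow> 'b :: {banach, second_countable_topology}) \<Rightarrow> bool" where
  "bdd_meas M f \<longleftrightarrow> f \<in> borel_measurable M \<and> (\<exists>C. \<forall>x. norm (f x) \<le> C)"

lemma bdd_measI: "f \<in> borel_measurable M \<Longrightarrow> (\<And>x. norm (f x) \<le> C) \<Longrightarrow> bdd_meas M f"
  by (auto simp: bdd_meas_def)

lemma bdd_measD: "bdd_meas M f \<Longrightarrow> f \<in> borel_measurable M"
  by (simp add: bdd_meas_def)

lemma bdd_meas_const [intro!]: "bdd_meas M (\<lambda>_. c)"
  by (rule bdd_measI[of _ _ "norm c"]) auto

lemma bdd_meas_add [intro!]: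
  assumes "bdd_meas M f" "bdd_meas M g" shows "bdd_meas M (\<lambda>x. f x + g x)"
proof -
  obtain C D where "\<And>x. norm (f x) \<le> C" "\<And>x. norm (g x) \<le> D" using assms by (auto simp: bdd_meas_def)
  then have "\<And>x. norm (f x + g x) \<le> C + D" by (meson add_mono norm_triangle_le order_trans)
  then show ?thesis using assms by (intro bdd_measI[of _ _ "C + D"]) (auto simp: bdd_meas_def)
qed

lemma bdd_meas_uminus [intro!]: "bdd_meas M f \<Longrightarrow> bdd_meas M (\<lambda>x. - f x)"
  by (auto simp: bdd_meas_def)

lemma bdd_meas_diff [intro!]: "bdd_meas M f \<Longrightarrow> bdd_meas M g \<Longrightarrow> bdd_meas M (\<lambda>x. f x - g x)"
  using bdd_meas_add[of M f "\<lambda>x. - g x"] by auto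

lemma bdd_meas_mult [intro!]:
  fixes f g :: "'a \<Rightarrow> 'b :: {banach, second_countable_topology, real_normed_field}"
  assumes "bdd_meas M f" "bdd_meas M g" shows "bdd_meas M (\<lambda>x. f x * g x)"
proof -
  obtain C D where "\<And>x. norm (f x) \<le> C" "\<And>x. norm (g x) \<le> D" using assms by (auto simp: bdd_meas_def)
  then have "\<And>x. norm (f x * g x) \<le> C * D"
    by (simp add: norm_mult) (meson mult_mono norm_ge_zero order_trans)
  then show ?thesis using assms by (intro bdd_measI[of _ _ "C * D"]) (auto simp: bdd_meas_def)
qed

lemma bdd_meas_sum [intro!]: "(\<And>k. k \<in> I \<Longrightarrow> bdd_meas M (f k)) \<Longrightarrow> bdd_meas M (\<lambda>x. \<Sum>k\<in>I. f k x)"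
  by (induction I rule: infinite_finite_induct) auto

lemma bdd_meas_cnj [intro!]: "bdd_meas M f \<Longrightarrow> bdd_meas M (\<lambda>x. cnj (f x))"
  unfolding bdd_meas_def
  by (auto intro!: measurable_compose[of f M borel cnj] borel_measurable_continuous_onI continuous_intros)

lemma bdd_meas_Re [intro!]: "bdd_meas M f \<Longrightarrow> bdd_meas M (\<lambda>x. Re (f x))"
  by (auto simp: bdd_meas_def intro: order_trans[OF abs_Re_le_cmod])

lemma bdd_meas_compose: "bdd_meas M f \<Longrightarrow> g \<in> measurable N M \<Longrightarrow> bdd_meas N (\<lambda>x. f (g x))"
  by (auto simp: bdd_meas_def)

lemma bdd_meas_integrable: "prob_space M \<Longrightarrow> bdd_meas M f \<Longrightarrow> integrable M f"
  by (auto simp: bdd_meas_def intro!: finite_measure.integrable_const_bound prob_space.finite_measure)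

definition bdd_mat :: "'a measure \<Rightarrow> ('a \<Rightarrow> nat \<Rightarrow> nat \<Rightarrow> complex) \<Rightarrow> bool" where
  "bdd_mat M A \<longleftrightarrow> (\<forall>i j. bdd_meas M (\<lambda>x. A x i j))"

lemma bdd_mat_const [intro!]: "bdd_mat M (\<lambda>_. A)"
  by (auto simp: bdd_mat_def)

lemma bdd_mat_diff [intro!]: "bdd_mat M A \<Longrightarrow> bdd_mat M B \<Longrightarrow> bdd_mat M (\<lambda>x. A x - B x)"
  by (auto simp: bdd_mat_def)

lemma bdd_mat_sum [intro!]:
  assumes "\<And>k. k \<in> I \<Longrightarrow> bdd_mat M (A k)" shows "bdd_mat M (\<lambda>x. \<Sum>k\<in>I. A k x)"
proof -
  have "(\<Sum>k\<in>I. A k x) i j = (\<Sum>k\<in>I. A k x i j)" for x i j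
    by (induction I rule: infinite_finite_induct) auto
  then show ?thesis using assms by (auto simp: bdd_mat_def)
qed

lemma bdd_mat_mmul [intro!]: "bdd_mat M A \<Longrightarrow> bdd_mat M B \<Longrightarrow> bdd_mat M (\<lambda>x. mmul T (A x) (B x))"
  by (auto simp: bdd_mat_def mmul_def)

lemma bdd_mat_mpow [intro!]: "bdd_mat M A \<Longrightarrow> bdd_mat M (\<lambda>x. mpow T (A x) p)"
  by (induction p) (auto simp: mpow_def)

lemma bdd_mat_compose: "bdd_mat M A \<Longrightarrow> g \<in> measurable N M \<Longrightarrow> bdd_mat N (\<lambda>x. A (g x))"
  unfolding bdd_mat_def by (auto intro: bdd_meas_compose[of M "\<lambda>x. A x _ _"])

lemma bdd_meas_ip [intro!]: "bdd_mat M A \<Longrightarrow> bdd_mat M B \<Longrightarrow> bdd_meas M (\<lambda>x. ip T (A x) (B x))"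
  unfolding ip_def bdd_mat_def by (intro bdd_meas_sum bdd_meas_Re bdd_meas_mult bdd_meas_cnj) auto

lemma integral_ip_left:
  assumes "prob_space M" "bdd_mat M A"
  shows "(\<integral>x. ip T (A x) B \<partial>M) = ip T (\<lambda>i j. \<integral>x. A x i j \<partial>M) B"
proof -
  have i: "integrable M (\<lambda>x. A x i j)" for i j using assms by (auto simp: bdd_mat_def bdd_meas_integrable)
  have "(\<integral>x. ip T (A x) B \<partial>M) = (\<Sum>i\<in>T. \<Sum>j\<in>T. \<integral>x. Re (cnj (A x i j) * B i j) \<partial>M)"
    unfolding ip_def by (subst Bochner_Integration.integral_sum, simp add: i, intro sum.cong refl, subst Bochner_Integration.integral_sum) (auto simp: i)
  also have "\<dots> = ip T (\<lambda>i j. \<integral>x. A x i j \<partial>M) B"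
    unfolding ip_def using i by (intro sum.cong refl) (simp add: integral_cnj[symmetric] del: integral_cnj)
  finally show ?thesis .
qed

lemma integral_ip_mmul:
  assumes "prob_space M" "bdd_mat M A" "\<And>x. herm (A x)"
  shows "(\<integral>x. ip T W (mmul T (A x) W) \<partial>M) = ip T W (mmul T (\<lambda>i j. \<integral>x. A x i j \<partial>M) W)"
proof -
  have e: "ip T W (mmul T A W) = (\<Sum>i\<in>T. \<Sum>j\<in>T. \<Sum>k\<in>T. Re (cnj (W i j) * (A i k * W k j)))" for A
    by (simp only: ip_def mmul_def sum_distrib_left Re_sum)
  have i: "integrable M (\<lambda>x. A x i j)" for i j using assms by (auto simp: bdd_mat_def bdd_meas_integrable)
  have "(\<integral>x. ip T W (mmul T (A x) W) \<partial>M) =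
    (\<Sum>i\<in>T. \<Sum>j\<in>T. \<Sum>k\<in>T. \<integral>x. Re (cnj (W i j) * (A x i k * W k j)) \<partial>M)"
    unfolding e by (simp add: i del: complex_cnj_mult times_complex.sel)
  also have "\<dots> = ip T W (mmul T (\<lambda>i j. \<integral>x. A x i j \<partial>M) W)"
    unfolding e using i by (intro sum.cong refl) (simp del: times_complex.sel add: integral_Re[symmetric])
  finally show ?thesis .
qed

text \<open>Exchangeability of coordinate k and an independent copy of it: once the other
  coordinates are integrated last, Fubini swaps two variables with the same law.\<close>

lemma (in product_prob_space) integral_resample:
  fixes f :: "('i \<Rightarrow> 'a) \<times> 'a \<Rightarrow> real"
  assumes I: "finite I" "k \<in> I" and f: "bdd_meas (PiM I M \<Otimes>\<^sub>M M k) f"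
  shows "(\<integral>p. f ((fst p)(k := snd p), fst p k) \<partial>(PiM I M \<Otimes>\<^sub>M M k)) = (\<integral>p. f p \<partial>(PiM I M \<Otimes>\<^sub>M M k))"
proof -
  define J where "J = I - {k}"
  have IJ: "I = insert k J" "finite J" "k \<notin> J" using I by (auto simp: J_def)
  interpret P: prob_space "PiM I M" by (rule prob_space_PiM) (rule prob_space)
  interpret J: prob_space "PiM J M" by (rule prob_space_PiM) (rule prob_space)
  interpret PP: pair_prob_space "PiM I M" "M k" ..
  interpret KK: pair_prob_space "M k" "M k" ..
  have m: "(\<lambda>(x, z, y). (x(k := z), y)) \<in> measurable (PiM J M \<Otimes>\<^sub>M (M k \<Otimes>\<^sub>M M k)) (PiM I M \<Otimes>\<^sub>M M k)"
    unfolding IJ(1) by (auto simp: split_beta' intro!: measurable_Pair measurable_fun_upd[where J=J])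
  have sw: "(\<lambda>p. ((fst p)(k := snd p), fst p k)) \<in> measurable (PiM I M \<Otimes>\<^sub>M M k) (PiM I M \<Otimes>\<^sub>M M k)"
    using I(2) by (intro measurable_Pair measurable_fun_upd[where J=I] measurable_compose[OF measurable_fst measurable_component_singleton]) auto
  have ex: "(\<integral>p. g p \<partial>(PiM I M \<Otimes>\<^sub>M M k)) = (\<integral>x. (\<integral>z. (\<integral>y. g (x(k := z), y) \<partial>M k) \<partial>M k) \<partial>PiM J M)"
    if g: "bdd_meas (PiM I M \<Otimes>\<^sub>M M k) g" for g :: "('i \<Rightarrow> 'a) \<times> 'a \<Rightarrow> real"
  proof -
    have gi: "integrable (PiM I M \<Otimes>\<^sub>M M k) g" using g PP.prob_space_axioms by (rule bdd_meas_integrable[rotated])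
    have "(\<integral>p. g p \<partial>(PiM I M \<Otimes>\<^sub>M M k)) = (\<integral>x. (\<integral>y. g (x, y) \<partial>M k) \<partial>PiM I M)"
      by (rule PP.integral_fst'[symmetric, OF gi])
    also have "\<dots> = (\<integral>x. (\<integral>z. (\<integral>y. g (x(k := z), y) \<partial>M k) \<partial>M k) \<partial>PiM J M)"
      unfolding IJ(1)
      by (rule product_integral_insert[OF IJ(2,3)]) (use PP.integrable_fst'[OF gi] IJ(1) in simp)
    finally show ?thesis .
  qed
  have "(\<integral>p. f ((fst p)(k := snd p), fst p k) \<partial>(PiM I M \<Otimes>\<^sub>M M k)) =
      (\<integral>x. (\<integral>z. (\<integral>y. f (x(k := y), z) \<partial>M k) \<partial>M k) \<partial>PiM J M)"
    by (subst ex) (auto intro!: bdd_meas_compose[OF f] sw)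
  also have "\<dots> = (\<integral>x. (\<integral>y. (\<integral>z. f (x(k := y), z) \<partial>M k) \<partial>M k) \<partial>PiM J M)"
  proof (rule Bochner_Integration.integral_cong[OF refl])
    fix x assume x: "x \<in> space (PiM J M)"
    have "(\<lambda>p. (x(k := snd p), fst p)) \<in> measurable (M k \<Otimes>\<^sub>M M k) (PiM I M \<Otimes>\<^sub>M M k)"
      unfolding IJ(1) using x by (intro measurable_Pair measurable_fun_upd[where J=J]) auto
    then have "integrable (M k \<Otimes>\<^sub>M M k) (\<lambda>p. f (x(k := snd p), fst p))"
      by (intro bdd_meas_integrable bdd_meas_compose[OF f]) (rule KK.prob_space_axioms)
    then show "(\<integral>z. (\<integral>y. f (x(k := y), z) \<partial>M k) \<partial>M k) = (\<integral>y. (\<integral>z. f (x(k := y), z) \<partial>M k) \<partial>M k)"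
      by (intro KK.Fubini_integral[symmetric]) (simp add: split_beta')
  qed
  also have "\<dots> = (\<integral>p. f p \<partial>(PiM I M \<Otimes>\<^sub>M M k))"
    by (subst ex[OF f]) simp
  finally show ?thesis .
qed

section \<open>Moments of a sum of independent positive semidefinite matrices\<close>

lemma mpow_Suc: "mpow T A (Suc p) = mmul T A (mpow T A p)"
  by (simp add: mpow_def)

text \<open>Isolates a single factor of the even trace, which can then be expanded linearly into the
  centred summands.\<close>

lemma ip_mpow_Suc:
  assumes "finite T" "herm A" "supp T A"
  shows "ip T (mpow T A (Suc p)) (mpow T A (Suc p)) = ip T A (mpow T A (2 * p + 1))"
proof -
  have "mpow T A (Suc p) = (mmul T A ^^ p) A"
    using assms by (simp add: mpow_def funpow_Suc_right mmul_idm_right del: funpow.simps)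
  then have "ip T (mpow T A (Suc p)) (mpow T A (Suc p)) = ip T ((mmul T A ^^ p) A) (mpow T A (Suc p))"
    by (rule arg_cong)
  also have "\<dots> = ip T A ((mmul T A ^^ p) (mpow T A (Suc p)))"
    by (rule ip_lpow[OF assms(2)])
  also have "(mmul T A ^^ p) (mpow T A (Suc p)) = mpow T A (2 * p + 1)"
    by (simp only: mpow_def funpow_add[symmetric] comp_apply[symmetric, of "mmul T A ^^ p"])
      (simp add: mult_2)
  finally show ?thesis .
qed

lemma ip_diff_square_le: "ip T (A - B) (A - B) \<le> 2 * ip T A A + 2 * ip T B B"
proof -
  have "0 \<le> ip T (A + B) (A + B)" by (rule ip_nonneg)
  then show ?thesis
    by (simp add: ip_diff_left ip_diff_right ip_add_left ip_add_right ip_commute[of T B A])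
qed

lemma ip_minus_minus: "ip T (- A) (- B) = ip T A B"
  by (simp add: ip_def)

lemma mmul_minus_left: "mmul T (- A) B = - mmul T A B"
  by (simp add: mmul_def fun_eq_iff sum_negf)

text \<open>\<open>Y_psd\<close> encodes \<open>Y^2 <= R Y\<close>, that is, positive semidefinite
  with norm at most R, by testing against matrices W. This is the form in which the recursion uses
  it. \<open>Y_mean\<close> is isotropy.\<close>

locale psd_sum =
  product_prob_space F I for F :: "'k \<Rightarrow> 'a measure" and I :: "'k set" +
  fixes T :: "nat set" and Y :: "'k \<Rightarrow> 'a \<Rightarrow> nat \<Rightarrow> nat \<Rightarrow> complex" and R :: real
  assumes finite_T [simp]: "finite T" and finite_I [simp]: "finite I" and R_nonneg: "R \<ge> 0"
    and Y_bdd_meas: "k \<in> I \<Longrightarrow> bdd_mat (F k) (Y k)"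
    and herm_Y: "k \<in> I \<Longrightarrow> herm (Y k b)"
    and supp_Y: "k \<in> I \<Longrightarrow> supp T (Y k b)"
    and Y_psd: "k \<in> I \<Longrightarrow> ip T (mmul T (Y k b) W) (mmul T (Y k b) W) \<le> R * ip T W (mmul T (Y k b) W)"
    and Y_mean: "(\<Sum>k\<in>I. \<integral>b. Y k b i j \<partial>F k) = idm T i j"
begin

definition X :: "('k \<Rightarrow> 'a) \<Rightarrow> nat \<Rightarrow> nat \<Rightarrow> complex" where
  "X \<omega> = (\<Sum>k\<in>I. Y k (\<omega> k)) - idm T"

abbreviation "\<Omega> \<equiv> PiM I F"

text \<open>Since X is Hermitian, this is the expectation of tr \<open>X^(2p)\<close>.\<close>

definition mom :: "nat \<Rightarrow> real" where
  "mom p = (\<integral>\<omega>. ip T (mpow T (X \<omega>) p) (mpow T (X \<omega>) p) \<partial>\<Omega>)"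

sublocale P: prob_space \<Omega>
  by (rule prob_space_PiM) (rule prob_space)

lemma Y_coord_bdd_meas: "k \<in> I \<Longrightarrow> bdd_mat \<Omega> (\<lambda>\<omega>. Y k (\<omega> k))"
  by (rule bdd_mat_compose[OF Y_bdd_meas]) auto

lemma X_bdd_meas: "bdd_mat \<Omega> X"
  unfolding X_def[abs_def] using Y_coord_bdd_meas by auto

lemma herm_X: "herm (X \<omega>)"
  unfolding X_def by (intro herm_diff herm_sum herm_idm herm_Y)

lemma supp_X: "supp T (X \<omega>)"
  unfolding X_def by (intro supp_diff supp_sum supp_idm supp_Y)

lemma X_upd:
  assumes "k \<in> I" shows "X \<omega> - X (fun_upd \<omega> k y) = Y k (\<omega> k) - Y k y"
proof -
  have "X \<omega> - X (fun_upd \<omega> k y) = (\<Sum>l\<in>I. Y l (\<omega> l)) - (\<Sum>l\<in>I. Y l ((fun_upd \<omega> k y) l))"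
    unfolding X_def by (simp only: diff_diff_eq2 diff_add_cancel)
  also have "\<dots> = (\<Sum>l\<in>I. if l = k then Y k (\<omega> k) - Y k y else 0)"
    unfolding sum_subtractf[symmetric] by (intro sum.cong) auto
  also have "\<dots> = Y k (\<omega> k) - Y k y"
    by (simp only: sum.delta finite_I assms if_True)
  finally show ?thesis .
qed

lemma bdd_meas_mpow: "bdd_meas \<Omega> (\<lambda>\<omega>. ip T (mpow T (X \<omega>) p) (mpow T (X \<omega>) p))"
  using X_bdd_meas by auto

lemma mom_0: "mom 0 = real (card T)"
proof -
  have "ip T (idm T) (idm T) = (\<Sum>i\<in>T. \<Sum>j\<in>T. if j = i then 1 else 0)"
    unfolding ip_def idm_def by (intro sum.cong refl) auto
  also have "\<dots> = real (card T)" by simp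
  finally show ?thesis by (simp add: mom_def mpow_def P.prob_space)
qed

definition mean :: "'k \<Rightarrow> nat \<Rightarrow> nat \<Rightarrow> complex" where
  "mean k = (\<lambda>i j. \<integral>b. Y k b i j \<partial>F k)"

lemma sum_mean: "(\<Sum>k\<in>I. mean k) = idm T"
proof (intro ext)
  fix i j
  have "(\<Sum>k\<in>I. mean k) i j = (\<Sum>k\<in>I. mean k i j)"
    by (induction I rule: infinite_finite_induct) auto
  then show "(\<Sum>k\<in>I. mean k) i j = idm T i j" by (simp add: mean_def Y_mean)
qed

text \<open>Exchangeable pairs: \<open>Y k (\<omega> k) - mean k\<close> may be replaced by \<open>Y k (\<omega> k) - Y k y\<close> with an independent
  copy \<open>y\<close>, and then antisymmetrised by swapping \<open>\<omega> k\<close> and \<open>y\<close>.\<close>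

lemma coord_moment_le:
  assumes k: "k \<in> I"
  shows "(\<integral>\<omega>. ip T (Y k (\<omega> k) - mean k) (mpow T (X \<omega>) (2*q+1)) \<partial>\<Omega>) \<le>
    (2 * real q + 1) * R * (\<integral>\<omega>. ip T (mpow T (X \<omega>) q) (mmul T (Y k (\<omega> k)) (mpow T (X \<omega>) q)) +
       ip T (mpow T (X \<omega>) q) (mmul T (mean k) (mpow T (X \<omega>) q)) \<partial>\<Omega>)"
proof -
  interpret PP: pair_prob_space \<Omega> "F k" ..
  let ?N = "\<Omega> \<Otimes>\<^sub>M F k"
  let ?W = "\<lambda>\<omega>. mpow T (X \<omega>) q"
  let ?D = "\<lambda>p. Y k (fst p k) - Y k (snd p)"
  define sw where "sw p = ((fst p)(k := snd p), fst p k)" for p :: "('k \<Rightarrow> 'a) \<times> 'a"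
  define f where "f p = ip T (?D p) (mpow T (X (fst p)) (2*q+1))" for p
  define g where "g p = ip T (mmul T (?D p) (?W (fst p))) (mmul T (?D p) (?W (fst p)))" for p
  have sw: "sw \<in> measurable ?N ?N" unfolding sw_def[abs_def]
    using k by (intro measurable_Pair measurable_fun_upd[where J=I] measurable_compose[OF measurable_fst measurable_component_singleton]) auto
  have Yf: "bdd_mat ?N (\<lambda>p. Y k (fst p k))" using Y_coord_bdd_meas[OF k] by (rule bdd_mat_compose) auto
  have Ys: "bdd_mat ?N (\<lambda>p. Y k (snd p))" using Y_bdd_meas[OF k] by (rule bdd_mat_compose) auto
  have Xf: "bdd_mat ?N (\<lambda>p. X (fst p))" using X_bdd_meas by (rule bdd_mat_compose) auto
  have f: "bdd_meas ?N f" unfolding f_def[abs_def] using Yf Ys Xf by auto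
  have g: "bdd_meas ?N g" unfolding g_def[abs_def] using Yf Ys Xf by auto
  note PPi = bdd_meas_integrable[OF PP.prob_space_axioms]
  have res: "(\<integral>p. h (sw p) \<partial>?N) = (\<integral>p. h p \<partial>?N)" if "bdd_meas ?N h" for h :: "_ \<Rightarrow> real"
    using integral_resample[OF finite_I k that] by (simp add: sw_def)
  have "(\<integral>\<omega>. ip T (Y k (\<omega> k) - mean k) (mpow T (X \<omega>) (2*q+1)) \<partial>\<Omega>) = (\<integral>\<omega>. (\<integral>y. f (\<omega>, y) \<partial>F k) \<partial>\<Omega>)"
  proof (rule Bochner_Integration.integral_cong[OF refl])
    fix \<omega>
    have "(\<integral>y. f (\<omega>, y) \<partial>F k) = ip T (\<lambda>i j. \<integral>y. (Y k (\<omega> k) - Y k y) i j \<partial>F k) (mpow T (X \<omega>) (2*q+1))"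
      unfolding f_def fst_conv snd_conv
      by (rule integral_ip_left) (use Y_bdd_meas[OF k] prob_space in auto)
    also have "(\<lambda>i j. \<integral>y. (Y k (\<omega> k) - Y k y) i j \<partial>F k) = Y k (\<omega> k) - mean k"
      using Y_bdd_meas[OF k] prob_space[of k]
      by (auto simp: fun_eq_iff mean_def bdd_mat_def bdd_meas_integrable prob_space.prob_space)
    finally show "ip T (Y k (\<omega> k) - mean k) (mpow T (X \<omega>) (2*q+1)) = (\<integral>y. f (\<omega>, y) \<partial>F k)" ..
  qed
  also have "\<dots> = (\<integral>p. f p \<partial>?N)" by (rule PP.integral_fst'[OF PPi[OF f]])
  also have "\<dots> = (\<integral>p. (f p + f (sw p)) / 2 \<partial>?N)"
    using res[OF f] PPi[OF f] PPi[OF bdd_meas_compose[OF f sw]] by simp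
  \<comment> \<open>The swap flips the sign of the difference of the summands and exchanges X with
    its resampled version, so the two values of f combine into the left-hand side of
    \<open>trace_power_diff_le\<close>. The factor 1/4 is its 1/2 times the 1/2 from
    averaging.\<close>
  also have "\<dots> \<le> (\<integral>p. (2 * real q + 1) / 4 * (g p + g (sw p)) \<partial>?N)"
  proof (rule integral_mono)
    fix p :: "('k \<Rightarrow> 'a) \<times> 'a"
    let ?A = "X (fst p)" and ?B = "X ((fst p)(k := snd p))"
    have BA: "?B - ?A = - (?A - ?B)" by (simp only: minus_diff_eq)
    have D1: "?A - ?B = ?D p" by (rule X_upd[OF k])
    have "?D (sw p) = - ?D p" by (simp only: sw_def fst_conv snd_conv fun_upd_same minus_diff_eq)
    then have D: "?A - ?B = ?D p" "?D (sw p) = ?B - ?A" unfolding BA D1 by auto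
    from BA have neg: "mmul T (?B - ?A) W = - mmul T (?A - ?B) W" for W
      by (simp only: mmul_minus_left)
    have "f p + f (sw p) = ip T (?A - ?B) (mpow T ?A (2*q+1)) + ip T (?B - ?A) (mpow T ?B (2*q+1))"
      unfolding f_def D by (simp add: D sw_def del: minus_apply)
    also have "\<dots> = ip T (?A - ?B) (mpow T ?A (2*q+1) - mpow T ?B (2*q+1))"
      by (simp add: ip_diff_left ip_diff_right)
    also have "\<dots> \<le> (2 * real q + 1) / 2 * (ip T (mmul T (?A - ?B) (?W (fst p))) (mmul T (?A - ?B) (?W (fst p)))
        + ip T (mmul T (?A - ?B) (mpow T ?B q)) (mmul T (?A - ?B) (mpow T ?B q)))"
      by (rule trace_power_diff_le) (auto simp: herm_X supp_X)
    also have "\<dots> = (2 * real q + 1) / 2 * (g p + g (sw p))"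
      unfolding g_def D unfolding neg by (simp only: sw_def D fst_conv ip_minus_minus)
    finally show "(f p + f (sw p)) / 2 \<le> (2 * real q + 1) / 4 * (g p + g (sw p))" by simp
  qed (use PPi[OF f] PPi[OF g] PPi[OF bdd_meas_compose[OF f sw]] PPi[OF bdd_meas_compose[OF g sw]] in auto)
  also have "\<dots> = (2 * real q + 1) / 2 * (\<integral>p. g p \<partial>?N)"
    using res[OF g] PPi[OF g] PPi[OF bdd_meas_compose[OF g sw]] by simp
  finally have 1: "(\<integral>\<omega>. ip T (Y k (\<omega> k) - mean k) (mpow T (X \<omega>) (2*q+1)) \<partial>\<Omega>) \<le> (2 * real q + 1) / 2 * (\<integral>p. g p \<partial>?N)" .
  \<comment> \<open>Uses \<open>(Y - Y')^2 <= 2 Y^2 + 2 Y'^2 <= 2 R (Y + Y')\<close>; integrating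
    out the copy then replaces Y' by its mean.\<close>
  have "(\<integral>p. g p \<partial>?N) \<le> (\<integral>p. 2 * R * (ip T (?W (fst p)) (mmul T (Y k (fst p k)) (?W (fst p)))
       + ip T (?W (fst p)) (mmul T (Y k (snd p)) (?W (fst p)))) \<partial>?N)"
  proof (rule integral_mono)
    show "g p \<le> 2 * R * (ip T (?W (fst p)) (mmul T (Y k (fst p k)) (?W (fst p)))
       + ip T (?W (fst p)) (mmul T (Y k (snd p)) (?W (fst p))))" for p
      unfolding g_def mmul_diff_left
      using ip_diff_square_le[of T "mmul T (Y k (fst p k)) (?W (fst p))" "mmul T (Y k (snd p)) (?W (fst p))"]
        Y_psd[OF k, of "fst p k" "?W (fst p)"] Y_psd[OF k, of "snd p" "?W (fst p)"]
      by (simp add: algebra_simps)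
    show "integrable ?N g" by (rule PPi[OF g])
    show "integrable ?N (\<lambda>p. 2 * R * (ip T (?W (fst p)) (mmul T (Y k (fst p k)) (?W (fst p)))
       + ip T (?W (fst p)) (mmul T (Y k (snd p)) (?W (fst p)))))"
      using Yf Ys Xf by (intro PPi) auto
  qed
  also have "\<dots> = (\<integral>\<omega>. (\<integral>y. 2 * R * (ip T (?W \<omega>) (mmul T (Y k (\<omega> k)) (?W \<omega>))
       + ip T (?W \<omega>) (mmul T (Y k y) (?W \<omega>))) \<partial>F k) \<partial>\<Omega>)"
    by (subst PP.integral_fst'[symmetric]) (use Yf Ys Xf in \<open>auto intro!: PPi\<close>)
  also have "\<dots> = (\<integral>\<omega>. 2 * R * (ip T (?W \<omega>) (mmul T (Y k (\<omega> k)) (?W \<omega>))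
       + ip T (?W \<omega>) (mmul T (mean k) (?W \<omega>))) \<partial>\<Omega>)"
  proof (rule Bochner_Integration.integral_cong[OF refl])
    fix \<omega>
    have i: "integrable (F k) (\<lambda>y. ip T (?W \<omega>) (mmul T (Y k y) (?W \<omega>)))"
      using Y_bdd_meas[OF k] prob_space[of k] by (intro bdd_meas_integrable) auto
    have "(\<integral>y. ip T (?W \<omega>) (mmul T (Y k y) (?W \<omega>)) \<partial>F k) = ip T (?W \<omega>) (mmul T (mean k) (?W \<omega>))"
      unfolding mean_def by (rule integral_ip_mmul) (use Y_bdd_meas[OF k] herm_Y[OF k] prob_space[of k] in auto)
    then show "(\<integral>y. 2 * R * (ip T (?W \<omega>) (mmul T (Y k (\<omega> k)) (?W \<omega>)) + ip T (?W \<omega>) (mmul T (Y k y) (?W \<omega>))) \<partial>F k)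
      = 2 * R * (ip T (?W \<omega>) (mmul T (Y k (\<omega> k)) (?W \<omega>)) + ip T (?W \<omega>) (mmul T (mean k) (?W \<omega>)))"
      using i prob_space.prob_space[OF prob_space[of k]] finite_measure.integrable_const[OF prob_space.finite_measure[OF prob_space[of k]]] by simp
  qed
  also have "\<dots> = 2 * R * (\<integral>\<omega>. ip T (?W \<omega>) (mmul T (Y k (\<omega> k)) (?W \<omega>))
       + ip T (?W \<omega>) (mmul T (mean k) (?W \<omega>)) \<partial>\<Omega>)"
    by simp
  finally have "(2 * real q + 1) / 2 * (\<integral>p. g p \<partial>?N) \<le> (2 * real q + 1) / 2 * (2 * R * (\<integral>\<omega>. ip T (?W \<omega>) (mmul T (Y k (\<omega> k)) (?W \<omega>))
       + ip T (?W \<omega>) (mmul T (mean k) (?W \<omega>)) \<partial>\<Omega>))"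
    by (intro mult_left_mono) auto
  note 2 = order_trans[OF 1 this]
  have "(2 * real q + 1) / 2 * (2 * R * J) = (2 * real q + 1) * R * J" for J by simp
  from ord_le_eq_trans[OF 2 this] show ?thesis .
qed

text \<open>Sum of the coordinate bounds: the Y add up to X + I and their means to I, so the
  quadratic form becomes that of X + 2.\<close>

lemma mom_Suc_le:
  "mom (Suc q) \<le> (2 * real q + 1) * R *
    ((\<integral>\<omega>. ip T (mpow T (X \<omega>) q) (mpow T (X \<omega>) (Suc q)) \<partial>\<Omega>) + 2 * mom q)"
proof -
  note i = bdd_meas_integrable[OF P.prob_space_axioms]
  let ?W = "\<lambda>\<omega>. mpow T (X \<omega>) q"
  have "mom (Suc q) = (\<integral>\<omega>. ip T (X \<omega>) (mpow T (X \<omega>) (2*q+1)) \<partial>\<Omega>)"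
    unfolding mom_def by (simp only: ip_mpow_Suc[OF finite_T herm_X supp_X])
  also have "\<dots> = (\<integral>\<omega>. (\<Sum>k\<in>I. ip T (Y k (\<omega> k) - mean k) (mpow T (X \<omega>) (2*q+1))) \<partial>\<Omega>)"
    unfolding ip_sum_left[symmetric] sum_subtractf sum_mean X_def ..
  also have "\<dots> = (\<Sum>k\<in>I. \<integral>\<omega>. ip T (Y k (\<omega> k) - mean k) (mpow T (X \<omega>) (2*q+1)) \<partial>\<Omega>)"
    by (rule Bochner_Integration.integral_sum, rule i) (use X_bdd_meas Y_coord_bdd_meas in auto)
  also have "\<dots> \<le> (\<Sum>k\<in>I. (2 * real q + 1) * R * (\<integral>\<omega>. ip T (?W \<omega>) (mmul T (Y k (\<omega> k)) (?W \<omega>)) +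
       ip T (?W \<omega>) (mmul T (mean k) (?W \<omega>)) \<partial>\<Omega>))"
    by (intro sum_mono coord_moment_le)
  also have "\<dots> = (2 * real q + 1) * R * (\<integral>\<omega>. (\<Sum>k\<in>I. ip T (?W \<omega>) (mmul T (Y k (\<omega> k)) (?W \<omega>)) +
       ip T (?W \<omega>) (mmul T (mean k) (?W \<omega>))) \<partial>\<Omega>)"
    unfolding sum_distrib_left[symmetric]
    by (subst Bochner_Integration.integral_sum, rule i) (use X_bdd_meas Y_coord_bdd_meas in auto)
  also have "(\<lambda>\<omega>. \<Sum>k\<in>I. ip T (?W \<omega>) (mmul T (Y k (\<omega> k)) (?W \<omega>)) + ip T (?W \<omega>) (mmul T (mean k) (?W \<omega>)))
     = (\<lambda>\<omega>. ip T (?W \<omega>) (mpow T (X \<omega>) (Suc q)) + 2 * ip T (?W \<omega>) (?W \<omega>))"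
  proof
    fix \<omega>
    have s: "(\<Sum>k\<in>I. Y k (\<omega> k)) = X \<omega> + idm T" by (simp add: X_def)
    have w: "mmul T (idm T) (?W \<omega>) = ?W \<omega>" by (intro mmul_idm_left supp_mpow supp_X finite_T)
    show "(\<Sum>k\<in>I. ip T (?W \<omega>) (mmul T (Y k (\<omega> k)) (?W \<omega>)) + ip T (?W \<omega>) (mmul T (mean k) (?W \<omega>)))
      = ip T (?W \<omega>) (mpow T (X \<omega>) (Suc q)) + 2 * ip T (?W \<omega>) (?W \<omega>)"
      unfolding sum.distrib ip_sum_right[symmetric] mmul_sum_left[symmetric] sum_mean s mmul_add_left w
      by (simp add: ip_add_right mpow_Suc del: plus_fun_apply)
  qed
  also have "(\<integral>\<omega>. ip T (?W \<omega>) (mpow T (X \<omega>) (Suc q)) + 2 * ip T (?W \<omega>) (?W \<omega>) \<partial>\<Omega>) =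
      (\<integral>\<omega>. ip T (?W \<omega>) (mpow T (X \<omega>) (Suc q)) \<partial>\<Omega>) + 2 * mom q"
    unfolding mom_def using X_bdd_meas
    by (subst Bochner_Integration.integral_add) (auto intro!: i)
  finally show ?thesis .
qed

text \<open>The trace of the odd power \<open>X^(2q+1)\<close> has no sign. It is bounded by lam tr
  \<open>X^(2q+2)\<close> + tr \<open>X^(2q)\<close> / (4 lam), and the first term is moved to the
  left.\<close>

lemma mom_recursion:
  assumes lam: "lam > 0"
  shows "(1 - (2 * real q + 1) * R * lam) * mom (Suc q) \<le> (2 * real q + 1) * (R * (2 + 1 / (4 * lam))) * mom q"
proof -
  note i = bdd_meas_integrable[OF P.prob_space_axioms]
  have "ip T A B \<le> lam * ip T B B + 1 / (4 * lam) * ip T A A" for A B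
  proof -
    let ?C = "\<lambda>i j. complex_of_real (2 * lam) * B i j"
    have "2 * ip T A ?C \<le> ip T A A + ip T ?C ?C" by (rule ip_le)
    moreover have r: "ip T D ?C = 2 * lam * ip T D B" for D
      using ip_scale_left[of T "2 * lam" B D] by (simp only: ip_commute[of T D])
    moreover have "ip T ?C B = 2 * lam * ip T B B" by (rule ip_scale_left)
    ultimately have "4 * lam * ip T A B \<le> ip T A A + 4 * lam * (lam * ip T B B)"
      by (simp only: r)
    then show ?thesis using lam by (simp add: field_simps)
  qed
  then have "(\<integral>\<omega>. ip T (mpow T (X \<omega>) q) (mpow T (X \<omega>) (Suc q)) \<partial>\<Omega>) \<le>
    (\<integral>\<omega>. lam * ip T (mpow T (X \<omega>) (Suc q)) (mpow T (X \<omega>) (Suc q))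
      + 1 / (4 * lam) * ip T (mpow T (X \<omega>) q) (mpow T (X \<omega>) q) \<partial>\<Omega>)"
    by (intro integral_mono i bdd_meas_add bdd_meas_mult bdd_meas_const bdd_meas_ip bdd_mat_mpow X_bdd_meas)
  also have "\<dots> = lam * mom (Suc q) + 1 / (4 * lam) * mom q"
    unfolding mom_def using i[OF bdd_meas_mpow] by (subst Bochner_Integration.integral_add) auto
  finally have "(2 * real q + 1) * R * ((\<integral>\<omega>. ip T (mpow T (X \<omega>) q) (mpow T (X \<omega>) (Suc q)) \<partial>\<Omega>) + 2 * mom q)
     \<le> (2 * real q + 1) * R * (lam * mom (Suc q) + 1 / (4 * lam) * mom q + 2 * mom q)"
    using R_nonneg by (intro mult_left_mono) auto
  then show ?thesis using mom_Suc_le[of q] by (simp add: algebra_simps)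
qed

text \<open>The left coefficient in the recursion is smallest at q = P - 1, where it contains 2P -
  1; with \<open>small\<close> every step multiplies the moment by at most (2q+1)V. The product of
  the odd numbers is then bounded by \<open>P^P\<close>.\<close>

lemma mom_le_power:
  assumes V: "V \<ge> 0" and lam: "lam > 0"
    and small: "R * (2 + 1 / (4 * lam)) \<le> V * (1 - (2 * real P - 1) * R * lam)"
    and pos: "(2 * real P - 1) * R * lam < 1"
  shows "mom P \<le> real (card T) * (real P * V) ^ P"
proof -
  have mom_nonneg: "mom p \<ge> 0" for p
    unfolding mom_def by (intro Bochner_Integration.integral_nonneg) (auto simp: ip_nonneg)
  have step: "mom (Suc q) \<le> (2 * real q + 1) * V * mom q" if "q < P" for q
  proof -
    let ?x = "1 - (2 * real q + 1) * R * lam"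
    have "(2 * real q + 1) * (R * lam) \<le> (2 * real P - 1) * (R * lam)"
      using that R_nonneg lam by (intro mult_right_mono) auto
    then have x: "?x \<ge> 1 - (2 * real P - 1) * R * lam" by (simp add: algebra_simps)
    then have xpos: "?x > 0" using pos by linarith
    have "R * (2 + 1 / (4 * lam)) \<le> V * ?x"
      using small mult_left_mono[OF x V] by linarith
    then have "(2 * real q + 1) * (R * (2 + 1 / (4 * lam))) * mom q \<le> (2 * real q + 1) * (V * ?x) * mom q"
      using mom_nonneg by (intro mult_right_mono mult_left_mono) auto
    with mom_recursion[OF lam, of q] have "?x * mom (Suc q) \<le> ?x * ((2 * real q + 1) * V * mom q)"
      by (simp add: algebra_simps)
    then show ?thesis using xpos by simp
  qed
  have "mom q \<le> real (card T) * (real q * V) ^ q" if "q \<le> P" for q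
    using that
  proof (induction q)
    case (Suc q)
    have "mom (Suc q) \<le> (2 * real q + 1) * V * mom q" using step Suc.prems by auto
    also have "\<dots> \<le> (2 * real q + 1) * V * (real (card T) * (real q * V) ^ q)"
      using Suc V by (intro mult_left_mono) auto
    also have "\<dots> = real (card T) * V ^ Suc q * ((2 * real q + 1) * real q ^ q)"
      by (simp add: power_mult_distrib)
    \<comment> \<open>Bernoulli gives \<open>2 q^q <= (q+1)^q\<close>, and 2q + 1 is at most 2(q+1).
      The case q = 0 relies on \<open>0 ^ 0 = 1\<close>.\<close>
    also have "(2 * real q + 1) * real q ^ q \<le> real (Suc q) ^ Suc q"
    proof (cases "q = 0")
      case False
      have "1 + real q * (1 / real q) \<le> (1 + 1 / real q) ^ q"
        by (rule Bernoulli_inequality) (rule order_trans[of _ 0], auto)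
      then have "2 * real q ^ q \<le> ((1 + 1 / real q) * real q) ^ q"
        using False by (simp add: power_mult_distrib)
      also have "(1 + 1 / real q) * real q = real (Suc q)" using False by (simp add: field_simps)
      finally have "real (Suc q) * (2 * real q ^ q) \<le> real (Suc q) * real (Suc q) ^ q" by (intro mult_left_mono) auto
      moreover have "(2 * real q + 1) * real q ^ q \<le> real (Suc q) * (2 * real q ^ q)"
        by (simp add: algebra_simps)
      ultimately show ?thesis unfolding power_Suc by (rule order_trans[rotated])
    qed simp
    then have "real (card T) * V ^ Suc q * ((2 * real q + 1) * real q ^ q) \<le> real (card T) * V ^ Suc q * real (Suc q) ^ Suc q"
      using V by (intro mult_left_mono) auto
    finally show ?case by (simp only: power_mult_distrib mult_ac)
  qed (simp add: mom_0)
  then show ?thesis by simp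
qed

end

section \<open>From trace moments to contractions\<close>

lemma ip_self_mmul_le:
  assumes "finite T"
  shows "ip T (mmul T A B) (mmul T A B) \<le> ip T A A * ip T B B"
proof -
  have "(cmod (mmul T A B i j))\<^sup>2 \<le> (\<Sum>k\<in>T. (cmod (A i k))\<^sup>2) * (\<Sum>k\<in>T. (cmod (B k j))\<^sup>2)" for i j
  proof -
    have "cmod (mmul T A B i j) \<le> (\<Sum>k\<in>T. cmod (A i k) * cmod (B k j))"
      unfolding mmul_def by (rule order_trans[OF norm_sum]) (simp add: norm_mult)
    then have "(cmod (mmul T A B i j))\<^sup>2 \<le> (\<Sum>k\<in>T. cmod (A i k) * cmod (B k j))\<^sup>2"
      by (rule power_mono) simp
    also have "\<dots> \<le> (\<Sum>k\<in>T. (cmod (A i k))\<^sup>2) * (\<Sum>k\<in>T. (cmod (B k j))\<^sup>2)"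
      by (rule Cauchy_Schwarz_ineq_sum)
    finally show ?thesis .
  qed
  then have "ip T (mmul T A B) (mmul T A B) \<le>
      (\<Sum>i\<in>T. \<Sum>j\<in>T. (\<Sum>k\<in>T. (cmod (A i k))\<^sup>2) * (\<Sum>k\<in>T. (cmod (B k j))\<^sup>2))"
    unfolding ip_self by (intro sum_mono) auto
  also have "\<dots> = ip T A A * (\<Sum>j\<in>T. \<Sum>k\<in>T. (cmod (B k j))\<^sup>2)"
    unfolding ip_self by (simp only: sum_product)
  also have "(\<Sum>j\<in>T. \<Sum>k\<in>T. (cmod (B k j))\<^sup>2) = ip T B B"
    unfolding ip_self by (rule sum.swap)
  finally show ?thesis .
qed

text \<open>Passes from a trace bound to an operator bound without eigenvalues. The squared norms
  \<open>a i\<close> of \<open>X^i V\<close> are log-convex by Cauchy-Schwarz, so the first ratio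
  \<open>a 1 / a 0\<close> is the smallest, and its P-th power is at most \<open>a P / a 0\<close>,
  which the Hilbert-Schmidt norm of \<open>X^P\<close> controls. Here d bounds the square of the
  norm.\<close>

lemma ip_mmul_less:
  assumes T: "finite T" and X: "herm X" "supp T X" and V: "supp T V" "0 < ip T V V"
    and P: "P > 0" and d: "d \<ge> 0" and less: "ip T (mpow T X P) (mpow T X P) < d ^ P"
  shows "ip T (mmul T X V) (mmul T X V) < d * ip T V V"
proof -
  define a where "a i = ip T ((mmul T X ^^ i) V) ((mmul T X ^^ i) V)" for i
  have a_nonneg: "a i \<ge> 0" for i by (simp add: a_def ip_nonneg)
  have logconv: "(a (Suc i))\<^sup>2 \<le> a i * a (Suc (Suc i))" for i
  proof -
    have "a (Suc i) = ip T ((mmul T X ^^ i) V) ((mmul T X ^^ Suc (Suc i)) V)"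
      by (simp add: a_def ip_mmul_left[OF X(1)])
    then show ?thesis unfolding a_def by (simp only: ip_cauchy)
  qed
  have ratio: "a 1 * a i \<le> a 0 * a (Suc i)" for i
  proof (induction i)
    case (Suc i)
    show ?case
    proof (cases "a i = 0")
      case True
      then have "a (Suc i) = 0" using logconv[of i] by simp
      then show ?thesis using a_nonneg by simp
    next
      case False
      then have ai: "a i > 0" using a_nonneg[of i] by simp
      have "a i * (a 1 * a (Suc i)) = (a 1 * a i) * a (Suc i)" by simp
      also have "\<dots> \<le> (a 0 * a (Suc i)) * a (Suc i)" by (intro mult_right_mono Suc a_nonneg)
      also have "\<dots> = a 0 * (a (Suc i))\<^sup>2" by (simp add: power2_eq_square)
      also have "\<dots> \<le> a 0 * (a i * a (Suc (Suc i)))" by (intro mult_left_mono logconv a_nonneg)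
      finally have "a i * (a 1 * a (Suc i)) \<le> a i * (a 0 * a (Suc (Suc i)))" by (simp add: mult_ac)
      then show ?thesis using ai by simp
    qed
  qed (simp add: mult.commute)
  have pw: "a 1 ^ Suc p \<le> a (Suc p) * a 0 ^ p" for p
  proof (induction p)
    case (Suc p)
    have "a 1 ^ Suc (Suc p) \<le> a 1 * (a (Suc p) * a 0 ^ p)"
      using Suc a_nonneg[of 1] by (simp only: power_Suc mult_left_mono)
    also have "\<dots> = (a 1 * a (Suc p)) * a 0 ^ p" by simp
    also have "\<dots> \<le> (a 0 * a (Suc (Suc p))) * a 0 ^ p"
      by (intro mult_right_mono ratio zero_le_power a_nonneg)
    finally show ?case by (simp add: mult_ac)
  qed simp
  obtain p where p: "P = Suc p" using P gr0_implies_Suc by blast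
  have "a P \<le> ip T (mpow T X P) (mpow T X P) * a 0"
  proof -
    have "(mmul T X ^^ P) V = mmul T (mpow T X P) V"
      using lpow_mmul[of P T X "idm T" V] by (simp add: mmul_idm_left[OF T V(1)] mpow_def)
    then show ?thesis using ip_self_mmul_le[OF T, of "mpow T X P" V] by (simp add: a_def)
  qed
  also have "\<dots> < d ^ P * a 0" using less V(2) by (simp add: a_def)
  finally have "a P * a 0 ^ p < d ^ P * a 0 * a 0 ^ p" using V(2) by (simp add: a_def)
  then have "a 1 ^ P < (d * a 0) ^ P"
    using pw[of p] by (simp add: p power_mult_distrib mult_ac)
  then have "a 1 < d * a 0" by (rule power_less_imp_less_base) (simp add: d a_nonneg)
  then show ?thesis by (simp add: a_def)
qed

section \<open>Vectors over a finite index set and the Neumann series\<close>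

definition nv :: "nat set \<Rightarrow> (nat \<Rightarrow> complex) \<Rightarrow> real" where
  "nv T v = (\<Sum>i\<in>T. (cmod (v i))\<^sup>2)"

definition mv :: "nat set \<Rightarrow> (nat \<Rightarrow> nat \<Rightarrow> complex) \<Rightarrow> (nat \<Rightarrow> complex) \<Rightarrow> nat \<Rightarrow> complex" where
  "mv T A v = (\<lambda>i. \<Sum>k\<in>T. A i k * v k)"

lemma nv_nonneg: "nv T v \<ge> 0"
  by (auto simp: nv_def intro: sum_nonneg)

text \<open>Vector form of \<open>ip_mmul_less\<close>: the vector is placed in a single column j of
  an otherwise zero matrix.\<close>

lemma nv_mv_less:
  assumes T: "finite T" and X: "herm X" "supp T X" and v: "0 < nv T v"
    and P: "P > 0" and d: "d \<ge> 0" and less: "ip T (mpow T X P) (mpow T X P) < d ^ P"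
  shows "nv T (mv T X v) < d * nv T v"
proof -
  have "T \<noteq> {}" using v by (auto simp: nv_def)
  then obtain j where j: "j \<in> T" by blast
  define E where "E u = (\<lambda>i k. if k = j \<and> i \<in> T then u i else 0)" for u :: "nat \<Rightarrow> complex"
  have ipE: "ip T (E u) (E u) = nv T u" for u
  proof -
    have "ip T (E u) (E u) = (\<Sum>i\<in>T. \<Sum>k\<in>T. if k = j then (cmod (u i))\<^sup>2 else 0)"
      unfolding ip_self E_def by (intro sum.cong refl) auto
    then show ?thesis using T j by (simp add: nv_def)
  qed
  have "mmul T X (E v) = E (mv T X v)"
    using X(2) by (auto simp: mmul_def E_def mv_def supp_def fun_eq_iff intro!: sum.cong)
  moreover have "supp T (E v)" using j by (auto simp: supp_def E_def)
  ultimately show ?thesis using ip_mmul_less[OF T X, of "E v" P d] assms by (simp add: ipE)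
qed

text \<open>The Neumann series of the inverse of I + H applied to c. An explicit series, unlike a
  chosen solution of the linear system, is visibly measurable in H and c.\<close>

definition neumann :: "nat set \<Rightarrow> (nat \<Rightarrow> nat \<Rightarrow> complex) \<Rightarrow> (nat \<Rightarrow> complex) \<Rightarrow> nat \<Rightarrow> complex" where
  "neumann S H c i = (\<Sum>p. (-1) ^ p * (mv S H ^^ p) c i)"

lemma nv_le_sum: "finite S \<Longrightarrow> i \<in> S \<Longrightarrow> (cmod (v i))\<^sup>2 \<le> nv S v"
  unfolding nv_def by (rule member_le_sum) auto

lemma neumann_solves:
  assumes S: "finite S" and d: "0 \<le> d" "d < 1" and H: "\<And>v. nv S (mv S H v) \<le> d\<^sup>2 * nv S v"
    and i: "i \<in> S"
  shows "neumann S H c i + mv S H (neumann S H c) i = c i"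
proof -
  let ?t = "\<lambda>p i. (-1) ^ p * (mv S H ^^ p) c i"
  have nvp: "nv S ((mv S H ^^ p) c) \<le> (d ^ p)\<^sup>2 * nv S c" for p
  proof (induction p)
    case (Suc p)
    have "nv S ((mv S H ^^ Suc p) c) \<le> d\<^sup>2 * nv S ((mv S H ^^ p) c)" using H by simp
    also have "\<dots> \<le> d\<^sup>2 * ((d ^ p)\<^sup>2 * nv S c)" by (intro mult_left_mono Suc) auto
    finally show ?case by (simp add: power_mult_distrib)
  qed simp
  have sm: "summable (\<lambda>p. ?t p j)" if "j \<in> S" for j
  proof (rule summable_comparison_test')
    show "summable (\<lambda>p. sqrt (nv S c) * d ^ p)" using d by (intro summable_mult summable_geometric) auto
    show "norm (?t p j) \<le> sqrt (nv S c) * d ^ p" if "p \<ge> 0" for p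
    proof -
      have "(cmod ((mv S H ^^ p) c j))\<^sup>2 \<le> (d ^ p)\<^sup>2 * nv S c"
        using nv_le_sum[OF S \<open>j \<in> S\<close>] nvp by (rule order_trans)
      also have "\<dots> = (sqrt (nv S c) * d ^ p)\<^sup>2" by (simp add: power_mult_distrib nv_nonneg)
      finally have "cmod ((mv S H ^^ p) c j) \<le> sqrt (nv S c) * d ^ p"
        by (rule power2_le_imp_le) (use d nv_nonneg in auto)
      then show ?thesis by (simp add: norm_mult norm_power)
    qed
  qed
  have "mv S H (neumann S H c) i = (\<Sum>k\<in>S. \<Sum>p. H i k * ?t p k)"
    unfolding mv_def[of S H "neumann S H c"] neumann_def using sm
    by (intro sum.cong refl) (simp add: suminf_mult)
  also have "\<dots> = (\<Sum>p. \<Sum>k\<in>S. H i k * ?t p k)"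
    using sm by (intro suminf_sum[symmetric] summable_mult)
  \<comment> \<open>Applying H to a term gives the next term with opposite sign, so H maps the
    series to minus its tail.\<close>
  also have "(\<lambda>p. \<Sum>k\<in>S. H i k * ?t p k) = (\<lambda>p. - ?t (Suc p) i)"
    by (rule ext) (simp add: mv_def sum_distrib_left sum_negf mult_ac)
  also have "(\<Sum>p. - ?t (Suc p) i) = - (\<Sum>p. ?t (Suc p) i)"
    using sm[OF i] by (intro suminf_minus) (subst summable_Suc_iff)
  also have "(\<Sum>p. ?t (Suc p) i) = neumann S H c i - c i"
    using suminf_split_head[OF sm[OF i]] by (simp add: neumann_def)
  finally show ?thesis by simp
qed

section \<open>Recovery from a dual certificate\<close>

definition gram :: "nat \<Rightarrow> (nat \<Rightarrow> nat \<Rightarrow> complex) \<Rightarrow> nat \<Rightarrow> nat \<Rightarrow> complex" where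
  "gram N a i k = (\<Sum>r<N. cnj (a r i) * a r k)"

definition lin :: "nat set \<Rightarrow> (nat \<Rightarrow> nat \<Rightarrow> complex) \<Rightarrow> (nat \<Rightarrow> complex) \<Rightarrow> nat \<Rightarrow> complex" where
  "lin T a z r = (\<Sum>i\<in>T. a r i * z i)"

definition nrm :: "nat \<Rightarrow> (nat \<Rightarrow> complex) \<Rightarrow> real" where
  "nrm N f = L2_set (\<lambda>r. cmod (f r)) {..<N}"

lemma nrm_nonneg: "nrm N f \<ge> 0"
  by (simp add: nrm_def L2_set_nonneg)

lemma nrm_triangle: "nrm N (\<lambda>r. f r + g r) \<le> nrm N f + nrm N g"
proof -
  have "nrm N (\<lambda>r. f r + g r) \<le> L2_set (\<lambda>r. cmod (f r) + cmod (g r)) {..<N}"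
    unfolding nrm_def by (intro L2_set_mono norm_triangle_ineq) auto
  also have "\<dots> \<le> nrm N f + nrm N g" unfolding nrm_def by (rule L2_set_triangle_ineq)
  finally show ?thesis .
qed

lemma nrm_scale: "nrm N (\<lambda>r. f r * c) = cmod c * nrm N f"
  by (simp add: nrm_def norm_mult mult.commute L2_set_right_distrib)

lemma nrm_sum: "finite T \<Longrightarrow> nrm N (\<lambda>r. \<Sum>j\<in>T. f j r) \<le> (\<Sum>j\<in>T. nrm N (f j))"
proof (induction T rule: finite_induct)
  case empty
  then show ?case by (simp add: nrm_def L2_set_def)
next
  case (insert x F)
  then show ?case using nrm_triangle[of N "f x" "\<lambda>r. \<Sum>j\<in>F. f j r"] by simp
qed

lemma nrm_power2: "(nrm N f)\<^sup>2 = (\<Sum>r<N. (cmod (f r))\<^sup>2)"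
  by (simp add: nrm_def L2_set_def sum_nonneg)

lemma nrm_inner_le: "cmod (\<Sum>r<N. cnj (f r) * g r) \<le> nrm N f * nrm N g"
  unfolding nrm_def by (rule order_trans[OF norm_sum], rule order_trans[OF _ L2_set_mult_ineq])
    (simp add: norm_mult)

lemma gram_cnj: "cnj (gram N a i k) = gram N a k i"
  by (simp add: gram_def mult.commute)

text \<open>The adjoint identity between the inner product of \<open>A_S b\<close> with
  \<open>A_T h\<close> and that of \<open>A_T^* A_S b\<close> with h. It links the dual vector to
  the measurements of the error h.\<close>

lemma inner_lin:
  "(\<Sum>r<N. cnj (lin S a b r) * lin T a h r) = (\<Sum>i\<in>T. cnj (\<Sum>k\<in>S. gram N a i k * b k) * h i)"
proof -
  have "(\<Sum>r<N. cnj (lin S a b r) * lin T a h r) = (\<Sum>r<N. \<Sum>k\<in>S. \<Sum>i\<in>T. cnj (b k) * cnj (a r k) * a r i * h i)"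
    unfolding lin_def by (simp add: sum_distrib_left sum_distrib_right mult_ac)
  also have "\<dots> = (\<Sum>r<N. \<Sum>i\<in>T. \<Sum>k\<in>S. cnj (b k) * cnj (a r k) * a r i * h i)"
    by (intro sum.cong refl sum.swap)
  also have "\<dots> = (\<Sum>i\<in>T. \<Sum>r<N. \<Sum>k\<in>S. cnj (b k) * cnj (a r k) * a r i * h i)" by (rule sum.swap)
  also have "\<dots> = (\<Sum>i\<in>T. \<Sum>k\<in>S. \<Sum>r<N. cnj (b k) * cnj (a r k) * a r i * h i)"
    by (intro sum.cong refl sum.swap)
  also have "\<dots> = (\<Sum>i\<in>T. cnj (\<Sum>k\<in>S. gram N a i k * b k) * h i)"
    unfolding cnj_sum complex_cnj_mult gram_cnj by (simp add: gram_def sum_distrib_left sum_distrib_right mult_ac)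
  finally show ?thesis .
qed

text \<open>Here b solves \<open>A_S^* A_S b = \<sigma>\<close>, so \<open>u = A^* A_S b\<close> is
  the dual vector: it equals the sign vector on S. The contraction hypothesis says that
  \<open>A_S^* A_S\<close> is within d of the identity in operator norm.\<close>

locale dual_certificate =
  fixes N n :: nat and a :: "nat \<Rightarrow> nat \<Rightarrow> complex" and S :: "nat set" and \<sigma> b :: "nat \<Rightarrow> complex" and d :: real
  assumes S: "S \<subseteq> {..<n}" and \<sigma>: "i \<in> S \<Longrightarrow> cmod (\<sigma> i) = 1" and d: "0 \<le> d" "d < 1"
    and contraction: "nv S (mv S (\<lambda>i k. gram N a i k - (if i = k then 1 else 0)) v) \<le> d\<^sup>2 * nv S v"
    and b: "i \<in> S \<Longrightarrow> (\<Sum>k\<in>S. gram N a i k * b k) = \<sigma> i"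
begin

definition u :: "nat \<Rightarrow> complex" where "u j = (\<Sum>k\<in>S. gram N a j k * b k)"

lemma finite_S: "finite S"
  using S finite_subset by blast

lemma gram_split: "i \<in> S \<Longrightarrow> (\<Sum>k\<in>S. gram N a i k * v k) = v i + mv S (\<lambda>i k. gram N a i k - (if i = k then 1 else 0)) v i"
proof -
  assume i: "i \<in> S"
  have "(\<Sum>k\<in>S. (if i = k then 1 else 0) * v k) = (\<Sum>k\<in>S. if k = i then v i else 0)"
    by (intro sum.cong) auto
  then show ?thesis using i finite_S by (simp add: mv_def algebra_simps sum_subtractf)
qed

text \<open>On S, projecting each entry onto its sign gives a gain of at least Re(cnj \<sigma> h).
  The sum of these gains is rewritten through u as the pairing of \<open>A_S b\<close> with
  \<open>A h\<close>, minus the part of u off S, which the entries of h off S pay for when u is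
  small there.\<close>

lemma l1_lower:
  assumes r: "\<And>i. i \<in> S \<Longrightarrow> r i > 0"
  shows "(\<Sum>i<n. cmod ((if i \<in> S then of_real (r i) * \<sigma> i else 0) + h i)) \<ge>
    (\<Sum>i<n. cmod (if i \<in> S then of_real (r i) * \<sigma> i else 0))
     + (\<Sum>j\<in>{..<n}-S. (1 - cmod (u j)) * cmod (h j)) - nrm N (lin S a b) * nrm N (lin {..<n} a h)"
proof -
  have split: "(\<Sum>i<n. f i) = (\<Sum>i\<in>S. f i) + (\<Sum>j\<in>{..<n}-S. f j)" for f :: "nat \<Rightarrow> real"
    using S by (simp add: sum.subset_diff add.commute)
  have split': "(\<Sum>i<n. f i) = (\<Sum>i\<in>S. f i) + (\<Sum>j\<in>{..<n}-S. f j)" for f :: "nat \<Rightarrow> complex"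
    using S by (simp add: sum.subset_diff add.commute)
  have on: "cmod (of_real (r i) * \<sigma> i + h i) \<ge> r i + Re (cnj (\<sigma> i) * h i)" if i: "i \<in> S" for i
  proof -
    have "cnj (\<sigma> i) * \<sigma> i = 1" using \<sigma>[OF i] by (simp add: mult.commute complex_norm_square[symmetric])
    then have "cnj (\<sigma> i) * (of_real (r i) * \<sigma> i + h i) = complex_of_real (r i) + cnj (\<sigma> i) * h i"
      by (simp add: algebra_simps)
    then have "r i + Re (cnj (\<sigma> i) * h i) \<le> cmod (cnj (\<sigma> i) * (of_real (r i) * \<sigma> i + h i))"
      using complex_Re_le_cmod[of "complex_of_real (r i) + cnj (\<sigma> i) * h i"] by simp
    then show ?thesis using \<sigma>[OF i] by (simp add: norm_mult)
  qed
  have "(\<Sum>i<n. cnj (u i) * h i) = (\<Sum>i\<in>S. cnj (\<sigma> i) * h i) + (\<Sum>j\<in>{..<n}-S. cnj (u j) * h j)"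
    unfolding split' by (simp add: u_def b)
  then have e: "(\<Sum>i\<in>S. cnj (\<sigma> i) * h i) =
      (\<Sum>r<N. cnj (lin S a b r) * lin {..<n} a h r) - (\<Sum>j\<in>{..<n}-S. cnj (u j) * h j)"
    unfolding inner_lin u_def[symmetric] by simp
  have e1: "Re (\<Sum>r<N. cnj (lin S a b r) * lin {..<n} a h r) \<ge> - (nrm N (lin S a b) * nrm N (lin {..<n} a h))"
    using nrm_inner_le[of "lin S a b" "lin {..<n} a h" N]
      abs_Re_le_cmod[of "\<Sum>r<N. cnj (lin S a b r) * lin {..<n} a h r"] by linarith
  have e2: "Re (\<Sum>j\<in>{..<n}-S. cnj (u j) * h j) \<le> (\<Sum>j\<in>{..<n}-S. cmod (u j) * cmod (h j))"
    by (rule order_trans[OF complex_Re_le_cmod], rule order_trans[OF norm_sum]) (simp add: norm_mult)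
  have "(\<Sum>i\<in>S. Re (cnj (\<sigma> i) * h i)) \<ge> - (nrm N (lin S a b) * nrm N (lin {..<n} a h))
      - (\<Sum>j\<in>{..<n}-S. cmod (u j) * cmod (h j))"
    using e1 e2 by (simp only: Re_sum[symmetric] e minus_complex.sel)
  moreover have "(\<Sum>i\<in>S. r i) + (\<Sum>i\<in>S. Re (cnj (\<sigma> i) * h i)) \<le> (\<Sum>i\<in>S. cmod (of_real (r i) * \<sigma> i + h i))"
    unfolding sum.distrib[symmetric] by (intro sum_mono on)
  moreover have "(\<Sum>i\<in>S. cmod (of_real (r i) * \<sigma> i)) = (\<Sum>i\<in>S. r i)"
    using r \<sigma> by (intro sum.cong refl) (simp add: norm_mult less_imp_le)
  ultimately show ?thesis
    unfolding split by (simp add: left_diff_distrib sum_subtractf)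
qed

lemma nv_le_gram:
  shows "(1 - d) * sqrt (nv S v) \<le> sqrt (nv S (\<lambda>i. \<Sum>k\<in>S. gram N a i k * v k))"
proof -
  let ?H = "\<lambda>i k. gram N a i k - (if i = k then 1 else 0)"
  have L: "sqrt (nv S f) = L2_set (\<lambda>i. cmod (f i)) S" for f by (simp add: nv_def L2_set_def)
  have "sqrt (nv S v) \<le> L2_set (\<lambda>i. cmod (\<Sum>k\<in>S. gram N a i k * v k) + cmod (mv S ?H v i)) S"
    unfolding L
  proof (rule L2_set_mono)
    fix i assume "i \<in> S"
    then have "v i = (\<Sum>k\<in>S. gram N a i k * v k) - mv S ?H v i" by (simp add: gram_split)
    from arg_cong[OF this, of cmod] norm_triangle_ineq4[of "\<Sum>k\<in>S. gram N a i k * v k" "mv S ?H v i"]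
    show "cmod (v i) \<le> cmod (\<Sum>k\<in>S. gram N a i k * v k) + cmod (mv S ?H v i)" by linarith
  qed auto
  also have "\<dots> \<le> sqrt (nv S (\<lambda>i. \<Sum>k\<in>S. gram N a i k * v k)) + sqrt (nv S (mv S ?H v))"
    unfolding L by (rule L2_set_triangle_ineq)
  also have "sqrt (nv S (mv S ?H v)) \<le> d * sqrt (nv S v)"
    using real_sqrt_le_mono[OF contraction[of v]] d by (simp add: real_sqrt_mult)
  finally show ?thesis by (simp add: algebra_simps)
qed

lemma lin_power2: "(nrm N (lin S a v))\<^sup>2 = (\<Sum>i\<in>S. Re (cnj (\<Sum>k\<in>S. gram N a i k * v k) * v i))"
proof -
  have "(nrm N (lin S a v))\<^sup>2 = Re (\<Sum>r<N. cnj (lin S a v r) * lin S a v r)"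
    unfolding nrm_power2 Re_sum
    by (intro sum.cong refl) (simp add: cmod_power2, simp add: power2_eq_square)
  then show ?thesis by (simp only: inner_lin Re_sum)
qed

text \<open>Quantitative injectivity of A on vectors supported on S: it recovers the part of the
  error on S once the part off S is under control.\<close>

lemma lin_lower: "(1 - d) * nv S v \<le> (nrm N (lin S a v))\<^sup>2"
proof -
  let ?H = "\<lambda>i k. gram N a i k - (if i = k then 1 else 0)"
  have L: "sqrt (nv S f) = L2_set (\<lambda>i. cmod (f i)) S" for f by (simp add: nv_def L2_set_def)
  have "(\<Sum>i\<in>S. cmod (mv S ?H v i) * cmod (v i)) \<le> sqrt (nv S (mv S ?H v)) * sqrt (nv S v)"
    unfolding L by (rule order_trans[OF _ L2_set_mult_ineq]) simp
  also have "\<dots> \<le> (d * sqrt (nv S v)) * sqrt (nv S v)"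
    using real_sqrt_le_mono[OF contraction[of v]] d by (intro mult_right_mono) (auto simp: real_sqrt_mult nv_nonneg)
  also have "\<dots> = d * nv S v" by (simp add: nv_nonneg)
  finally have 1: "(\<Sum>i\<in>S. cmod (mv S ?H v i) * cmod (v i)) \<le> d * nv S v" .
  have "nv S v - (\<Sum>i\<in>S. cmod (mv S ?H v i) * cmod (v i)) = (\<Sum>i\<in>S. (cmod (v i))\<^sup>2 - cmod (mv S ?H v i) * cmod (v i))"
    by (simp add: nv_def sum_subtractf)
  also have "\<dots> \<le> (nrm N (lin S a v))\<^sup>2"
    unfolding lin_power2
  proof (rule sum_mono)
    fix i assume i: "i \<in> S"
    have "- Re (cnj (mv S ?H v i) * v i) \<le> cmod (mv S ?H v i) * cmod (v i)"
      using abs_Re_le_cmod[of "cnj (mv S ?H v i) * v i"] by (simp add: norm_mult)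
    then show "(cmod (v i))\<^sup>2 - cmod (mv S ?H v i) * cmod (v i) \<le> Re (cnj (\<Sum>k\<in>S. gram N a i k * v k) * v i)"
      unfolding gram_split[OF i] using cmod_power2[of "v i"] by (simp add: algebra_simps power2_eq_square)
  qed
  finally show ?thesis using 1 by (simp add: algebra_simps)
qed

text \<open>For h in the kernel the measurement term of \<open>l1_lower\<close> disappears, so h
  vanishes where u has modulus below 1. What remains lives on S, where A is injective by
  \<open>lin_lower\<close>.\<close>

theorem unique_recovery:
  assumes r: "\<And>i. i \<in> S \<Longrightarrow> r i > 0" and u1: "\<And>j. j < n \<Longrightarrow> j \<notin> S \<Longrightarrow> cmod (u j) < 1"
    and ker: "\<And>r. r < N \<Longrightarrow> lin {..<n} a h r = 0"
    and le: "(\<Sum>i<n. cmod ((if i \<in> S then of_real (r i) * \<sigma> i else 0) + h i)) \<le>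
      (\<Sum>i<n. cmod (if i \<in> S then of_real (r i) * \<sigma> i else 0))"
    and i: "i < n"
  shows "h i = 0"
proof -
  have "nrm N (lin {..<n} a h) = 0" using ker by (simp add: nrm_def L2_set_def)
  then have "(\<Sum>j\<in>{..<n}-S. (1 - cmod (u j)) * cmod (h j)) \<le> 0"
    using l1_lower[where r=r and h=h, OF r] le by simp
  moreover have nn: "(1 - cmod (u j)) * cmod (h j) \<ge> 0" if "j \<in> {..<n} - S" for j
    using u1[of j] that by simp
  ultimately have "(\<Sum>j\<in>{..<n}-S. (1 - cmod (u j)) * cmod (h j)) = 0"
    using sum_nonneg[of "{..<n}-S" "\<lambda>j. (1 - cmod (u j)) * cmod (h j)"] by fastforce
  then have "\<forall>j\<in>{..<n}-S. (1 - cmod (u j)) * cmod (h j) = 0"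
    using nn by (subst (asm) sum_nonneg_eq_0_iff) auto
  then have off: "h j = 0" if "j \<in> {..<n} - S" for j using u1[of j] that by force
  have "lin {..<n} a h r = lin S a h r" for r
    unfolding lin_def using S off by (intro sum.mono_neutral_right) auto
  then have "nrm N (lin S a h) = 0" using ker by (simp add: nrm_def L2_set_def)
  then have "(1 - d) * nv S h \<le> 0" using lin_lower[of h] by simp
  then have "nv S h \<le> 0" using d by (simp add: mult_le_0_iff)
  then have "\<forall>j\<in>S. (cmod (h j))\<^sup>2 \<le> 0" using nv_le_sum[OF finite_S, of _ h] by (meson order_trans)
  then show ?thesis using off i by (cases "i \<in> S") auto
qed

text \<open>The squared norm of \<open>A_S b\<close> equals the pairing of \<sigma> with b, at most
  sqrt s times the norm of b, which \<open>nv_le_gram\<close> bounds by sqrt s / (1 - d). This is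
  the source of sqrt s in the error estimate.\<close>

lemma nrm_b: "(nrm N (lin S a b))\<^sup>2 \<le> real (card S) / (1 - d)"
proof -
  have L: "sqrt (nv S f) = L2_set (\<lambda>i. cmod (f i)) S" for f by (simp add: nv_def L2_set_def)
  have ns: "nv S (\<lambda>i. \<Sum>k\<in>S. gram N a i k * b k) = real (card S)"
    unfolding nv_def by (simp add: b \<sigma>)
  have "(nrm N (lin S a b))\<^sup>2 \<le> (\<Sum>i\<in>S. cmod (\<sigma> i) * cmod (b i))"
    unfolding lin_power2
  proof (rule sum_mono)
    fix i assume "i \<in> S"
    then show "Re (cnj (\<Sum>k\<in>S. gram N a i k * b k) * b i) \<le> cmod (\<sigma> i) * cmod (b i)"
      using complex_Re_le_cmod[of "cnj (\<sigma> i) * b i"] by (simp only: b norm_mult complex_mod_cnj)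
  qed
  also have "\<dots> \<le> sqrt (nv S \<sigma>) * sqrt (nv S b)" unfolding L by (rule order_trans[OF _ L2_set_mult_ineq]) simp
  also have "nv S \<sigma> = real (card S)" unfolding nv_def by (simp add: \<sigma>)
  finally have 1: "(nrm N (lin S a b))\<^sup>2 \<le> sqrt (real (card S)) * sqrt (nv S b)" .
  have "(1 - d) * (nrm N (lin S a b))\<^sup>2 \<le> (1 - d) * (sqrt (real (card S)) * sqrt (nv S b))"
    using d by (intro mult_left_mono 1) auto
  also have "\<dots> = sqrt (real (card S)) * ((1 - d) * sqrt (nv S b))" by simp
  also have "\<dots> \<le> sqrt (real (card S)) * sqrt (real (card S))"
    using nv_le_gram[of b] unfolding ns by (intro mult_left_mono) auto
  finally show ?thesis using d by (simp add: field_simps)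
qed

text \<open>With q the l1 mass of h off S, \<open>l1_lower\<close> and the bound 2 sqrt s on
  \<open>A_S b\<close> give q <= 8 sqrt s \<eta>. Removing the columns off S leaves
  \<open>A_S h\<close> of norm at most 2\<eta> + 2q, so h on S has norm at most 4\<eta> + 4q. Adding
  q gives 4\<eta> + 5q, hence the constants 4 and 40.\<close>

theorem stable_recovery:
  assumes r: "\<And>i. i \<in> S \<Longrightarrow> r i > 0" and u1: "\<And>j. j < n \<Longrightarrow> j \<notin> S \<Longrightarrow> cmod (u j) \<le> 1 / 2"
    and d4: "d \<le> 1 / 2" and diag: "\<And>j. j < n \<Longrightarrow> j \<notin> S \<Longrightarrow> nrm N (\<lambda>r. a r j) \<le> 2"
    and meas: "nrm N (lin {..<n} a h) \<le> 2 * \<eta>"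
    and le: "(\<Sum>i<n. cmod ((if i \<in> S then of_real (r i) * \<sigma> i else 0) + h i)) \<le>
      (\<Sum>i<n. cmod (if i \<in> S then of_real (r i) * \<sigma> i else 0))"
  shows "nrm n h \<le> (4 + 40 * sqrt (real (card S))) * \<eta>"
proof -
  define s where "s = sqrt (real (card S))"
  define q where "q = (\<Sum>j\<in>{..<n}-S. cmod (h j))"
  have s0: "s \<ge> 0" and q0: "q \<ge> 0" by (auto simp: s_def q_def intro: sum_nonneg)
  have e0: "\<eta> \<ge> 0" using meas nrm_nonneg[of N "lin {..<n} a h"] by linarith
  have "real (card S) / (1 - d) \<le> real (card S) / (1 / 2)" using d4 by (intro divide_left_mono) auto
  then have "(nrm N (lin S a b))\<^sup>2 \<le> (2 * s)\<^sup>2" using nrm_b by (simp add: s_def power_mult_distrib)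
  then have nb: "nrm N (lin S a b) \<le> 2 * s" by (rule power2_le_imp_le) (simp add: s0)
  have "(1 / 2) * q = (\<Sum>j\<in>{..<n}-S. (1 / 2) * cmod (h j))" by (simp add: q_def sum_distrib_left)
  also have "\<dots> \<le> (\<Sum>j\<in>{..<n}-S. (1 - cmod (u j)) * cmod (h j))"
    using u1 by (intro sum_mono mult_right_mono) auto
  also have "\<dots> \<le> nrm N (lin S a b) * nrm N (lin {..<n} a h)"
    using l1_lower[where r=r and h=h, OF r] le by simp
  also have "\<dots> \<le> (2 * s) * (2 * \<eta>)"
    by (intro mult_mono nb meas) (auto simp: s0 nrm_nonneg)
  finally have q: "q \<le> 8 * s * \<eta>" by simp
  have "lin S a h = (\<lambda>r. lin {..<n} a h r + (\<Sum>j\<in>{..<n}-S. a r j * (- h j)))"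
  proof
    fix r
    have "lin {..<n} a h r = lin S a h r + (\<Sum>j\<in>{..<n}-S. a r j * h j)"
      unfolding lin_def using S by (subst sum.subset_diff[of S]) auto
    then show "lin S a h r = lin {..<n} a h r + (\<Sum>j\<in>{..<n}-S. a r j * (- h j))"
      by (simp add: sum_negf)
  qed
  then have "nrm N (lin S a h) \<le> nrm N (lin {..<n} a h) + nrm N (\<lambda>r. \<Sum>j\<in>{..<n}-S. a r j * (- h j))"
    by (simp only: nrm_triangle)
  also have "nrm N (\<lambda>r. \<Sum>j\<in>{..<n}-S. a r j * (- h j)) \<le> (\<Sum>j\<in>{..<n}-S. nrm N (\<lambda>r. a r j * (- h j)))"
    by (rule nrm_sum) auto
  also have "\<dots> \<le> (\<Sum>j\<in>{..<n}-S. cmod (h j) * 2)"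
    unfolding nrm_scale norm_minus_cancel using diag by (intro sum_mono mult_left_mono) auto
  also have "\<dots> = 2 * q" by (simp add: q_def sum_distrib_left mult.commute)
  finally have 1: "nrm N (lin S a h) \<le> 2 * \<eta> + 2 * q" using meas by simp
  have "(1 / 2) * nv S h \<le> (1 - d) * nv S h" using d4 nv_nonneg by (intro mult_right_mono) auto
  then have "nv S h \<le> 2 * ((1 - d) * nv S h)" by simp
  also have "\<dots> \<le> 2 * (nrm N (lin S a h))\<^sup>2" using lin_lower[of h] by simp
  also have "\<dots> \<le> 2 * (2 * \<eta> + 2 * q)\<^sup>2" using 1 nrm_nonneg by (intro mult_left_mono power_mono) auto
  also have "\<dots> \<le> 4 * (2 * \<eta> + 2 * q)\<^sup>2" by simp
  also have "\<dots> = (2 * (2 * \<eta> + 2 * q))\<^sup>2" by (simp only: power_mult_distrib) simp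
  finally have 2: "sqrt (nv S h) \<le> 2 * (2 * \<eta> + 2 * q)"
    using e0 q0 by (intro real_le_lsqrt) (auto simp: nv_nonneg)
  have "nrm n h \<le> nrm n (\<lambda>i. if i \<in> S then h i else 0) + nrm n (\<lambda>i. if i \<in> S then 0 else h i)"
    using nrm_triangle[of n "\<lambda>i. if i \<in> S then h i else 0" "\<lambda>i. if i \<in> S then 0 else h i"]
    by (simp add: if_distrib if_distribR cong: if_cong)
  also have "nrm n (\<lambda>i. if i \<in> S then h i else 0) = sqrt (nv S h)"
  proof -
    have "(\<Sum>i<n. (cmod (if i \<in> S then h i else 0))\<^sup>2) = (\<Sum>i\<in>S. (cmod (h i))\<^sup>2)"
      using S by (intro sum.mono_neutral_cong_right) auto
    then show ?thesis by (simp add: nrm_def L2_set_def nv_def)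
  qed
  also have "nrm n (\<lambda>i. if i \<in> S then 0 else h i) \<le> (\<Sum>i<n. \<bar>cmod (if i \<in> S then 0 else h i)\<bar>)"
    unfolding nrm_def by (rule L2_set_le_sum_abs)
  also have "\<dots> = q" unfolding q_def by (intro sum.mono_neutral_cong_right) auto
  finally have "nrm n h \<le> 4 * \<eta> + 5 * q" using 2 by simp
  also have "\<dots> \<le> (4 + 40 * s) * \<eta>" using q by (simp add: algebra_simps)
  finally show ?thesis by (simp add: s_def)
qed

end

section \<open>Tails of random sign sums\<close>

lemma two_power_fact_le: "2 ^ k * fact k \<le> (fact (2 * k) :: real)"
proof (induction k)
  case (Suc k)
  have "(2::real) ^ Suc k * fact (Suc k) = 2 * (real k + 1) * (2 ^ k * fact k)" by (simp add: algebra_simps)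
  also have "\<dots> \<le> 2 * (real k + 1) * fact (2 * k)" using Suc by (intro mult_left_mono) auto
  also have "\<dots> \<le> 2 * (real k + 1) * ((2 * real k + 1) * fact (2 * k))"
    by (intro mult_left_mono) (simp_all add: mult_le_cancel_right1 algebra_simps)
  also have "\<dots> = fact (2 * Suc k)" by (simp add: algebra_simps)
  finally show ?case .
qed simp

text \<open>Both sides are power series in the square of x, compared coefficient by coefficient with
  (2k)! >= \<open>2^k k!\<close>.\<close>

lemma cosh_le_exp_half_square: "cosh (x::real) \<le> exp (x\<^sup>2 / 2)"
proof -
  define f where "f n = (if even n then x ^ n /\<^sub>R fact n else 0)" for n :: nat
  have "f sums cosh x" using cosh_converges[of x] by (simp only: f_def[abs_def])
  \<comment> \<open>The odd terms vanish, so the series may be reindexed over even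
    exponents.\<close>
  moreover have "(\<lambda>k. f (2 * k)) sums cosh x \<longleftrightarrow> f sums cosh x"
  proof (rule sums_mono_reindex)
    show "strict_mono (\<lambda>k::nat. 2 * k)" by (simp add: strict_mono_def)
    fix n :: nat assume "n \<notin> range (\<lambda>k. 2 * k)"
    then have "odd n" by (auto simp: dvd_def)
    then show "f n = 0" by (simp add: f_def)
  qed
  ultimately have 1: "(\<lambda>k. f (2 * k)) sums cosh x" by (rule iffD2[rotated])
  have 2: "(\<lambda>k. (x\<^sup>2 / 2) ^ k /\<^sub>R fact k) sums exp (x\<^sup>2 / 2)" by (rule exp_converges)
  have "f (2 * k) \<le> (x\<^sup>2 / 2) ^ k /\<^sub>R fact k" for k
  proof -
    have "f (2 * k) = x ^ (2 * k) / fact (2 * k)" by (simp add: f_def divide_inverse_commute)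
    also have "x ^ (2 * k) / fact (2 * k) \<le> x ^ (2 * k) / (2 ^ k * fact k)"
      by (intro divide_left_mono two_power_fact_le) simp_all
    also have "\<dots> = (x\<^sup>2 / 2) ^ k /\<^sub>R fact k"
      by (subst power_mult) (simp add: power_divide field_simps)
    finally show ?thesis .
  qed
  from sums_le[OF this 1 2] show ?thesis .
qed

text \<open>The variance proxy \<open>q c\<close> bounds \<open>Re (c * z)\<close>: it is \<open>(Re c)\<^sup>2\<close> for Rademacher and \<open>\<bar>c\<bar>\<^sup>2 / 2\<close> for
  Steinhaus variables; \<open>q_rot\<close> says that real and imaginary part of \<open>c * z\<close> share \<open>\<bar>c\<bar>\<^sup>2\<close>.\<close>

locale subgaussian =
  fixes \<mu> :: "complex measure" and q :: "complex \<Rightarrow> real"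
  assumes prob_\<mu>: "prob_space \<mu>" and id_meas: "(\<lambda>z. z) \<in> borel_measurable \<mu>"
    and q_nonneg: "q c \<ge> 0" and q_scale: "q (complex_of_real t * c) = t\<^sup>2 * q c"
    and q_rot: "q c + q (- (\<i> * c)) = (cmod c)\<^sup>2"
    and mgf: "(\<integral>\<^sup>+z. ennreal (exp (Re (c * z))) \<partial>\<mu>) \<le> ennreal (exp (q c / 2))"
begin

lemma coord_meas: "i \<in> S \<Longrightarrow> (\<lambda>s. s i) \<in> borel_measurable (PiM S (\<lambda>_. \<mu>))"
proof -
  assume "i \<in> S"
  then have "(\<lambda>s. s i) \<in> measurable (PiM S (\<lambda>_. \<mu>)) \<mu>" by (rule measurable_component_singleton)
  from measurable_compose[OF this id_meas] show ?thesis .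
qed

lemma lin_meas: "(\<lambda>s. \<Sum>i\<in>S. c i * s i) \<in> borel_measurable (PiM S (\<lambda>_. \<mu>))"
  by (intro borel_measurable_sum borel_measurable_times borel_measurable_const coord_meas)

text \<open>Chernoff bound: independence factors the exponential moment over the coordinates, and
  \<open>mgf\<close> bounds each factor.\<close>

lemma tail_Re:
  fixes S :: "nat set"
  assumes S: "finite S" and Q: "Q > 0" "(\<Sum>i\<in>S. q (c i)) \<le> Q" and u: "v > 0"
  shows "emeasure (PiM S (\<lambda>_. \<mu>)) {s \<in> space (PiM S (\<lambda>_. \<mu>)). Re (\<Sum>i\<in>S. c i * s i) \<ge> v} \<le> ennreal (exp (- (v\<^sup>2 / (2 * Q))))"
proof -
  interpret product_prob_space "\<lambda>_. \<mu>" S by (rule product_prob_spaceI) (rule prob_\<mu>)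
  let ?M = "PiM S (\<lambda>_. \<mu>)"
  \<comment> \<open>Minimises the exponent - t v + t^2 Q / 2.\<close>
  define t where "t = v / Q"
  have t: "t > 0" using u Q by (simp add: t_def)
  have mR: "(\<lambda>s. Re (\<Sum>i\<in>S. c i * s i)) \<in> borel_measurable ?M"
    using measurable_compose[OF lin_meas[of c S], of Re borel]
    by (auto intro!: borel_measurable_continuous_onI continuous_intros)
  have m1: "(\<lambda>z. ennreal (exp (t * Re (c i * z)))) \<in> borel_measurable \<mu>" for i
  proof -
    have "(\<lambda>z. ennreal (exp (t * Re (c i * z)))) \<in> borel_measurable borel"
      by (intro measurable_compose[OF _ measurable_ennreal] borel_measurable_continuous_onI continuous_intros)
    from measurable_compose[OF id_meas this] show ?thesis .
  qed
  have "emeasure ?M {s \<in> space ?M. Re (\<Sum>i\<in>S. c i * s i) \<ge> v} \<le>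
      ennreal (exp (- t * v)) * (\<integral>\<^sup>+s. ennreal (exp (t * Re (\<Sum>i\<in>S. c i * s i))) * indicator (space ?M) s \<partial>?M)"
    by (rule Chernoff_ineq_nn_integral_ge[OF t sets.top
          borel_measurable_times[OF mR borel_measurable_indicator[OF sets.top]]])
  also have "(\<integral>\<^sup>+s. ennreal (exp (t * Re (\<Sum>i\<in>S. c i * s i))) * indicator (space ?M) s \<partial>?M)
      = (\<integral>\<^sup>+s. (\<Prod>i\<in>S. ennreal (exp (t * Re (c i * s i)))) \<partial>?M)"
  proof (rule nn_integral_cong)
    fix s assume "s \<in> space ?M"
    have "(\<Prod>i\<in>S. ennreal (exp (t * Re (c i * s i)))) = ennreal (exp (\<Sum>i\<in>S. t * Re (c i * s i)))"
      by (simp only: exp_sum[OF S]) (rule prod_ennreal, simp)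
    then show "ennreal (exp (t * Re (\<Sum>i\<in>S. c i * s i))) * indicator (space ?M) s = (\<Prod>i\<in>S. ennreal (exp (t * Re (c i * s i))))"
      using \<open>s \<in> space ?M\<close> by (simp only: Re_sum sum_distrib_left indicator_simps mult_1_right)
  qed
  also have "\<dots> = (\<Prod>i\<in>S. \<integral>\<^sup>+z. ennreal (exp (t * Re (c i * z))) \<partial>\<mu>)"
    by (rule product_nn_integral_prod[OF S m1])
  also have "\<dots> \<le> (\<Prod>i\<in>S. ennreal (exp (t\<^sup>2 * q (c i) / 2)))"
  proof (intro prod_mono_ennreal)
    fix i
    show "(\<integral>\<^sup>+z. ennreal (exp (t * Re (c i * z))) \<partial>\<mu>) \<le> ennreal (exp (t\<^sup>2 * q (c i) / 2))"
      using mgf[of "complex_of_real t * c i"] by (simp add: q_scale algebra_simps)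
  qed
  also have "\<dots> = ennreal (exp (t\<^sup>2 * (\<Sum>i\<in>S. q (c i)) / 2))"
  proof -
    have "(\<Prod>i\<in>S. ennreal (exp (t\<^sup>2 * q (c i) / 2))) = ennreal (exp (\<Sum>i\<in>S. t\<^sup>2 * q (c i) / 2))"
      by (simp only: exp_sum[OF S]) (rule prod_ennreal, simp)
    then show ?thesis by (simp only: sum_distrib_left sum_divide_distrib)
  qed
  also have "\<dots> \<le> ennreal (exp (t\<^sup>2 * Q / 2))"
    using Q by (intro ennreal_leI) (simp add: mult_left_mono)
  finally have "emeasure ?M {s \<in> space ?M. Re (\<Sum>i\<in>S. c i * s i) \<ge> v} \<le>
      ennreal (exp (- t * v)) * ennreal (exp (t\<^sup>2 * Q / 2))"
    by (simp add: mult_left_mono)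
  also have "\<dots> = ennreal (exp (- t * v + t\<^sup>2 * Q / 2))"
    by (simp only: ennreal_mult[symmetric] exp_ge_zero exp_add)
  also have "- t * v + t\<^sup>2 * Q / 2 = - (v\<^sup>2 / (2 * Q))"
    using Q by (simp add: t_def power2_eq_square field_simps)
  finally show ?thesis .
qed

text \<open>Splitting the threshold between real and imaginary part in proportion to their variance proxies
  \<open>Q1\<close>, \<open>Q2\<close> loses only a factor 2; the slack \<open>e\<close> keeps both proxies positive.\<close>

lemma tail_cmod:
  fixes S :: "nat set"
  assumes S: "finite S" and c: "(\<Sum>i\<in>S. (cmod (c i))\<^sup>2) < t" and \<tau>: "\<tau> > 0"
  shows "emeasure (PiM S (\<lambda>_. \<mu>)) {s \<in> space (PiM S (\<lambda>_. \<mu>)). cmod (\<Sum>i\<in>S. c i * s i) \<ge> \<tau>} \<le> ennreal (4 * exp (- (\<tau>\<^sup>2 / (2 * t))))"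
proof -
  let ?M = "PiM S (\<lambda>_. \<mu>)" and ?c' = "\<lambda>i. - (\<i> * c i)"
  define e where "e = (t - (\<Sum>i\<in>S. (cmod (c i))\<^sup>2)) / 2"
  define Q1 where "Q1 = (\<Sum>i\<in>S. q (c i)) + e"
  define Q2 where "Q2 = (\<Sum>i\<in>S. q (?c' i)) + e"
  have e: "e > 0" using c by (simp add: e_def)
  have Q: "Q1 > 0" "Q2 > 0" unfolding Q1_def Q2_def using e by (auto intro!: add_nonneg_pos sum_nonneg q_nonneg)
  have Qt: "Q1 + Q2 = t"
  proof -
    have "Q1 + Q2 = (\<Sum>i\<in>S. q (c i) + q (?c' i)) + 2 * e" by (simp add: Q1_def Q2_def sum.distrib)
    also have "\<dots> = t" unfolding q_rot e_def by (simp only: field_sum_of_halves mult_2 add_diff_cancel_left' add_diff_eq)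
    finally show ?thesis .
  qed
  have t: "t > 0" using Q Qt by simp
  define v1 where "v1 = \<tau> * sqrt (Q1 / t)"
  define v2 where "v2 = \<tau> * sqrt (Q2 / t)"
  have v: "v1 > 0" "v2 > 0" using \<tau> Q t by (auto simp: v1_def v2_def)
  have vt: "v1\<^sup>2 + v2\<^sup>2 = \<tau>\<^sup>2"
    using Q t by (simp add: v1_def v2_def power_mult_distrib flip: distrib_left add_divide_distrib) (simp add: Qt)
  \<comment> \<open>This choice of thresholds equalises the exponents, so all four one-sided tails
    share one bound.\<close>
  have ex: "v1\<^sup>2 / (2 * Q1) = \<tau>\<^sup>2 / (2 * t)" "v2\<^sup>2 / (2 * Q2) = \<tau>\<^sup>2 / (2 * t)"
    using Q t by (auto simp: v1_def v2_def power_mult_distrib)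
  have qm: "q (- z) = q z" for z using q_scale[of "-1" z] by simp
  define B where "B w v = {s \<in> space ?M. Re (\<Sum>i\<in>S. w i * s i) \<ge> v}" for w :: "nat \<Rightarrow> complex" and v
  have B: "B w v \<in> sets ?M" for w v unfolding B_def using lin_meas[of w S] by measurable
  let ?p = "ennreal (exp (- (\<tau>\<^sup>2 / (2 * t))))"
  have b1: "emeasure ?M (B c v1) \<le> ?p"
    unfolding B_def ex(1)[symmetric] by (rule tail_Re[OF S Q(1) _ v(1)]) (use e in \<open>simp add: Q1_def\<close>)
  have b2: "emeasure ?M (B (\<lambda>i. - c i) v1) \<le> ?p"
    unfolding B_def ex(1)[symmetric] by (rule tail_Re[OF S Q(1) _ v(1)]) (use e in \<open>simp add: Q1_def qm\<close>)
  have b3: "emeasure ?M (B ?c' v2) \<le> ?p"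
    unfolding B_def ex(2)[symmetric] by (rule tail_Re[OF S Q(2) _ v(2)]) (use e in \<open>simp add: Q2_def\<close>)
  have b4: "emeasure ?M (B (\<lambda>i. \<i> * c i) v2) \<le> ?p"
    unfolding B_def ex(2)[symmetric] by (rule tail_Re[OF S Q(2) _ v(2)]) (use e in \<open>simp add: Q2_def qm\<close>)
  \<comment> \<open>If all four one-sided events fail, then |Re z| < v1 and |Im z| < v2, and the
    squares of v1 and v2 add up to that of \<tau>.\<close>
  have "{s \<in> space ?M. cmod (\<Sum>i\<in>S. c i * s i) \<ge> \<tau>} \<subseteq> (B c v1 \<union> B (\<lambda>i. - c i) v1) \<union> (B ?c' v2 \<union> B (\<lambda>i. \<i> * c i) v2)"
  proof safe
    fix s assume s: "s \<in> space ?M" "cmod (\<Sum>i\<in>S. c i * s i) \<ge> \<tau>"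
      and n: "s \<notin> B ?c' v2" "s \<notin> B (\<lambda>i. \<i> * c i) v2" "s \<notin> B (\<lambda>i. - c i) v1"
    define z where "z = (\<Sum>i\<in>S. c i * s i)"
    have r: "(\<Sum>i\<in>S. - c i * s i) = - z" "(\<Sum>i\<in>S. \<i> * c i * s i) = \<i> * z" "(\<Sum>i\<in>S. - (\<i> * c i) * s i) = - (\<i> * z)"
      by (auto simp: z_def sum_negf sum_distrib_left mult_ac)
    have Bi: "s \<in> B w v \<longleftrightarrow> v \<le> Re (\<Sum>i\<in>S. w i * s i)" for w v
      unfolding B_def using s(1) by blast
    show "s \<in> B c v1"
    proof (rule ccontr)
      assume "s \<notin> B c v1"
      with n have "\<bar>Re z\<bar> < v1" "\<bar>Im z\<bar> < v2" unfolding Bi r z_def[symmetric] by auto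
      then have "(Re z)\<^sup>2 < v1\<^sup>2" "(Im z)\<^sup>2 < v2\<^sup>2"
        by (metis abs_ge_zero power2_abs power_strict_mono zero_less_numeral)+
      then have "(cmod z)\<^sup>2 < \<tau>\<^sup>2" using vt by (simp add: cmod_power2)
      then have "cmod z < \<tau>" using \<tau> by (simp add: power_less_imp_less_base)
      then show False using s(2) by (simp add: z_def)
    qed
  qed
  then have "emeasure ?M {s \<in> space ?M. cmod (\<Sum>i\<in>S. c i * s i) \<ge> \<tau>} \<le>
     emeasure ?M ((B c v1 \<union> B (\<lambda>i. - c i) v1) \<union> (B ?c' v2 \<union> B (\<lambda>i. \<i> * c i) v2))"
    by (rule emeasure_mono) (intro sets.Un B)
  also have "\<dots> \<le> (emeasure ?M (B c v1) + emeasure ?M (B (\<lambda>i. - c i) v1)) + (emeasure ?M (B ?c' v2) + emeasure ?M (B (\<lambda>i. \<i> * c i) v2))"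
    by (intro order_trans[OF emeasure_subadditive] add_mono emeasure_subadditive sets.Un B)
  also have "\<dots> \<le> (?p + ?p) + (?p + ?p)"
    by (intro add_mono b1 b2 b3 b4)
  also have "\<dots> = ennreal (4 * exp (- (\<tau>\<^sup>2 / (2 * t))))"
    by (simp flip: ennreal_plus)
  finally show ?thesis .
qed

end

lemma subgaussian_rademacher: "subgaussian rademacher (\<lambda>c. (Re c)\<^sup>2)"
proof (rule subgaussian.intro)
  show "prob_space rademacher" unfolding rademacher_def by (rule prob_space_measure_pmf)
  show "(\<lambda>z. z) \<in> borel_measurable rademacher" unfolding rademacher_def by simp
  fix c :: complex and t :: real
  show "(Re (complex_of_real t * c))\<^sup>2 = t\<^sup>2 * (Re c)\<^sup>2" by (simp add: power_mult_distrib)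
  show "(Re c)\<^sup>2 + (Re (- (\<i> * c)))\<^sup>2 = (cmod c)\<^sup>2" by (simp add: cmod_power2)
  have "(\<integral>\<^sup>+z. ennreal (exp (Re (c * z))) \<partial>rademacher) = ennreal (cosh (Re c))"
    unfolding rademacher_def
    by (subst nn_integral_pmf_of_set) (auto simp: cosh_field_def ennreal_plus[symmetric] divide_ennreal[symmetric] simp del: ennreal_plus)
  also have "\<dots> \<le> ennreal (exp ((Re c)\<^sup>2 / 2))" by (intro ennreal_leI cosh_le_exp_half_square)
  finally show "(\<integral>\<^sup>+z. ennreal (exp (Re (c * z))) \<partial>rademacher) \<le> ennreal (exp ((Re c)\<^sup>2 / 2))" .
qed auto

lemma nn_integral_steinhaus:
  assumes [measurable]: "f \<in> borel_measurable borel"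
  shows "(\<integral>\<^sup>+z. f z \<partial>steinhaus) = (\<integral>\<^sup>+t. f (cis t) * indicator {0..<2*pi} t \<partial>lborel) / ennreal (2 * pi)"
proof -
  have "cis \<in> borel_measurable borel" by (intro borel_measurable_continuous_onI continuous_intros)
  then have [measurable]: "cis \<in> borel_measurable lborel" by simp
  show ?thesis
    unfolding steinhaus_def
    by (subst nn_integral_distr) (auto simp: nn_integral_uniform_measure)
qed

text \<open>Multiplication by the imaginary unit shifts the angle by pi/2. The piece of the period
  over [0, pi/2) is moved by a full turn to its end, so that the whole period becomes a shifted
  interval.\<close>

lemma nn_integral_steinhaus_rotate:
  assumes f [measurable]: "f \<in> borel_measurable borel"
  shows "(\<integral>\<^sup>+z. f (\<i> * z) \<partial>steinhaus) = (\<integral>\<^sup>+z. f z \<partial>steinhaus)"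
proof -
  have [measurable]: "cis \<in> borel_measurable borel" by (intro borel_measurable_continuous_onI continuous_intros)
  have per: "cis (2 * pi + t) = cis t" for t by (simp add: cis_mult[symmetric])
  have rot: "cis (pi / 2 + t) = \<i> * cis t" for t by (simp add: cis_mult[symmetric])
  have [measurable]: "(\<lambda>z. f (\<i> * z)) \<in> borel_measurable borel"
    by (rule measurable_compose[OF _ f]) measurable
  have "(\<integral>\<^sup>+t. f (cis t) * indicator {0..<2*pi} t \<partial>lborel) =
     (\<integral>\<^sup>+t. f (cis t) * indicator {pi/2..<2*pi} t + f (cis t) * indicator {0..<pi/2} t \<partial>lborel)"
    by (intro nn_integral_cong) (auto split: split_indicator)
  also have "\<dots> = (\<integral>\<^sup>+t. f (cis t) * indicator {pi/2..<2*pi} t \<partial>lborel) + (\<integral>\<^sup>+t. f (cis t) * indicator {0..<pi/2} t \<partial>lborel)"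
    by (rule nn_integral_add) auto
  also have "(\<integral>\<^sup>+t. f (cis t) * indicator {0..<pi/2} t \<partial>lborel) = (\<integral>\<^sup>+t. f (cis t) * indicator {2*pi..<5/2*pi} t \<partial>lborel)"
  proof -
    have "(\<integral>\<^sup>+t. f (cis t) * indicator {2*pi..<5/2*pi} t \<partial>lborel) =
      (\<integral>\<^sup>+t. f (cis (2*pi + t)) * indicator {2*pi..<5/2*pi} (2*pi + t) \<partial>lborel)"
      by (subst nn_integral_real_affine[where c=1 and t="2*pi"]) auto
    also have "\<dots> = (\<integral>\<^sup>+t. f (cis t) * indicator {0..<pi/2} t \<partial>lborel)"
      unfolding per by (intro nn_integral_cong) (auto split: split_indicator)
    finally show ?thesis ..
  qed
  also have "(\<integral>\<^sup>+t. f (cis t) * indicator {pi/2..<2*pi} t \<partial>lborel) + \<dots> =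
     (\<integral>\<^sup>+t. f (cis t) * indicator {pi/2..<2*pi} t + f (cis t) * indicator {2*pi..<5/2*pi} t \<partial>lborel)"
    by (rule nn_integral_add[symmetric]) auto
  also have "\<dots> = (\<integral>\<^sup>+t. f (cis t) * indicator {pi/2..<5/2*pi} t \<partial>lborel)"
    by (intro nn_integral_cong) (auto split: split_indicator)
  also have "\<dots> = (\<integral>\<^sup>+t. f (cis (pi/2 + t)) * indicator {pi/2..<5/2*pi} (pi/2 + t) \<partial>lborel)"
    by (subst nn_integral_real_affine[where c=1 and t="pi/2"]) auto
  also have "\<dots> = (\<integral>\<^sup>+t. f (\<i> * cis t) * indicator {0..<2*pi} t \<partial>lborel)"
    unfolding rot by (intro nn_integral_cong) (auto split: split_indicator)
  finally show ?thesis by (simp add: nn_integral_steinhaus)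
qed

lemma prob_space_steinhaus: "prob_space steinhaus"
proof -
  have "cis \<in> borel_measurable borel" by (intro borel_measurable_continuous_onI continuous_intros)
  then show ?thesis unfolding steinhaus_def
    by (intro prob_space.prob_space_distr prob_space_uniform_measure) auto
qed

lemma AE_steinhaus: "AE z in steinhaus. cmod z = 1"
proof -
  have "cis \<in> borel_measurable borel" by (intro borel_measurable_continuous_onI continuous_intros)
  then show ?thesis unfolding steinhaus_def by (subst AE_distr_iff) auto
qed

text \<open>Averaging over the four rotations by powers of \<open>\<i>\<close> turns the exponential into
  \<open>(cosh a + cosh b) / 2 = cosh ((a + b) / 2) * cosh ((a - b) / 2)\<close> with \<open>a\<^sup>2 + b\<^sup>2 = \<bar>c\<bar>\<^sup>2\<close>.\<close>

lemma subgaussian_steinhaus: "subgaussian steinhaus (\<lambda>c. (cmod c)\<^sup>2 / 2)"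
proof (rule subgaussian.intro)
  show "prob_space steinhaus" by (rule prob_space_steinhaus)
  show "(\<lambda>z. z) \<in> borel_measurable steinhaus" unfolding steinhaus_def by simp
  fix c :: complex and t :: real
  show "(cmod (complex_of_real t * c))\<^sup>2 / 2 = t\<^sup>2 * ((cmod c)\<^sup>2 / 2)" by (simp add: norm_mult power_mult_distrib)
  show "(cmod c)\<^sup>2 / 2 + (cmod (- (\<i> * c)))\<^sup>2 / 2 = (cmod c)\<^sup>2" by (simp add: norm_mult)
  define f where "f c z = ennreal (exp (Re (c * z)))" for c z :: complex
  have [measurable]: "f c \<in> borel_measurable borel" for c unfolding f_def by measurable
  have sm: "f c \<in> borel_measurable steinhaus" for c unfolding steinhaus_def by simp
  define J where "J c = (\<integral>\<^sup>+z. f c z \<partial>steinhaus)" for c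
  have J: "J (\<i> * c) = J c" for c
    using nn_integral_steinhaus_rotate[of "f c"] by (simp add: J_def f_def mult_ac)
  have "4 * J c = J c + J (\<i> * c) + J (\<i> * (\<i> * c)) + J (\<i> * (\<i> * (\<i> * c)))"
  proof -
    have "(4::ennreal) = 1 + 1 + 1 + 1" by simp
    then show ?thesis unfolding J by (simp only: distrib_right mult_1_left)
  qed
  also have "\<dots> = (\<integral>\<^sup>+z. f c z + f (\<i> * c) z + f (\<i> * (\<i> * c)) z + f (\<i> * (\<i> * (\<i> * c))) z \<partial>steinhaus)"
    unfolding J_def using sm by (simp add: nn_integral_add)
  also have "\<dots> \<le> (\<integral>\<^sup>+z. ennreal (4 * exp ((cmod c)\<^sup>2 / 4)) \<partial>steinhaus)"
  proof (rule nn_integral_mono_AE, use AE_steinhaus in eventually_elim)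
    fix z assume z: "cmod z = 1"
    define a where "a = Re (c * z)" define b where "b = Im (c * z)"
    have ab: "a\<^sup>2 + b\<^sup>2 = (cmod c)\<^sup>2"
      unfolding a_def b_def cmod_power2[symmetric] by (simp add: norm_mult z)
    \<comment> \<open>Successive rotations of c z = a + i b have real parts a, -b, -a and b.\<close>
    have "exp a + exp (- b) + exp (- a) + exp b = 4 * (cosh ((a + b) / 2) * cosh ((a - b) / 2))"
      by (simp add: cosh_field_def field_simps flip: exp_add)
    also have "\<dots> \<le> 4 * (exp (((a + b) / 2)\<^sup>2 / 2) * exp (((a - b) / 2)\<^sup>2 / 2))"
      by (intro mult_left_mono mult_mono cosh_le_exp_half_square) (auto simp: cosh_real_nonneg)
    also have "\<dots> = 4 * exp ((a\<^sup>2 + b\<^sup>2) / 4)"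
      by (simp add: field_simps power2_eq_square flip: exp_add)
    finally have "exp a + exp (- b) + exp (- a) + exp b \<le> 4 * exp ((cmod c)\<^sup>2 / 4)" by (simp add: ab)
    moreover have "f c z + f (\<i> * c) z + f (\<i> * (\<i> * c)) z + f (\<i> * (\<i> * (\<i> * c))) z
       = ennreal (exp a + exp (- b) + exp (- a) + exp b)"
      by (simp add: f_def a_def b_def flip: ennreal_plus)
    ultimately show "f c z + f (\<i> * c) z + f (\<i> * (\<i> * c)) z + f (\<i> * (\<i> * (\<i> * c))) z \<le> ennreal (4 * exp ((cmod c)\<^sup>2 / 4))"
      by (simp only: ennreal_leI)
  qed
  also have "\<dots> = 4 * ennreal (exp ((cmod c)\<^sup>2 / 4))"
    using prob_space.emeasure_space_1[OF prob_space_steinhaus] by (simp add: ennreal_mult)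
  finally show "(\<integral>\<^sup>+z. ennreal (exp (Re (c * z))) \<partial>steinhaus) \<le> ennreal (exp ((cmod c)\<^sup>2 / 2 / 2))"
    unfolding J_def f_def by (simp add: ennreal_mult_le_mult_iff)
qed auto

section \<open>Gram matrices of the sensing matrix\<close>

definition ent :: "complex mat \<Rightarrow> nat \<Rightarrow> nat \<Rightarrow> complex" where
  "ent A r i = A $$ (r, i)"

lemma l2norm_eq_nrm: "l2norm v = nrm (dim_vec v) (\<lambda>i. v $ i)"
  by (simp add: l2norm_def nrm_def L2_set_def)

lemma cadj_mult_index:
  assumes "A \<in> carrier_mat N n" "i < n" "k < n"
  shows "(cadj A * A) $$ (i, k) = gram N (ent A) i k"
  using assms by (simp add: cadj_def scalar_prod_def gram_def ent_def atLeast0LessThan)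

lemma mult_mat_vec_index_lin:
  assumes "A \<in> carrier_mat N n" "z \<in> carrier_vec n" "r < N"
  shows "(A *\<^sub>v z) $ r = lin {..<n} (ent A) (\<lambda>i. z $ i) r"
  using assms by (simp add: scalar_prod_def lin_def ent_def atLeast0LessThan)

lemma sum_lessThan_add: "(\<Sum>r<a + b. f r) = (\<Sum>r<a. f r) + (\<Sum>r<b. f (a + r))" for f :: "nat \<Rightarrow> 'a::comm_monoid_add"
  by (induction b) (auto simp: add.assoc)

lemma append_rows_index:
  assumes "A \<in> carrier_mat a n" "B \<in> carrier_mat b n" "r < a + b" "i < n"
  shows "(A @\<^sub>r B) $$ (r, i) = (if r < a then A $$ (r, i) else B $$ (r - a, i))"
  using assms unfolding append_rows_def by auto

lemma stack_carrier_gram: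
  assumes "\<And>l. l \<in> set ls \<Longrightarrow> B l \<in> carrier_mat (p l) n"
  defines "M \<equiv> foldr (\<lambda>l M. B l @\<^sub>r M) ls (0\<^sub>m 0 n)"
  shows "M \<in> carrier_mat (sum_list (map p ls)) n \<and>
    (\<forall>i<n. \<forall>k<n. gram (sum_list (map p ls)) (ent M) i k = (\<Sum>l\<leftarrow>ls. gram (p l) (ent (B l)) i k))"
  using assms(1) unfolding M_def
proof (induction ls)
  case Nil
  then show ?case by (simp add: gram_def)
next
  case (Cons l ls)
  let ?M = "foldr (\<lambda>l M. B l @\<^sub>r M) ls (0\<^sub>m 0 n)" and ?N = "sum_list (map p ls)"
  have B: "B l \<in> carrier_mat (p l) n" using Cons.prems by simp
  have M: "?M \<in> carrier_mat ?N n"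
    and g: "\<forall>i<n. \<forall>k<n. gram ?N (ent ?M) i k = (\<Sum>l\<leftarrow>ls. gram (p l) (ent (B l)) i k)"
    using Cons by auto
  have "gram (p l + ?N) (ent (B l @\<^sub>r ?M)) i k = gram (p l) (ent (B l)) i k + gram ?N (ent ?M) i k"
    if "i < n" "k < n" for i k
    unfolding gram_def sum_lessThan_add ent_def using that
    by (intro arg_cong2[where f="(+)"] sum.cong refl) (auto simp: append_rows_index[OF B M])
  then show ?case using carrier_append_rows[OF B M] g by simp
qed

text \<open>Stacking rows adds Gram matrices and the factor 1/sqrt m gets squared, so
  \<open>A^* A\<close> is the average of the block Gram matrices.\<close>

lemma sensing_matrix_gram:
  assumes B: "\<And>l. l \<in> {1..m} \<Longrightarrow> B l \<in> carrier_mat (p l) n" and m: "m \<ge> 1"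
  shows "sensing_matrix n m B \<in> carrier_mat (dim_row (sensing_matrix n m B)) n"
    and "i < n \<Longrightarrow> k < n \<Longrightarrow> gram (dim_row (sensing_matrix n m B)) (ent (sensing_matrix n m B)) i k =
      (\<Sum>l=1..m. (cadj (B l) * B l) $$ (i, k) / of_nat m)"
proof -
  let ?M = "foldr (\<lambda>l M. B l @\<^sub>r M) [1..<m+1] (0\<^sub>m 0 n)" and ?N = "sum_list (map p [1..<m+1])"
  have M: "?M \<in> carrier_mat ?N n"
    and g: "\<forall>i<n. \<forall>k<n. gram ?N (ent ?M) i k = (\<Sum>l\<leftarrow>[1..<m+1]. gram (p l) (ent (B l)) i k)"
  proof -
    have "B l \<in> carrier_mat (p l) n" if "l \<in> set [1..<m+1]" for l using that by (intro B) auto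
    from stack_carrier_gram[of "[1..<m+1]" B p n, OF this]
    show "?M \<in> carrier_mat ?N n"
      "\<forall>i<n. \<forall>k<n. gram ?N (ent ?M) i k = (\<Sum>l\<leftarrow>[1..<m+1]. gram (p l) (ent (B l)) i k)"
      by blast+
  qed
  have d: "dim_row (sensing_matrix n m B) = ?N" using M unfolding sensing_matrix_def by simp
  show c: "sensing_matrix n m B \<in> carrier_mat (dim_row (sensing_matrix n m B)) n"
    using M unfolding sensing_matrix_def by auto
  have sq: "complex_of_real (1 / sqrt (real m)) * complex_of_real (1 / sqrt (real m)) = 1 / of_nat m"
  proof -
    have "complex_of_real (1 / sqrt (real m)) * complex_of_real (1 / sqrt (real m)) = complex_of_real (1 / real m)"
      unfolding of_real_mult[symmetric] using m by simp
    then show ?thesis by simp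
  qed
  show "gram (dim_row (sensing_matrix n m B)) (ent (sensing_matrix n m B)) i k =
      (\<Sum>l=1..m. (cadj (B l) * B l) $$ (i, k) / of_nat m)" if ik: "i < n" "k < n"
  proof -
    let ?c = "complex_of_real (1 / sqrt (real m))"
    have "gram (dim_row (sensing_matrix n m B)) (ent (sensing_matrix n m B)) i k
        = (\<Sum>r<?N. cnj (?c * ent ?M r i) * (?c * ent ?M r k))"
      unfolding d gram_def using M ik
      by (intro sum.cong refl) (auto simp: sensing_matrix_def ent_def)
    also have "\<dots> = (\<Sum>r<?N. (?c * ?c) * (cnj (ent ?M r i) * ent ?M r k))"
      by (intro sum.cong refl) (simp only: complex_cnj_mult complex_cnj_complex_of_real mult_ac)
    also have "\<dots> = (1 / of_nat m) * gram ?N (ent ?M) i k"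
      unfolding sq gram_def sum_distrib_left ..
    also have "gram ?N (ent ?M) i k = (\<Sum>l\<leftarrow>[1..<m+1]. gram (p l) (ent (B l)) i k)" using g ik by blast
    also have "\<dots> = (\<Sum>l=1..m. gram (p l) (ent (B l)) i k)"
      by (simp only: sum_list_distinct_conv_sum_set[OF distinct_upt] set_upt Suc_eq_plus1[symmetric] atLeastLessThanSuc_atLeastAtMost)
    also have "\<dots> = (\<Sum>l=1..m. (cadj (B l) * B l) $$ (i, k))"
      by (intro sum.cong refl) (simp only: cadj_mult_index[OF B ik])
    finally show ?thesis by (simp add: sum_divide_distrib)
  qed
qed

section \<open>Operator norms and positivity of restricted Gram matrices\<close>

lemma l2norm_le_sum: "l2norm v \<le> (\<Sum>i<dim_vec v. cmod (v $ i))"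
  unfolding l2norm_eq_nrm nrm_def using L2_set_le_sum_abs[of "\<lambda>i. cmod (v $ i)" "{..<dim_vec v}"] by simp

text \<open>A real \<open>Sup\<close> dominates the elements of its set only if the set is bounded
  above; the sum of the absolute values of the entries is a crude but sufficient bound.\<close>

lemma l2norm_mult_le_opnorm22:
  assumes M: "M \<in> carrier_mat d d" and v: "v \<in> carrier_vec d" "l2norm v \<le> 1"
  shows "l2norm (M *\<^sub>v v) \<le> opnorm22 M"
  unfolding opnorm22_def
proof (rule cSup_upper)
  show "l2norm (M *\<^sub>v v) \<in> {l2norm (M *\<^sub>v v) |v. v \<in> carrier_vec (dim_col M) \<and> l2norm v \<le> 1}"
    using M v by auto
  show "bdd_above {l2norm (M *\<^sub>v v) |v. v \<in> carrier_vec (dim_col M) \<and> l2norm v \<le> 1}"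
  proof (rule bdd_aboveI)
    fix x assume "x \<in> {l2norm (M *\<^sub>v v) |v. v \<in> carrier_vec (dim_col M) \<and> l2norm v \<le> 1}"
    then obtain v where x: "x = l2norm (M *\<^sub>v v)" and v: "v \<in> carrier_vec d" "l2norm v \<le> 1" using M by auto
    have vk: "cmod (v $ k) \<le> 1" if "k < d" for k
    proof -
      have "(cmod (v $ k))\<^sup>2 \<le> (\<Sum>i<d. (cmod (v $ i))\<^sup>2)" using that by (intro member_le_sum) auto
      then have "cmod (v $ k) \<le> l2norm v" using v unfolding l2norm_def by (simp add: real_le_rsqrt)
      then show ?thesis using v by simp
    qed
    have "x \<le> (\<Sum>i<d. cmod ((M *\<^sub>v v) $ i))" using l2norm_le_sum[of "M *\<^sub>v v"] M by (simp add: x)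
    also have "\<dots> \<le> (\<Sum>i<d. \<Sum>k<d. cmod (M $$ (i, k)))"
    proof (rule sum_mono)
      fix i assume "i \<in> {..<d}"
      then have "(M *\<^sub>v v) $ i = (\<Sum>k<d. M $$ (i, k) * v $ k)" using M v by (simp add: scalar_prod_def atLeast0LessThan)
      also have "cmod \<dots> \<le> (\<Sum>k<d. cmod (M $$ (i, k)) * 1)"
        by (rule order_trans[OF norm_sum]) (auto simp: norm_mult vk intro!: sum_mono mult_left_le)
      finally show "cmod ((M *\<^sub>v v) $ i) \<le> (\<Sum>k<d. cmod (M $$ (i, k)))" by simp
    qed
    finally show "x \<le> (\<Sum>i<d. \<Sum>k<d. cmod (M $$ (i, k)))" .
  qed
qed

text \<open>\<open>restrT\<close> renumbers the columns in T by 0, ..., card T - 1. Normalising v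
  and transporting it along this bijection turns the norm bound into one over the index set T
  itself.\<close>

lemma opnorm22_restr_bound:
  assumes B: "B \<in> carrier_mat p n" and T: "T \<subseteq> {..<n}" and L: "L \<ge> 0"
    and op: "opnorm22 (cadj (restrT B T) * restrT B T) \<le> L"
  shows "nv T (mv T (gram p (ent B)) v) \<le> L\<^sup>2 * nv T v"
proof -
  define d where "d = card T"
  define t where "t = nth (sorted_list_of_set T)"
  have finT: "finite T" using T finite_subset by blast
  have bij: "bij_betw t {..<d} T" unfolding t_def d_def
    using finT by (intro bij_betw_nth) auto
  have tT: "t a \<in> T" "t a < n" if "a < d" for a using bij that T by (auto simp: bij_betw_def)
  have reindex: "(\<Sum>a<d. f (t a)) = (\<Sum>i\<in>T. f i)" for f :: "nat \<Rightarrow> 'b::comm_monoid_add"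
    by (rule sum.reindex_bij_betw[OF bij])
  let ?R = "restrT B T"
  have E: "embedT n T \<in> carrier_mat n d" by (simp add: embedT_def d_def)
  have R: "?R \<in> carrier_mat p d" unfolding restrT_def using B E by auto
  have Rent: "?R $$ (r, a) = B $$ (r, t a)" if "r < p" "a < d" for r a
  proof -
    have "?R $$ (r, a) = (\<Sum>i<n. B $$ (r, i) * embedT n T $$ (i, a))"
      unfolding restrT_def using B E that by (simp add: scalar_prod_def atLeast0LessThan)
    also have "\<dots> = (\<Sum>i<n. if i = t a then B $$ (r, t a) else 0)"
      using that by (intro sum.cong refl) (auto simp: embedT_def t_def d_def)
    also have "\<dots> = B $$ (r, t a)" using tT[OF that(2)] by simp
    finally show ?thesis .
  qed
  define M where "M = cadj ?R * ?R"
  have M: "M \<in> carrier_mat d d" unfolding M_def using R by (auto simp: cadj_def)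
  have Ment: "M $$ (a, b) = gram p (ent B) (t a) (t b)" if "a < d" "b < d" for a b
    unfolding M_def cadj_mult_index[OF R that] gram_def using that
    by (intro sum.cong refl) (simp add: ent_def Rent)
  show ?thesis
  proof (cases "nv T v = 0")
    case True
    then have "\<And>i. i \<in> T \<Longrightarrow> v i = 0" using finT by (simp add: nv_def sum_nonneg_eq_0_iff)
    then have "mv T (gram p (ent B)) v = (\<lambda>_. 0)" by (auto simp: mv_def fun_eq_iff)
    then show ?thesis by (simp add: nv_def sum_nonneg)
  next
    case False
    define c where "c = sqrt (nv T v)"
    have c: "c > 0" "c\<^sup>2 = nv T v" using False nv_nonneg[of T v] by (auto simp: c_def)
    define w where "w = vec d (\<lambda>a. v (t a) / complex_of_real c)"
    have w: "w \<in> carrier_vec d" by (simp add: w_def)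
    have "(\<Sum>a<d. (cmod (w $ a))\<^sup>2) = (\<Sum>a<d. (cmod (v (t a)))\<^sup>2 / c\<^sup>2)"
      by (intro sum.cong refl) (simp add: w_def norm_divide power_divide)
    also have "\<dots> = nv T v / c\<^sup>2"
      unfolding sum_divide_distrib[symmetric] reindex[of "\<lambda>i. (cmod (v i))\<^sup>2"] nv_def ..
    finally have "l2norm w \<le> 1" using w c False by (simp add: l2norm_def)
    then have "l2norm (M *\<^sub>v w) \<le> L" using l2norm_mult_le_opnorm22[OF M w] op unfolding M_def by linarith
    then have le: "(\<Sum>a<d. (cmod ((M *\<^sub>v w) $ a))\<^sup>2) \<le> L\<^sup>2"
      using M L unfolding l2norm_def by (simp add: sqrt_le_D)
    have "(M *\<^sub>v w) $ a = mv T (gram p (ent B)) v (t a) / complex_of_real c" if "a < d" for a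
    proof -
      have "(M *\<^sub>v w) $ a = (\<Sum>b<d. M $$ (a, b) * w $ b)" using M w that by (simp add: scalar_prod_def atLeast0LessThan)
      also have "\<dots> = (\<Sum>b<d. gram p (ent B) (t a) (t b) * v (t b)) / complex_of_real c"
        unfolding sum_divide_distrib using that by (intro sum.cong refl) (simp add: Ment w_def)
      also have "(\<Sum>b<d. gram p (ent B) (t a) (t b) * v (t b)) = mv T (gram p (ent B)) v (t a)"
        unfolding reindex[of "\<lambda>k. gram p (ent B) (t a) k * v k"] mv_def ..
      finally show ?thesis .
    qed
    then have "(\<Sum>a<d. (cmod ((M *\<^sub>v w) $ a))\<^sup>2) = (\<Sum>a<d. (cmod (mv T (gram p (ent B)) v (t a)))\<^sup>2 / c\<^sup>2)"
      by (intro sum.cong refl) (simp add: norm_divide power_divide)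
    also have "\<dots> = nv T (mv T (gram p (ent B)) v) / c\<^sup>2"
      unfolding sum_divide_distrib[symmetric] reindex[of "\<lambda>i. (cmod (mv T (gram p (ent B)) v i))\<^sup>2"] nv_def ..
    finally show ?thesis using le c False nv_nonneg[of T v] by (simp add: divide_le_eq)
  qed
qed

text \<open>For a positive matrix G of norm at most L, \<open>G^2 <= L G\<close>, without a matrix
  square root. As \<open>G = a^* a\<close>, the squared norm of G v is the pairing of a v with a G
  v; Cauchy-Schwarz and the bound L for a yield an inequality from which one factor cancels.\<close>

lemma gram_psd_bound:
  assumes T: "finite T" and L: "L \<ge> 0" and bd: "\<And>v. nv T (mv T (gram p a) v) \<le> L\<^sup>2 * nv T v"
  shows "nv T (mv T (gram p a) v) \<le> L * (\<Sum>i\<in>T. Re (cnj (v i) * mv T (gram p a) v i))"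
proof -
  let ?G = "mv T (gram p a)"
  have lin2: "(nrm p (lin T a v))\<^sup>2 = (\<Sum>i\<in>T. Re (cnj (v i) * ?G v i))" for v
  proof -
    have "(nrm p (lin T a v))\<^sup>2 = Re (\<Sum>r<p. cnj (lin T a v r) * lin T a v r)"
      unfolding nrm_power2 Re_sum by (intro sum.cong refl) (simp add: cmod_power2, simp add: power2_eq_square)
    also have "\<dots> = (\<Sum>i\<in>T. Re (cnj (v i) * ?G v i))"
    proof -
      have "Re (cnj x * y) = Re (cnj y * x)" for x y :: complex by (simp add: algebra_simps)
      then show ?thesis unfolding inner_lin Re_sum mv_def by (intro sum.cong refl)
    qed
    finally show ?thesis .
  qed
  have S: "sqrt (nv T f) = L2_set (\<lambda>i. cmod (f i)) T" for f by (simp add: nv_def L2_set_def)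
  have up: "(nrm p (lin T a v))\<^sup>2 \<le> L * nv T v" for v
  proof -
    have "(nrm p (lin T a v))\<^sup>2 \<le> (\<Sum>i\<in>T. cmod (v i) * cmod (?G v i))"
      unfolding lin2 by (intro sum_mono order_trans[OF complex_Re_le_cmod]) (simp add: norm_mult)
    also have "\<dots> \<le> sqrt (nv T v) * sqrt (nv T (?G v))"
      unfolding S by (rule order_trans[OF _ L2_set_mult_ineq]) simp
    also have "\<dots> \<le> sqrt (nv T v) * (L * sqrt (nv T v))"
      using real_sqrt_le_mono[OF bd[of v]] L by (intro mult_left_mono) (auto simp: real_sqrt_mult nv_nonneg)
    also have "\<dots> = L * (sqrt (nv T v) * sqrt (nv T v))" by (simp only: mult_ac)
    finally show ?thesis by (simp add: nv_nonneg)
  qed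
  let ?x = "nv T (?G v)"
  have "complex_of_real ?x = (\<Sum>r<p. cnj (lin T a v r) * lin T a (?G v) r)"
    unfolding inner_lin nv_def of_real_sum by (intro sum.cong refl) (simp only: mv_def complex_norm_square mult.commute)
  then have "?x \<le> nrm p (lin T a v) * nrm p (lin T a (?G v))"
    using nrm_inner_le[of "lin T a v" "lin T a (?G v)" p] nv_nonneg[of T "?G v"] by (metis norm_of_real abs_of_nonneg)
  then have "?x\<^sup>2 \<le> (nrm p (lin T a v))\<^sup>2 * (nrm p (lin T a (?G v)))\<^sup>2"
    unfolding power_mult_distrib[symmetric] by (intro power_mono nv_nonneg)
  also have "\<dots> \<le> (nrm p (lin T a v))\<^sup>2 * (L * ?x)" by (intro mult_left_mono up) auto
  finally have "?x * ?x \<le> ?x * (L * (nrm p (lin T a v))\<^sup>2)" by (simp add: power2_eq_square mult_ac)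
  moreover have "?x \<ge> 0" by (rule nv_nonneg)
  ultimately have "?x \<le> L * (nrm p (lin T a v))\<^sup>2"
    using L by (cases "?x = 0") auto
  then show ?thesis unfolding lin2 .
qed

lemma ip_columns: "ip T A B = (\<Sum>j\<in>T. \<Sum>i\<in>T. Re (cnj (A i j) * B i j))"
  unfolding ip_def by (rule sum.swap)

text \<open>Matrix inner products split over columns, so the vector inequality is applied to each
  column of W.\<close>

lemma ip_psd_bound:
  assumes "\<And>v. nv T (mv T Y v) \<le> R * (\<Sum>i\<in>T. Re (cnj (v i) * mv T Y v i))"
  shows "ip T (mmul T Y W) (mmul T Y W) \<le> R * ip T W (mmul T Y W)"
proof -
  have "ip T (mmul T Y W) (mmul T Y W) = (\<Sum>j\<in>T. nv T (mv T Y (\<lambda>i. W i j)))"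
    unfolding ip_self nv_def mmul_def mv_def by (rule sum.swap)
  also have "\<dots> \<le> (\<Sum>j\<in>T. R * (\<Sum>i\<in>T. Re (cnj (W i j) * mv T Y (\<lambda>i. W i j) i)))"
    by (intro sum_mono assms)
  also have "\<dots> = R * ip T W (mmul T Y W)"
    unfolding ip_columns sum_distrib_left mmul_def mv_def ..
  finally show ?thesis .
qed

section \<open>The random Gram matrices\<close>

lemma (in psd_sum) prob_moment_le:
  assumes "V \<ge> 0" "lam > 0" "R * (2 + 1 / (4 * lam)) \<le> V * (1 - (2 * real P - 1) * R * lam)"
    "(2 * real P - 1) * R * lam < 1" and d: "d > 0"
  shows "measure \<Omega> {\<omega> \<in> space \<Omega>. d ^ P \<le> ip T (mpow T (X \<omega>) P) (mpow T (X \<omega>) P)}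
    \<le> real (card T) * (real P * V / d) ^ P"
proof -
  have "measure \<Omega> {\<omega> \<in> space \<Omega>. d ^ P \<le> ip T (mpow T (X \<omega>) P) (mpow T (X \<omega>) P)} \<le> mom P / d ^ P"
    unfolding mom_def using bdd_meas_integrable[OF P.prob_space_axioms bdd_meas_mpow] d
    by (intro integral_Markov_inequality_measure[where A="{}"]) (auto simp: ip_nonneg)
  also have "\<dots> \<le> (real (card T) * (real P * V) ^ P) / d ^ P"
    using mom_le_power[OF assms(1-4)] d by (intro divide_right_mono) auto
  finally show ?thesis by (simp add: power_divide)
qed

lemma borel_measurable_neumann:
  assumes S: "finite S" and H: "\<And>i k. (\<lambda>x. H x i k) \<in> borel_measurable M"
    and c: "\<And>i. (\<lambda>x. c x i) \<in> borel_measurable M"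
  shows "(\<lambda>x. neumann S (H x) (c x) i) \<in> borel_measurable M"
proof -
  have "(\<lambda>x. (mv S (H x) ^^ k) (c x) i) \<in> borel_measurable M" for k i
  proof (induction k arbitrary: i)
    case (Suc k)
    then show ?case using H unfolding funpow.simps comp_apply mv_def
      by (intro borel_measurable_sum borel_measurable_times)
  qed (simp add: c)
  then show ?thesis unfolding neumann_def
    by (intro borel_measurable_suminf borel_measurable_times borel_measurable_const)
qed

section \<open>What a small trace of a high power implies for the columns\<close>

lemma nv_cong: "(\<And>i. i \<in> S \<Longrightarrow> v i = w i) \<Longrightarrow> nv S v = nv S w"
  by (simp add: nv_def)

lemma mv_cong: "(\<And>k. k \<in> S \<Longrightarrow> v k = w k) \<Longrightarrow> mv S A v = mv S A w"
  by (simp add: mv_def)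

text \<open>Testing the contraction \<open>H\<close> on the vector that equals \<open>w\<close> on \<open>S\<close> and \<open>-1\<close> at \<open>j\<close>, whose image
  restricted to \<open>S\<close> is \<open>-w\<close>, gives the bound \<open>d / (1 - d)\<close>.\<close>

lemma contraction_column:
  assumes S: "finite S" "j \<notin> S" and H: "herm H" "supp (insert j S) H"
    and P: "P > 0" and d: "0 < d" "d < 1"
    and less: "ip (insert j S) (mpow (insert j S) H P) (mpow (insert j S) H P) < d ^ P"
  defines "w \<equiv> neumann S H (\<lambda>i. H i j)"
  shows "nv S (mv S H v) \<le> d * nv S v"
    and "i \<in> S \<Longrightarrow> w i + mv S H w i = H i j"
    and "nv S w < d / (1 - d)"
    and "cmod (H j j) \<le> 1"
proof -
  let ?T = "insert j S"
  have T: "finite ?T" using S by simp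
  note less' = nv_mv_less[OF T H _ P less_imp_le[OF d(1)] less]
  have le: "nv ?T (mv ?T H v) \<le> d * nv ?T v" for v
  proof (cases "nv ?T v = 0")
    case True
    then have z: "v i = 0" if "i \<in> ?T" for i using T that by (auto simp: nv_def sum_nonneg_eq_0_iff)
    then have "mv ?T H v = (\<lambda>_. 0)" unfolding mv_def using z by (intro ext sum.neutral) auto
    then show ?thesis using True by (simp add: nv_def)
  next
    case False
    then show ?thesis using less'[of v] nv_nonneg[of ?T v] by simp
  qed
  have nvT: "nv ?T v = (cmod (v j))\<^sup>2 + nv S v" for v using S by (simp add: nv_def)
  have mvT: "mv ?T H v i = H i j * v j + mv S H v i" for v i using S by (simp add: mv_def)
  have con: "nv S (mv S H v) \<le> d * nv S v" for v
  proof -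
    \<comment> \<open>Setting the value at j to zero restricts the contraction on
      \<open>insert j S\<close> to S.\<close>
    define v' where "v' i = (if i = j then 0 else v i)" for i
    have 1: "nv S v' = nv S v" using S by (intro nv_cong) (auto simp: v'_def)
    have 2: "mv S H v' = mv S H v" using S by (intro mv_cong) (auto simp: v'_def)
    have "nv S (mv S H v) = nv S (mv ?T H v')" by (rule nv_cong) (simp add: mvT 2 v'_def)
    also have "\<dots> \<le> nv ?T (mv ?T H v')" by (simp add: nvT)
    also have "\<dots> \<le> d * nv ?T v'" by (rule le)
    also have "\<dots> = d * nv S v" by (simp add: nvT 1) (simp add: v'_def)
    finally show ?thesis .
  qed
  show "nv S (mv S H v) \<le> d * nv S v" by (rule con)
  \<comment> \<open>d bounds squared norms, while \<open>neumann_solves\<close> expects the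
    contraction factor of the norm itself.\<close>
  have sq: "0 \<le> sqrt d" "sqrt d < 1" "(sqrt d)\<^sup>2 = d" using d by auto
  show w: "w i + mv S H w i = H i j" if "i \<in> S" for i
    unfolding w_def using neumann_solves[OF S(1) sq(1,2), of H i "\<lambda>i. H i j"] con that by (simp add: sq(3))
  show "nv S w < d / (1 - d)"
  proof -
    define v where "v i = (if i = j then -1 else w i)" for i
    have 1: "nv S v = nv S w" using S by (intro nv_cong) (auto simp: v_def)
    have 2: "mv S H v = mv S H w" using S by (intro mv_cong) (auto simp: v_def)
    have vj: "v j = -1" by (simp add: v_def)
    have "nv S w = nv S (mv ?T H v)"
      unfolding nv_def
    proof (intro sum.cong refl)
      fix i assume "i \<in> S"
      then have "mv ?T H v i = - w i" using w[of i] by (simp add: mvT 2 vj algebra_simps)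
      then show "(cmod (w i))\<^sup>2 = (cmod (mv ?T H v i))\<^sup>2" by simp
    qed
    also have "\<dots> \<le> nv ?T (mv ?T H v)" by (simp add: nvT)
    also have "\<dots> < d * nv ?T v" by (rule less') (simp add: nvT vj nv_nonneg add_pos_nonneg)
    also have "\<dots> = d * (1 + nv S w)" by (simp add: nvT 1 vj)
    finally show ?thesis using d by (simp add: field_simps)
  qed
  show "cmod (H j j) \<le> 1"
  proof -
    \<comment> \<open>The j-th unit vector: its image has \<open>H j j\<close> among its
      entries.\<close>
    define v :: "nat \<Rightarrow> complex" where "v i = (if i = j then 1 else 0)" for i
    have v: "v j = 1" "nv S v = 0" "mv S H v j = 0" using S by (auto simp: v_def nv_def mv_def intro!: sum.neutral)
    have "(cmod (H j j))\<^sup>2 \<le> nv ?T (mv ?T H v)" by (simp add: nvT mvT v nv_nonneg)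
    also have "\<dots> \<le> d * nv ?T v" by (rule le)
    also have "\<dots> \<le> 1\<^sup>2" using d by (simp add: nvT v)
    finally show ?thesis by (rule power2_le_imp_le) simp
  qed
qed

text \<open>The set where the operator norm bounds hold need not be measurable.
  \<open>good l\<close> is a measurable set of full measure contained in it.\<close>

locale sensing = subgaussian \<mu> q for \<mu> :: "complex measure" and q :: "complex \<Rightarrow> real" +
  fixes n m :: nat and p :: "nat \<Rightarrow> nat" and F :: "nat \<Rightarrow> complex mat measure" and S :: "nat set"
    and Lam :: "nat set \<Rightarrow> real" and good :: "nat \<Rightarrow> complex mat set"
  assumes ok: "setting_ok n m p F S Lam" and S_sub: "S \<subseteq> {..<n}"
    and unimodular: "AE z in \<mu>. cmod z = 1"
    and good_sets: "l \<in> {1..m} \<Longrightarrow> good l \<in> sets (F l)"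
    and good_AE: "l \<in> {1..m} \<Longrightarrow> AE b in F l. b \<in> good l"
    and good_op: "l \<in> {1..m} \<Longrightarrow> b \<in> good l \<Longrightarrow> j \<in> {..<n} - S \<Longrightarrow>
      opnorm22 (cadj (restrT b (S \<union> {j})) * restrT b (S \<union> {j})) \<le> Lam (S \<union> {j})"
begin

lemma nm: "n \<ge> 1" "m \<ge> 1" using ok by (auto simp: setting_ok_def)

lemma finite_S: "finite S" using S_sub finite_subset by blast

lemma prob_F: "l \<in> {1..m} \<Longrightarrow> prob_space (F l)"
  and carrier_F: "l \<in> {1..m} \<Longrightarrow> b \<in> space (F l) \<Longrightarrow> b \<in> carrier_mat (p l) n"
  using ok by (auto simp: setting_ok_def)

lemma Lam_pos: "j \<in> {..<n} - S \<Longrightarrow> Lam (S \<union> {j}) > 0"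
  using ok by (auto simp: setting_ok_def)

text \<open>Product spaces of probability measures require a probability measure at every index,
  whereas the setting constrains F only on {1..m}.\<close>

definition F' :: "nat \<Rightarrow> complex mat measure" where "F' l = (if l \<in> {1..m} then F l else F 1)"

text \<open>Off the almost sure set \<open>good l\<close> the Gram matrix is replaced by 0. Only Gram entries are assumed
  measurable, so everything random below is a function of them.\<close>

definition Y :: "nat \<Rightarrow> nat \<Rightarrow> complex mat \<Rightarrow> nat \<Rightarrow> nat \<Rightarrow> complex" where
  "Y j l b i k = (if b \<in> good l \<and> i \<in> insert j S \<and> k \<in> insert j S then (cadj b * b) $$ (i, k) / of_nat m else 0)"

definition R :: "nat \<Rightarrow> real" where "R j = Lam (S \<union> {j}) / real m"

definition H :: "nat \<Rightarrow> (nat \<Rightarrow> complex mat) \<Rightarrow> nat \<Rightarrow> nat \<Rightarrow> complex" where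
  "H j \<omega> = (\<Sum>l\<in>{1..m}. Y j l (\<omega> l)) - idm (insert j S)"

lemma prob_F': "prob_space (F' l)"
  using prob_F[of l] prob_F[of 1] nm by (auto simp: F'_def)

lemma PiM_F': "PiM {1..m} F' = PiM {1..m} F"
  by (rule PiM_cong) (auto simp: F'_def)

lemma good_carrier: "l \<in> {1..m} \<Longrightarrow> b \<in> good l \<Longrightarrow> b \<in> carrier_mat (p l) n"
  using good_sets[of l] sets.sets_into_space carrier_F by blast

text \<open>Spreading 1/m over both factors as 1/sqrt m makes the summand itself a Gram matrix, so
  symmetry and positivity come from the general facts on \<open>gram\<close>.\<close>

lemma Y_good:
  assumes "l \<in> {1..m}" "b \<in> good l" "j < n" "i \<in> insert j S" "k \<in> insert j S"
  shows "Y j l b i k = gram (p l) (\<lambda>r i. ent b r i / complex_of_real (sqrt (real m))) i k"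
proof -
  have "i < n" "k < n" using assms S_sub by auto
  then have "Y j l b i k = gram (p l) (ent b) i k / of_nat m"
    using assms cadj_mult_index[OF good_carrier[OF assms(1,2)]] by (simp add: Y_def)
  also have "\<dots> = gram (p l) (\<lambda>r i. ent b r i / complex_of_real (sqrt (real m))) i k"
    by (simp add: gram_def sum_divide_distrib of_real_mult[symmetric] del: of_real_mult)
  finally show ?thesis .
qed

lemma Y_herm: "l \<in> {1..m} \<Longrightarrow> j < n \<Longrightarrow> herm (Y j l b)"
proof (rule hermI)
  fix i k assume l: "l \<in> {1..m}" "j < n"
  show "cnj (Y j l b i k) = Y j l b k i"
  proof (cases "b \<in> good l \<and> i \<in> insert j S \<and> k \<in> insert j S")
    case True
    then show ?thesis using l by (simp only: Y_good gram_cnj)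
  next
    case False
    then show ?thesis by (auto simp: Y_def)
  qed
qed

lemma Y_psd_form:
  assumes l: "l \<in> {1..m}" and j: "j \<in> {..<n} - S"
  shows "nv (insert j S) (mv (insert j S) (Y j l b) v) \<le>
    R j * (\<Sum>i\<in>insert j S. Re (cnj (v i) * mv (insert j S) (Y j l b) v i))"
    and "nv (insert j S) (mv (insert j S) (Y j l b) v) \<le> (R j)\<^sup>2 * nv (insert j S) v"
proof -
  let ?T = "insert j S"
  have T: "?T \<subseteq> {..<n}" "finite ?T" using S_sub j finite_S by auto
  have L: "Lam ?T > 0" using Lam_pos[OF j] by simp
  then have R0: "R j \<ge> 0" by (simp add: R_def)
  have "nv ?T (mv ?T (Y j l b) v) \<le> R j * (\<Sum>i\<in>?T. Re (cnj (v i) * mv ?T (Y j l b) v i)) \<and>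
     nv ?T (mv ?T (Y j l b) v) \<le> (R j)\<^sup>2 * nv ?T v"
  proof (cases "b \<in> good l")
    case False
    then have "mv ?T (Y j l b) v = (\<lambda>_. 0)" by (simp add: mv_def Y_def)
    then show ?thesis using nv_nonneg[of ?T v] by (simp add: nv_def)
  next
    case True
    let ?a = "\<lambda>r i. ent b r i / complex_of_real (sqrt (real m))"
    have e: "mv ?T (Y j l b) v i = mv ?T (gram (p l) ?a) v i" if "i \<in> ?T" for v i
      unfolding mv_def using Y_good[OF l True _ that] j by (intro sum.cong refl) auto
    have n1: "nv ?T (mv ?T (Y j l b) v) = nv ?T (mv ?T (gram (p l) ?a) v)" for v
      by (rule nv_cong) (rule e)
    have "opnorm22 (cadj (restrT b ?T) * restrT b ?T) \<le> Lam ?T" using good_op[OF l True j] by simp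
    from opnorm22_restr_bound[OF good_carrier[OF l True] T(1) less_imp_le[OF L] this]
    have b: "nv ?T (mv ?T (gram (p l) (ent b)) v) \<le> (Lam ?T)\<^sup>2 * nv ?T v" for v .
    have "mv ?T (gram (p l) ?a) v = (\<lambda>i. mv ?T (gram (p l) (ent b)) v i / of_nat m)" for v
      by (simp add: mv_def gram_def sum_divide_distrib[symmetric] of_real_mult[symmetric] del: of_real_mult)
    then have bd: "nv ?T (mv ?T (gram (p l) ?a) v) \<le> (R j)\<^sup>2 * nv ?T v" for v
      using divide_right_mono[OF b[of v], of "(real m)\<^sup>2"]
      by (simp add: nv_def R_def norm_divide power_divide sum_divide_distrib)
    have "nv ?T (mv ?T (gram (p l) ?a) v) \<le> R j * (\<Sum>i\<in>?T. Re (cnj (v i) * mv ?T (gram (p l) ?a) v i))"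
      by (rule gram_psd_bound[OF T(2) R0 bd])
    moreover have "(\<Sum>i\<in>?T. Re (cnj (v i) * mv ?T (gram (p l) ?a) v i)) = (\<Sum>i\<in>?T. Re (cnj (v i) * mv ?T (Y j l b) v i))"
      by (intro sum.cong refl) (simp only: e)
    ultimately show ?thesis using bd[of v] by (simp only: n1)
  qed
  then show "nv ?T (mv ?T (Y j l b) v) \<le> R j * (\<Sum>i\<in>?T. Re (cnj (v i) * mv ?T (Y j l b) v i))"
    "nv ?T (mv ?T (Y j l b) v) \<le> (R j)\<^sup>2 * nv ?T v" by auto
qed

lemma Y_measurable:
  assumes l: "l \<in> {1..m}" and j: "j < n"
  shows "(\<lambda>b. Y j l b i k) \<in> borel_measurable (F l)"
proof (cases "i \<in> insert j S \<and> k \<in> insert j S")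
  case True
  then have "i < n" "k < n" using j S_sub by auto
  then have "integrable (F l) (\<lambda>b. (cadj b * b) $$ (i, k))" using ok l by (simp add: setting_ok_def)
  then have "(\<lambda>b. (cadj b * b) $$ (i, k)) \<in> borel_measurable (F l)" by (rule borel_measurable_integrable)
  moreover have "{b \<in> space (F l). b \<in> good l} = good l"
    using sets.sets_into_space[OF good_sets[OF l]] by blast
  ultimately have "(\<lambda>b. if b \<in> good l then (cadj b * b) $$ (i, k) / of_nat m else 0) \<in> borel_measurable (F l)"
    using good_sets[OF l]
    by (intro measurable_If borel_measurable_divide borel_measurable_const) (simp_all only:)
  moreover have "(\<lambda>b. Y j l b i k) = (\<lambda>b. if b \<in> good l then (cadj b * b) $$ (i, k) / of_nat m else 0)"
    unfolding Y_def using True by auto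
  ultimately show ?thesis by (simp only:)
next
  case False
  then have "(\<lambda>b. Y j l b i k) = (\<lambda>_. 0)" by (auto simp: Y_def)
  then show ?thesis by simp
qed

text \<open>The norm bound tested on the k-th unit vector controls column k and hence each of its
  entries.\<close>

lemma Y_bounded:
  assumes l: "l \<in> {1..m}" and j: "j \<in> {..<n} - S"
  shows "cmod (Y j l b i k) \<le> R j"
proof (cases "i \<in> insert j S \<and> k \<in> insert j S")
  case True
  let ?T = "insert j S" and ?e = "\<lambda>i. if i = k then 1 else (0::complex)"
  have T: "finite ?T" using finite_S by simp
  have R0: "R j \<ge> 0" using Lam_pos[OF j] by (simp add: R_def)
  have "mv ?T (Y j l b) ?e i = (\<Sum>x\<in>?T. if x = k then Y j l b i k else 0)"
    unfolding mv_def by (intro sum.cong) auto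
  also have "\<dots> = Y j l b i k" using T True by simp
  finally have "(cmod (Y j l b i k))\<^sup>2 \<le> nv ?T (mv ?T (Y j l b) ?e)"
    using nv_le_sum[OF T, of i "mv ?T (Y j l b) ?e"] True by simp
  also have "\<dots> \<le> (R j)\<^sup>2 * nv ?T ?e" by (rule Y_psd_form(2)[OF l j])
  also have "nv ?T ?e = (\<Sum>x\<in>?T. if x = k then 1 else 0)" unfolding nv_def by (intro sum.cong) auto
  also have "\<dots> = 1" using T True by simp
  finally have "(cmod (Y j l b i k))\<^sup>2 \<le> (R j)\<^sup>2" by simp
  then show ?thesis using R0 by (rule power2_le_imp_le)
next
  case False
  then show ?thesis using Lam_pos[OF j] by (auto simp: Y_def R_def)
qed

text \<open>Truncation to \<open>good l\<close> changes nothing almost surely, so isotropy carries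
  over to the truncated summands.\<close>

lemma Y_mean:
  assumes j: "j \<in> {..<n} - S"
  shows "(\<Sum>l\<in>{1..m}. \<integral>b. Y j l b i k \<partial>F' l) = idm (insert j S) i k"
proof (cases "i \<in> insert j S \<and> k \<in> insert j S")
  case True
  then have ik: "i < n" "k < n" using j S_sub by auto
  have int: "integrable (F l) (\<lambda>b. (cadj b * b) $$ (i, k))" if "l \<in> {1..m}" for l
    using ok ik that by (simp add: setting_ok_def)
  have iso: "(1 / of_nat m) * (\<Sum>l=1..m. (\<integral>B. (cadj B * B) $$ (i,k) \<partial>F l)) = (if i = k then 1 else (0::complex))"
    using ok ik by (simp add: setting_ok_def)
  have "(\<Sum>l\<in>{1..m}. \<integral>b. Y j l b i k \<partial>F' l) = (\<Sum>l\<in>{1..m}. (\<integral>b. (cadj b * b) $$ (i, k) \<partial>F l) / of_nat m)"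
  proof (intro sum.cong refl)
    fix l assume l: "l \<in> {1..m}"
    have "(\<integral>b. Y j l b i k \<partial>F' l) = (\<integral>b. (cadj b * b) $$ (i, k) / of_nat m \<partial>F l)"
    proof -
      have ae: "AE b in F l. Y j l b i k = (cadj b * b) $$ (i, k) / of_nat m"
        using good_AE[OF l] by eventually_elim (use True in \<open>simp add: Y_def\<close>)
      have Fl: "F' l = F l" using l by (simp add: F'_def)
      have me: "(\<lambda>b. (cadj b * b) $$ (i, k) / of_nat m) \<in> borel_measurable (F l)"
        using int[OF l] by (intro borel_measurable_divide borel_measurable_const) auto
      have "j < n" using j by auto
      from integral_cong_AE[OF Y_measurable[OF l this] me ae] show ?thesis unfolding Fl .
    qed
    then show "(\<integral>b. Y j l b i k \<partial>F' l) = (\<integral>b. (cadj b * b) $$ (i, k) \<partial>F l) / of_nat m" by simp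
  qed
  also have "\<dots> = (1 / of_nat m) * (\<Sum>l=1..m. (\<integral>B. (cadj B * B) $$ (i,k) \<partial>F l))"
    by (simp add: sum_divide_distrib)
  also have "\<dots> = idm (insert j S) i k" unfolding iso using True by (auto simp: idm_def)
  finally show ?thesis .
next
  case False
  then show ?thesis by (auto simp: Y_def idm_def)
qed

lemma psd_sum_Y:
  assumes j: "j \<in> {..<n} - S"
  shows "psd_sum F' {1..m} (insert j S) (Y j) (R j)"
proof (intro psd_sum.intro psd_sum_axioms.intro product_prob_spaceI prob_F')
  fix l assume l: "l \<in> {1..m}"
  show "bdd_mat (F' l) (Y j l)"
    unfolding bdd_mat_def using Y_measurable[OF l, of j] Y_bounded[OF l j] j l
    by (auto intro!: bdd_measI simp: F'_def)
  show "herm (Y j l b)" for b using Y_herm[OF l] j by auto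
  show "supp (insert j S) (Y j l b)" for b by (auto simp: supp_def Y_def)
  show "ip (insert j S) (mmul (insert j S) (Y j l b) W) (mmul (insert j S) (Y j l b) W)
      \<le> R j * ip (insert j S) W (mmul (insert j S) (Y j l b) W)" for b W
    by (rule ip_psd_bound) (rule Y_psd_form(1)[OF l j])
qed (use finite_S Y_mean[OF j] Lam_pos[OF j] in \<open>auto simp: R_def\<close>)

lemma H_eq_X:
  assumes j: "j \<in> {..<n} - S"
  shows "psd_sum.X {1..m} (insert j S) (Y j) = H j"
  using psd_sum.X_def[OF psd_sum_Y[OF j]] by (auto simp: H_def fun_eq_iff)

end

section \<open>The probability of the good event and the certificate on it\<close>

lemma sum_apply2: "(\<Sum>k\<in>I. A k) i j = (\<Sum>k\<in>I. A k i j)"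
  for A :: "'k \<Rightarrow> nat \<Rightarrow> nat \<Rightarrow> complex"
  by (induction I rule: infinite_finite_induct) auto

context sensing
begin

definition "Om = PiM {1..m} F'"
abbreviation "\<Sigma> \<equiv> PiM S (\<lambda>_. \<mu>)"

text \<open>I + H restricted to S is \<open>A_S^* A_S\<close>, and for j outside S the column j of H
  on S is \<open>A_S^* a_j\<close>; when the series converges these are the regression coefficients
  of column j on the columns in S.\<close>

definition w :: "nat \<Rightarrow> (nat \<Rightarrow> complex mat) \<Rightarrow> nat \<Rightarrow> complex" where
  "w j \<omega> = neumann S (H j \<omega>) (\<lambda>i. H j \<omega> i j)"

definition fpow :: "nat \<Rightarrow> nat \<Rightarrow> (nat \<Rightarrow> complex mat) \<Rightarrow> real" where
  "fpow P j \<omega> = ip (insert j S) (mpow (insert j S) (H j \<omega>) P) (mpow (insert j S) (H j \<omega>) P)"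

text \<open>The value of the dual vector at j, written as a linear form in the signs whose
  coefficients depend on the matrices alone.\<close>

definition dev :: "nat \<Rightarrow> (nat \<Rightarrow> complex mat) \<Rightarrow> (nat \<Rightarrow> complex) \<Rightarrow> complex" where
  "dev j \<omega> s = (\<Sum>i\<in>S. cnj (w j \<omega> i) * s i)"

lemma prob_Om: "prob_space Om" unfolding Om_def by (rule prob_space_PiM) (rule prob_F')
lemma prob_\<Sigma>: "prob_space \<Sigma>" by (rule prob_space_PiM) (rule prob_\<mu>)

lemma H_props:
  assumes j: "j \<in> {..<n} - S"
  shows "herm (H j \<omega>)" "supp (insert j S) (H j \<omega>)" "bdd_mat Om (H j)"
  using psd_sum.herm_X[OF psd_sum_Y[OF j]] psd_sum.supp_X[OF psd_sum_Y[OF j]] psd_sum.X_bdd_meas[OF psd_sum_Y[OF j]]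
  by (simp_all only: H_eq_X[OF j] Om_def)

lemma fpow_measurable: "j \<in> {..<n} - S \<Longrightarrow> fpow P j \<in> borel_measurable Om"
  unfolding fpow_def[abs_def] by (intro bdd_measD bdd_meas_ip bdd_mat_mpow H_props)

lemma w_measurable: "j \<in> {..<n} - S \<Longrightarrow> (\<lambda>\<omega>. w j \<omega> i) \<in> borel_measurable Om"
  unfolding w_def using H_props(3)[of j] finite_S
  by (intro borel_measurable_neumann bdd_measD) (auto simp: bdd_mat_def)

lemma dev_measurable:
  assumes j: "j \<in> {..<n} - S"
  shows "(\<lambda>p. dev j (fst p) (snd p)) \<in> borel_measurable (Om \<Otimes>\<^sub>M \<Sigma>)"
proof -
  have a: "(\<lambda>p. cnj (w j (fst p) i)) \<in> borel_measurable (Om \<Otimes>\<^sub>M \<Sigma>)" for i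
  proof -
    have "cnj \<in> borel_measurable borel" by (intro borel_measurable_continuous_onI continuous_intros)
    from measurable_compose[OF measurable_compose[OF measurable_fst w_measurable[OF j]] this] show ?thesis .
  qed
  have b: "(\<lambda>p. snd p i) \<in> borel_measurable (Om \<Otimes>\<^sub>M \<Sigma>)" if "i \<in> S" for i
    by (rule measurable_compose[OF measurable_snd coord_meas[OF that]])
  show ?thesis unfolding dev_def by (intro borel_measurable_sum borel_measurable_times a b)
qed

text \<open>Union bound over two null sets (\<open>A1\<close>, \<open>A2\<close>) and, for each j, a
  large trace moment (\<open>C2\<close>, by Markov) and a large dual value despite a small moment
  (\<open>C3\<close>, by the sign tail).\<close>

lemma good_event:
  assumes P: "P > 0" and d: "0 < d" "d < 1" and \<tau>: "\<tau> > 0" and V: "V \<ge> 0" and lam: "lam > 0"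
    and R1: "\<And>j. j \<in> {..<n} - S \<Longrightarrow> R j * (2 + 1 / (4 * lam)) \<le> V * (1 - (2 * real P - 1) * R j * lam)"
    and R2: "\<And>j. j \<in> {..<n} - S \<Longrightarrow> (2 * real P - 1) * R j * lam < 1"
    and \<epsilon>: "real (card ({..<n} - S)) * (real (card S + 1) * (real P * V / d) ^ P
        + 4 * exp (- (\<tau>\<^sup>2 / (2 * (d / (1 - d)))))) \<le> \<epsilon>"
  shows "\<exists>E\<in>sets (Om \<Otimes>\<^sub>M \<Sigma>). measure (Om \<Otimes>\<^sub>M \<Sigma>) E \<ge> 1 - \<epsilon> \<and>
    (\<forall>x\<in>E. (\<forall>l\<in>{1..m}. fst x l \<in> good l) \<and> (\<forall>i\<in>S. cmod (snd x i) = 1) \<and>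
      (\<forall>j\<in>{..<n} - S. fpow P j (fst x) < d ^ P \<and> cmod (dev j (fst x) (snd x)) < \<tau>))"
proof -
  interpret O: prob_space Om by (rule prob_Om)
  interpret Si: prob_space \<Sigma> by (rule prob_\<Sigma>)
  interpret J: pair_prob_space Om \<Sigma> ..
  let ?J = "Om \<Otimes>\<^sub>M \<Sigma>" and ?D = "{..<n} - S"
  have sp: "space ?J = space Om \<times> space \<Sigma>" by (rule space_pair_measure)
  have "AE \<omega> in Om. \<forall>l\<in>{1..m}. \<omega> l \<in> good l"
  proof (intro eventually_ball_finite ballI)
    fix l assume l: "l \<in> {1..m}"
    have "F' l = F l" unfolding F'_def using l by (rule if_P)
    then have "AE b in F' l. b \<in> good l" using good_AE[OF l] by (simp only:)
    then show "AE \<omega> in Om. \<omega> l \<in> good l"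
      unfolding Om_def by (rule AE_PiM_component[OF prob_F' l])
  qed simp
  then obtain N1 where N1: "{\<omega> \<in> space Om. \<not> (\<forall>l\<in>{1..m}. \<omega> l \<in> good l)} \<subseteq> N1" "emeasure Om N1 = 0" "N1 \<in> sets Om"
    by (rule AE_E)
  have "AE s in \<Sigma>. \<forall>i\<in>S. cmod (s i) = 1"
  proof (intro eventually_ball_finite ballI finite_S)
    fix i assume i: "i \<in> S"
    show "AE s in \<Sigma>. cmod (s i) = 1"
      by (rule AE_PiM_component) (use i unimodular prob_\<mu> in auto)
  qed
  then obtain N2 where N2: "{s \<in> space \<Sigma>. \<not> (\<forall>i\<in>S. cmod (s i) = 1)} \<subseteq> N2" "emeasure \<Sigma> N2 = 0" "N2 \<in> sets \<Sigma>"
    by (rule AE_E)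
  define A1 where "A1 = N1 \<times> space \<Sigma>"
  define A2 where "A2 = space Om \<times> N2"
  define B2 where "B2 j = {\<omega> \<in> space Om. d ^ P \<le> fpow P j \<omega>}" for j
  define C2 where "C2 j = B2 j \<times> space \<Sigma>" for j
  \<comment> \<open>The moment condition is part of the event because the bound on the coefficients
    w holds only under it; its failure is already counted in \<open>C2\<close>.\<close>
  define C3 where "C3 j = {x \<in> space ?J. fpow P j (fst x) < d ^ P \<and> \<tau> \<le> cmod (dev j (fst x) (snd x))}" for j
  have A1: "A1 \<in> sets ?J" "measure ?J A1 = 0"
    using N1 Si.emeasure_pair_measure_Times[OF N1(3) sets.top] by (auto simp: A1_def measure_def)
  have A2: "A2 \<in> sets ?J" "measure ?J A2 = 0"
    using N2 Si.emeasure_pair_measure_Times[OF sets.top[of Om] N2(3)] by (auto simp: A2_def measure_def)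
  have B2: "B2 j \<in> sets Om" if "j \<in> ?D" for j
    unfolding B2_def by (rule borel_measurable_le[OF borel_measurable_const fpow_measurable[OF that]])
  have C2: "C2 j \<in> sets ?J" "measure ?J (C2 j) \<le> real (card S + 1) * (real P * V / d) ^ P" if j: "j \<in> ?D" for j
  proof -
    show "C2 j \<in> sets ?J" using B2[OF j] by (auto simp: C2_def)
    have "measure ?J (C2 j) = measure Om (B2 j)"
      using Si.emeasure_pair_measure_Times[OF B2[OF j] sets.top]
      by (simp add: C2_def measure_def Si.emeasure_space_1)
    also have "\<dots> \<le> real (card (insert j S)) * (real P * V / d) ^ P"
      using psd_sum.prob_moment_le[OF psd_sum_Y[OF j] V lam R1[OF j] R2[OF j] d(1)]
      unfolding H_eq_X[OF j] B2_def fpow_def Om_def .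
    finally show "measure ?J (C2 j) \<le> real (card S + 1) * (real P * V / d) ^ P"
      using j finite_S by simp
  qed
  have C3: "C3 j \<in> sets ?J" "measure ?J (C3 j) \<le> 4 * exp (- (\<tau>\<^sup>2 / (2 * (d / (1 - d)))))" if j: "j \<in> ?D" for j
  proof -
    have "{x \<in> space ?J. fpow P j (fst x) < d ^ P} \<in> sets ?J"
      by (rule borel_measurable_less[OF measurable_compose[OF measurable_fst fpow_measurable[OF j]] borel_measurable_const])
    moreover have "{x \<in> space ?J. \<tau> \<le> cmod (dev j (fst x) (snd x))} \<in> sets ?J"
      by (rule borel_measurable_le[OF borel_measurable_const measurable_compose[OF dev_measurable[OF j] borel_measurable_norm]])
    ultimately have "{x \<in> space ?J. fpow P j (fst x) < d ^ P} \<inter> {x \<in> space ?J. \<tau> \<le> cmod (dev j (fst x) (snd x))} \<in> sets ?J"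
      by (rule sets.Int)
    also have "{x \<in> space ?J. fpow P j (fst x) < d ^ P} \<inter> {x \<in> space ?J. \<tau> \<le> cmod (dev j (fst x) (snd x))} = C3 j"
      unfolding C3_def by blast
    finally show C3m: "C3 j \<in> sets ?J" .
    let ?q = "ennreal (4 * exp (- (\<tau>\<^sup>2 / (2 * (d / (1 - d))))))"
    \<comment> \<open>Signs and matrices are independent: on the slice at a fixed \<omega> the
      coefficients are constants, so \<open>tail_cmod\<close> applies.\<close>
    have "emeasure ?J (C3 j) = (\<integral>\<^sup>+\<omega>. emeasure \<Sigma> (Pair \<omega> -` C3 j) \<partial>Om)"
      by (rule Si.emeasure_pair_measure_alt[OF C3m])
    also have "\<dots> \<le> (\<integral>\<^sup>+\<omega>. ?q \<partial>Om)"
    proof (rule nn_integral_mono)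
      fix \<omega> assume om: "\<omega> \<in> space Om"
      show "emeasure \<Sigma> (Pair \<omega> -` C3 j) \<le> ?q"
      proof (cases "fpow P j \<omega> < d ^ P")
        case False
        then have "Pair \<omega> -` C3 j = {}" by (auto simp: C3_def)
        then show ?thesis by simp
      next
        case True
        have "Pair \<omega> -` C3 j = {s \<in> space \<Sigma>. \<tau> \<le> cmod (\<Sum>i\<in>S. cnj (w j \<omega> i) * s i)}"
          using True om by (auto simp: C3_def dev_def sp)
        moreover have "(\<Sum>i\<in>S. (cmod (cnj (w j \<omega> i)))\<^sup>2) < d / (1 - d)"
          using contraction_column(3)[OF finite_S _ H_props(1,2)[OF j] P d True[unfolded fpow_def]] j
          by (simp add: nv_def w_def)
        ultimately show ?thesis by (simp only: tail_cmod[OF finite_S _ \<tau>])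
      qed
    qed
    also have "\<dots> = ?q" by (simp add: O.emeasure_space_1)
    finally show "measure ?J (C3 j) \<le> 4 * exp (- (\<tau>\<^sup>2 / (2 * (d / (1 - d)))))"
      unfolding measure_def by (intro enn2real_leI) auto
  qed
  define Bad where "Bad = (A1 \<union> A2) \<union> (\<Union>j\<in>?D. C2 j \<union> C3 j)"
  have CC: "C2 j \<union> C3 j \<in> sets ?J" if "j \<in> ?D" for j using C2(1)[OF that] C3(1)[OF that] by (rule sets.Un)
  have UN: "(\<Union>j\<in>?D. C2 j \<union> C3 j) \<in> sets ?J" by (rule sets.finite_UN, simp, rule CC)
  have Badm: "Bad \<in> sets ?J" unfolding Bad_def by (intro sets.Un A1 A2 UN)
  have "measure ?J Bad \<le> measure ?J (A1 \<union> A2) + measure ?J (\<Union>j\<in>?D. C2 j \<union> C3 j)"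
    unfolding Bad_def by (intro measure_Un_le sets.Un[OF A1(1) A2(1)] UN)
  also have "measure ?J (A1 \<union> A2) \<le> measure ?J A1 + measure ?J A2" by (intro measure_Un_le A1 A2)
  also have "measure ?J (\<Union>j\<in>?D. C2 j \<union> C3 j) \<le> (\<Sum>j\<in>?D. measure ?J (C2 j \<union> C3 j))"
    by (intro measure_UNION_le CC) auto
  also have "\<dots> \<le> (\<Sum>j\<in>?D. real (card S + 1) * (real P * V / d) ^ P + 4 * exp (- (\<tau>\<^sup>2 / (2 * (d / (1 - d))))))"
    using C2 C3 by (intro sum_mono order_trans[OF measure_Un_le] add_mono) blast+
  also have "\<dots> = real (card ?D) * (real (card S + 1) * (real P * V / d) ^ P + 4 * exp (- (\<tau>\<^sup>2 / (2 * (d / (1 - d))))))"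
    by (simp only: sum_constant)
  finally have bad: "measure ?J Bad \<le> \<epsilon>" using \<epsilon> A1(2) A2(2) by linarith
  let ?E = "space ?J - Bad"
  have "?E \<in> sets ?J" using Badm by (rule sets.compl_sets)
  moreover have "measure ?J ?E \<ge> 1 - \<epsilon>" using J.prob_compl[OF Badm] bad by linarith
  moreover have "(\<forall>l\<in>{1..m}. fst x l \<in> good l) \<and> (\<forall>i\<in>S. cmod (snd x i) = 1) \<and>
      (\<forall>j\<in>?D. fpow P j (fst x) < d ^ P \<and> cmod (dev j (fst x) (snd x)) < \<tau>)" if x: "x \<in> ?E" for x
  proof -
    have "x \<in> space Om \<times> space \<Sigma>" using x unfolding sp by (rule DiffD1)
    then have xs: "fst x \<in> space Om" "snd x \<in> space \<Sigma>" "x \<in> space ?J" unfolding sp by auto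
    have "x \<notin> A1" "x \<notin> A2" using x by (auto simp: Bad_def)
    then have "fst x \<notin> N1" "snd x \<notin> N2" using xs by (auto simp: A1_def A2_def mem_Times_iff)
    then have 1: "\<forall>l\<in>{1..m}. fst x l \<in> good l" "\<forall>i\<in>S. cmod (snd x i) = 1" using N1(1) N2(1) xs by blast+
    have "fpow P j (fst x) < d ^ P \<and> cmod (dev j (fst x) (snd x)) < \<tau>" if j: "j \<in> ?D" for j
    proof -
      have "x \<notin> C2 j" "x \<notin> C3 j" using x j by (auto simp: Bad_def)
      then have "\<not> d ^ P \<le> fpow P j (fst x)" using xs by (auto simp: C2_def B2_def mem_Times_iff)
      moreover from this have "\<not> \<tau> \<le> cmod (dev j (fst x) (snd x))" using xs \<open>x \<notin> C3 j\<close> by (auto simp: C3_def)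
      ultimately show ?thesis by simp
    qed
    with 1 show ?thesis by blast
  qed
  ultimately show ?thesis by blast
qed

text \<open>Deterministic part. The key is to move the inverse of \<open>A_S^* A_S\<close> from the
  sign vector to the column \<open>a_j\<close>, which identifies the dual vector at j with
  \<open>dev j\<close>.\<close>

lemma certificate_exists:
  assumes P: "P > 0" and d: "0 < d" "d < 1" and card: "card S < n"
    and good: "\<forall>l\<in>{1..m}. \<omega> l \<in> good l" and s: "\<forall>i\<in>S. cmod (s i) = 1"
    and ev: "\<forall>j\<in>{..<n} - S. fpow P j \<omega> < d ^ P"
  defines "A \<equiv> sensing_matrix n m \<omega>"
  shows "\<exists>b. dual_certificate (dim_row A) n (ent A) S s b (sqrt d) \<and>
    (\<forall>j\<in>{..<n} - S. (\<Sum>k\<in>S. gram (dim_row A) (ent A) j k * b k) = dev j \<omega> s \<and>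
      nrm (dim_row A) (\<lambda>r. ent A r j) \<le> 2)"
proof -
  let ?N = "dim_row A" and ?a = "ent A"
  let ?I = "\<lambda>i k. if i = k then 1 else (0::complex)"
  let ?H = "\<lambda>i k. gram ?N ?a i k - ?I i k"
  define b where "b = neumann S ?H s"
  have carr: "\<omega> l \<in> carrier_mat (p l) n" if "l \<in> {1..m}" for l using good_carrier[OF that] good that by blast
  have gr: "gram ?N ?a i k = (\<Sum>l=1..m. (cadj (\<omega> l) * \<omega> l) $$ (i, k) / of_nat m)" if "i < n" "k < n" for i k
    unfolding A_def by (rule sensing_matrix_gram(2)[of m \<omega> p n, OF carr nm(2) that])
  have HH: "H j \<omega> i k = ?H i k" if j: "j \<in> {..<n} - S" and ik: "i \<in> insert j S" "k \<in> insert j S" for j i k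
  proof -
    have "i < n" "k < n" using that S_sub by auto
    have "(\<Sum>l\<in>{1..m}. Y j l (\<omega> l)) i k = (\<Sum>l\<in>{1..m}. Y j l (\<omega> l) i k)"
      by (rule sum_apply2)
    also have "\<dots> = gram ?N ?a i k" unfolding gr[OF \<open>i < n\<close> \<open>k < n\<close>]
      using good ik by (intro sum.cong refl) (simp add: Y_def)
    finally show ?thesis using ik by (auto simp: H_def idm_def)
  qed
  have mvH: "mv S (H j \<omega>) v i = mv S ?H v i" if "j \<in> {..<n} - S" "i \<in> insert j S" for j v i
    unfolding mv_def using HH[OF that(1)] that(2) by (intro sum.cong refl) auto
  have cc: "nv S (mv S ?H v) \<le> d * nv S v" "i \<in> S \<Longrightarrow> w j \<omega> i + mv S ?H (w j \<omega>) i = ?H i j"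
    "cmod (?H j j) \<le> 1" if j: "j \<in> {..<n} - S" for j v i
  proof -
    have jS: "j \<notin> S" using j by simp
    note c = contraction_column[OF finite_S jS H_props(1,2)[OF j] P d ev[rule_format, OF j, unfolded fpow_def]]
    have "nv S (mv S ?H v) = nv S (mv S (H j \<omega>) v)" by (rule nv_cong) (simp add: mvH[OF j])
    then show "nv S (mv S ?H v) \<le> d * nv S v" using c(1)[of v] by simp
    show "w j \<omega> i + mv S ?H (w j \<omega>) i = ?H i j" if "i \<in> S"
      using c(2)[OF that] HH[OF j, of i j] that mvH[OF j, of i "w j \<omega>"] by (simp add: w_def)
    show "cmod (?H j j) \<le> 1" using c(4) HH[OF j, of j j] by simp
  qed
  \<comment> \<open>The contraction on S is inherited from \<open>insert j S\<close> for some j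
    outside S, so one such j must exist.\<close>
  have "{..<n} - S \<noteq> {}" using card finite_S by (metis Diff_eq_empty_iff card_lessThan card_mono not_le)
  then obtain j0 where j0: "j0 \<in> {..<n} - S" by blast
  have sq: "0 \<le> sqrt d" "sqrt d < 1" "(sqrt d)\<^sup>2 = d" using d by auto
  have Isum: "(\<Sum>k\<in>S. ?I i k * v k) = v i" if "i \<in> S" for i v
  proof -
    have "(\<Sum>k\<in>S. ?I i k * v k) = (\<Sum>k\<in>S. if k = i then v i else 0)" by (intro sum.cong) auto
    then show ?thesis using that finite_S by simp
  qed
  have gsum: "(\<Sum>k\<in>S. gram ?N ?a i k * v k) = v i + mv S ?H v i" if "i \<in> S" for i v
    using Isum[OF that, of v] by (simp add: mv_def left_diff_distrib sum_subtractf)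
  have bsol: "(\<Sum>k\<in>S. gram ?N ?a i k * b k) = s i" if "i \<in> S" for i
    unfolding gsum[OF that] b_def
    by (rule neumann_solves[OF finite_S sq(1,2) _ that]) (simp only: sq(3) cc(1)[OF j0])
  have "dual_certificate ?N n ?a S s b (sqrt d)"
    by (rule dual_certificate.intro) (use S_sub s sq cc(1)[OF j0] bsol in auto)
  moreover have "(\<Sum>k\<in>S. gram ?N ?a j k * b k) = dev j \<omega> s \<and> nrm ?N (\<lambda>r. ?a r j) \<le> 2" if j: "j \<in> {..<n} - S" for j
  proof
    \<comment> \<open>The Gram matrix on S maps \<open>w j\<close> to the column of j and maps b to
      s. As it is Hermitian, pairing that column with b is the same as pairing \<open>w j\<close>
      with s.\<close>
    have gw: "(\<Sum>i\<in>S. gram ?N ?a k i * w j \<omega> i) = gram ?N ?a k j" if "k \<in> S" for k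
      unfolding gsum[OF that] using cc(2)[OF j that] that j by auto
    have "(\<Sum>k\<in>S. gram ?N ?a j k * b k) = (\<Sum>k\<in>S. cnj (\<Sum>i\<in>S. gram ?N ?a k i * w j \<omega> i) * b k)"
      by (intro sum.cong refl) (simp only: gw gram_cnj)
    also have "\<dots> = (\<Sum>k\<in>S. \<Sum>i\<in>S. cnj (w j \<omega> i) * (gram ?N ?a i k * b k))"
      by (simp only: cnj_sum complex_cnj_mult gram_cnj sum_distrib_right) (simp only: mult_ac)
    also have "\<dots> = (\<Sum>i\<in>S. \<Sum>k\<in>S. cnj (w j \<omega> i) * (gram ?N ?a i k * b k))" by (rule sum.swap)
    also have "\<dots> = (\<Sum>i\<in>S. cnj (w j \<omega> i) * s i)"
      unfolding sum_distrib_left[symmetric] by (intro sum.cong refl) (simp only: bsol)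
    finally show "(\<Sum>k\<in>S. gram ?N ?a j k * b k) = dev j \<omega> s" by (simp only: dev_def)
    \<comment> \<open>The squared column norm is the diagonal Gram entry 1 + H j j, of modulus at
      most 2.\<close>
    have "complex_of_real ((nrm ?N (\<lambda>r. ?a r j))\<^sup>2) = gram ?N ?a j j"
      unfolding nrm_power2 gram_def of_real_sum by (intro sum.cong refl) (simp only: complex_norm_square mult.commute)
    then have "(nrm ?N (\<lambda>r. ?a r j))\<^sup>2 = cmod (?H j j + 1)"
      by (metis abs_of_nonneg diff_add_cancel norm_of_real zero_le_power2)
    also have "\<dots> \<le> 2" using norm_triangle_ineq[of "?H j j" 1] cc(3)[OF j] by simp
    also have "\<dots> \<le> 2\<^sup>2" by simp
    finally show "nrm ?N (\<lambda>r. ?a r j) \<le> 2" by (rule power2_le_imp_le) simp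
  qed
  ultimately show ?thesis by blast
qed

end

section \<open>Constants and the theorem\<close>

text \<open>Here \<open>\<kappa> = 1\<close> (threshold 1 for the certificate) gives the constant 19, and \<open>\<kappa> = 4\<close> (threshold 1/2) serves
  the noisy case.\<close>

lemma numeric_bounds:
  assumes \<kappa>: "\<kappa> \<ge> 1" and l: "l \<ge> 12 / 5" and L: "L \<ge> 12 / 5" and P: "l \<le> real P" "real P \<le> l + 1"
    and R: "0 \<le> R" "R \<le> 1 / (19 * \<kappa> * l * L)"
  defines "d \<equiv> 1 / (1 + 2 * \<kappa> * L)"
  defines "V \<equiv> 8 / 25 * d / l"
  shows "R * (2 + 1 / (4 * (3 / 2))) \<le> V * (1 - (2 * real P - 1) * R * (3 / 2))"
    and "(2 * real P - 1) * R * (3 / 2) < 1"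
proof -
  define K where "K = \<kappa> * L"
  have K: "K \<ge> 12 / 5" unfolding K_def using \<kappa> L mult_mono[of 1 \<kappa> "12/5" L] by simp
  have R': "R \<le> 1 / (19 * l * K)" using R(2) by (simp add: K_def mult_ac)
  have pos: "l > 0" "K > 0" using l K by auto
  have "(2 * real P - 1) * R * (3 / 2) \<le> (2 * l + 1) * (1 / (19 * l * K)) * (3 / 2)"
    using P l R R' by (intro mult_right_mono mult_mono) auto
  also have "\<dots> \<le> 2 / 25"
  proof -
    define u where "u = K * l"
    have "(12 / 5) * l \<le> u" unfolding u_def using K pos by (intro mult_right_mono) auto
    \<comment> \<open>Since 38/25 * 12/5 = 3 + 81/125, the surplus 81/125 * l has to cover 3/2,
      which l >= 12/5 just allows.\<close>
    then have h: "3 * l + 3 / 2 \<le> 38 / 25 * u" using l by linarith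
    have "(2 * l + 1) * (1 / (19 * l * K)) * (3 / 2) = (3 * l + 3 / 2) / (19 * u)"
      using pos by (simp add: u_def divide_simps)
    also have "\<dots> \<le> (38 / 25 * u) / (19 * u)" using h pos by (intro divide_right_mono) (auto simp: u_def)
    also have "\<dots> = 2 / 25" using pos by (simp add: u_def)
    finally show ?thesis .
  qed
  finally have x: "(2 * real P - 1) * R * (3 / 2) \<le> 2 / 25" .
  then show "(2 * real P - 1) * R * (3 / 2) < 1" by simp
  have d: "d = 1 / (1 + 2 * K)" by (simp add: d_def K_def mult.assoc)
  \<comment> \<open>13/6 is 2 + 1/(4 lam) at lam = 3/2, and 13/114 is 13/6 divided by 19. On the
    other side, 184/625 is 8/25 * 23/25, where 23/25 is what the previous bound 2/25 leaves.\<close>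
  have "R * (13 / 6) \<le> (1 / (19 * l * K)) * (13 / 6)" using R' by (intro mult_right_mono) auto
  also have "\<dots> \<le> V * (23 / 25)"
  proof -
    have "(13 / 114) * (1 + 2 * K) \<le> (184 / 625) * K" using K by simp
    then have "(13 / 114) * (1 + 2 * K) / (l * K * (1 + 2 * K)) \<le> (184 / 625) * K / (l * K * (1 + 2 * K))"
      using pos by (intro divide_right_mono) auto
    moreover have "(13 / 114) * (1 + 2 * K) / (l * K * (1 + 2 * K)) = (1 / (19 * l * K)) * (13 / 6)"
      using pos by (simp add: divide_simps)
    moreover have "(184 / 625) * K / (l * K * (1 + 2 * K)) = V * (23 / 25)"
      using pos unfolding V_def d by (simp add: divide_simps)
    ultimately show ?thesis by simp
  qed
  also have "\<dots> \<le> V * (1 - (2 * real P - 1) * R * (3 / 2))"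
    using x pos unfolding V_def d by (intro mult_left_mono) auto
  finally show "R * (2 + 1 / (4 * (3 / 2))) \<le> V * (1 - (2 * real P - 1) * R * (3 / 2))" by simp
qed

text \<open>With y = l/P each factor must satisfy (8/25)/y <= exp(-y), that is, y - ln y <=
  ln(25/8). Rounding l up leaves y in [12/17, 1]; there y + 1/y <= 17/8, so y - ln y <= 9/8, and
  25/8 is chosen to exceed exp(9/8).\<close>

lemma power_le_exp_neg:
  assumes l: "l \<ge> 12 / 5" and P: "l \<le> real P" "real P \<le> l + 1"
  shows "(8 / 25 * real P / l) ^ P \<le> exp (- l)"
proof -
  define y where "y = l / real P"
  have Ppos: "real P > 0" using l P by linarith
  have y: "y > 0" "y \<le> 1" using l P Ppos by (auto simp: y_def)
  have y7: "y \<ge> 12 / 17"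
  proof -
    have "12 * real P \<le> 17 * l" using P l by linarith
    then show ?thesis using Ppos by (simp add: y_def field_simps)
  qed
  have "exp (9 / 8 :: real) = exp 1 * exp (1 / 8)" by (simp flip: exp_add)
  also have "\<dots> \<le> (272 / 100) * (1 + 1 / 8 + (1 / 8)\<^sup>2)"
    using e_less_272 by (intro mult_mono exp_bound) auto
  also have "\<dots> \<le> 25 / 8" by (simp add: power2_eq_square)
  finally have "ln (exp (9 / 8 :: real)) \<le> ln (25 / 8)" by (subst ln_le_cancel_iff) auto
  then have a: "9 / 8 \<le> ln (25 / 8 :: real)" by simp
  have "ln (1 / y) \<le> 1 / y - 1" by (rule ln_le_minus_one) (use y in simp)
  then have b: "- ln y \<le> 1 / y - 1" using y by (simp add: ln_div)
  have c: "y + 1 / y \<le> 17 / 8"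
  proof -
    have "(y - 12 / 17) * (1 - y) \<ge> 0" using y y7 by (intro mult_nonneg_nonneg) auto
    moreover have "(y - 12 / 17) * (1 - y) = (29 / 17) * y - 12 / 17 - y\<^sup>2"
      by (simp add: power2_eq_square field_simps)
    ultimately have "y\<^sup>2 + 1 \<le> (17 / 8) * y" using y7 y by linarith
    then show ?thesis using y by (simp add: field_simps power2_eq_square)
  qed
  have e: "8 / 25 * real P / l = (8 / 25) / y" using Ppos l by (simp add: y_def)
  have "ln ((8 / 25) / y) = - ln (25 / 8) - ln y"
    using y ln_div[of "8/25" y] ln_inverse[of "25/8"] by simp
  also have "\<dots> \<le> - y" using a b c by linarith
  finally have "exp (ln ((8 / 25) / y)) \<le> exp (- y)" by (simp only: exp_le_cancel_iff)
  moreover have "exp (ln ((8 / 25) / y)) = (8 / 25) / y" using y by (intro exp_ln) auto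
  ultimately have "(8 / 25) / y \<le> exp (- y)" by (simp only:)
  then have "((8 / 25) / y) ^ P \<le> exp (- y) ^ P" using y by (intro power_mono) auto
  also have "\<dots> = exp (- l)" using Ppos by (simp add: exp_of_nat_mult[symmetric] y_def)
  finally show ?thesis unfolding e .
qed

text \<open>12 = 6 * 2 * 1 is the least value of 6(s+1)(n-s) for a nonempty proper support. The
  bound 12/5 is what makes rounding l up to an integer cheap enough.\<close>

lemma ln_ge_12_5:
  assumes "x \<ge> (12::real)" shows "ln x \<ge> 12 / 5"
proof -
  have e: "exp (1 / 5 :: real) \<le> 1 + 1 / 5 + (1 / 5)\<^sup>2" by (rule exp_bound) auto
  have "exp (12 / 5 :: real) = exp 1 * exp 1 * (exp (1 / 5) * exp (1 / 5))" by (simp flip: exp_add)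
  also have "\<dots> \<le> (272 / 100) * (272 / 100) * ((1 + 1 / 5 + (1 / 5)\<^sup>2) * (1 + 1 / 5 + (1 / 5)\<^sup>2))"
    using e_less_272 e by (intro mult_mono) auto
  also have "\<dots> \<le> 12" by (simp add: power2_eq_square)
  also have "\<dots> \<le> x" by (rule assms)
  finally show ?thesis using assms by (subst ln_ge_iff) auto
qed

text \<open>An almost sure property fails only inside a measurable null set; the complement of that
  set serves as \<open>good l\<close>.\<close>

lemma sensing_exists:
  assumes ok: "setting_ok n m p F S Lam" and S: "S \<subseteq> {..<n}"
    and \<mu>: "subgaussian \<mu> q" "AE z in \<mu>. cmod z = 1"
  shows "\<exists>good. sensing \<mu> q n m p F S Lam good"
proof -
  let ?D = "{..<n} - S"
  let ?Q = "\<lambda>l b. \<forall>j\<in>?D. opnorm22 (cadj (restrT b (S \<union> {j})) * restrT b (S \<union> {j})) \<le> Lam (S \<union> {j})"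
  have "\<exists>g. g \<in> sets (F l) \<and> (AE b in F l. b \<in> g) \<and> (\<forall>b\<in>g. ?Q l b)" if l: "l \<in> {1..m}" for l
  proof -
    have "AE b in F l. ?Q l b"
      using ok l by (intro eventually_ball_finite ballI) (auto simp: setting_ok_def)
    then obtain N where N0: "{b \<in> space (F l). \<not> ?Q l b} \<subseteq> N" "emeasure (F l) N = 0" "N \<in> sets (F l)"
      by (rule AE_E)
    then have N: "\<And>b. b \<in> space (F l) - N \<Longrightarrow> ?Q l b" "N \<in> null_sets (F l)" by blast+
    have "space (F l) - N \<in> sets (F l)" using N(2) by auto
    moreover have "AE b in F l. b \<in> space (F l) - N"
      using AE_not_in[OF N(2)] AE_space by eventually_elim auto
    ultimately show ?thesis using N(1) by blast
  qed
  then obtain good where "\<forall>l\<in>{1..m}. good l \<in> sets (F l) \<and> (AE b in F l. b \<in> good l) \<and> (\<forall>b\<in>good l. ?Q l b)"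
    by metis
  then have "sensing \<mu> q n m p F S Lam good"
    using ok S \<mu> by (intro sensing.intro sensing_axioms.intro) auto
  then show ?thesis by blast
qed

lemma sign_law:
  defines "\<mu> rc \<equiv> if rc then rademacher else steinhaus"
  shows "\<exists>q. subgaussian (\<mu> rc) q" "AE z in \<mu> rc. cmod z = 1"
proof -
  show "\<exists>q. subgaussian (\<mu> rc) q"
    using subgaussian_rademacher subgaussian_steinhaus by (cases rc) (auto simp: \<mu>_def)
  have "AE z in rademacher. cmod z = 1"
    unfolding rademacher_def by (subst AE_measure_pmf_iff) auto
  then show "AE z in \<mu> rc. cmod z = 1" using AE_steinhaus unfolding \<mu>_def by (cases rc) auto
qed

text \<open>S is nonempty and proper, which brings the arguments of both logarithms to at least 12.
  Larger \<kappa> buys a smaller threshold for the dual vector at the price of proportionally more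
  measurements.\<close>

lemma certificate_event:
  assumes ok: "setting_ok n m p F S Lam" and S: "S \<subseteq> {0..<n}" and card: "card S < n" and ne: "S \<noteq> {}"
    and \<epsilon>: "0 < \<epsilon>" "\<epsilon> < 1" and \<kappa>: "\<kappa> \<ge> 1" and m: "real m \<ge> 19 * \<kappa> * sample_bound n S Lam \<epsilon>"
  shows "\<exists>E\<in>sets (joint_law m F S rc). measure (joint_law m F S rc) E \<ge> 1 - \<epsilon> \<and>
    (\<forall>x\<in>E. \<exists>b d. d \<le> 1 / 2 \<and>
       dual_certificate (dim_row (sensing_matrix n m (fst x))) n (ent (sensing_matrix n m (fst x))) S (snd x) b d \<and>
       (\<forall>j\<in>{..<n} - S.
         cmod (\<Sum>k\<in>S. gram (dim_row (sensing_matrix n m (fst x))) (ent (sensing_matrix n m (fst x))) j k * b k) < 1 / sqrt \<kappa> \<and>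
         nrm (dim_row (sensing_matrix n m (fst x))) (\<lambda>r. ent (sensing_matrix n m (fst x)) r j) \<le> 2))"
proof -
  let ?\<mu> = "if rc then rademacher else steinhaus"
  obtain q where q: "subgaussian ?\<mu> q" using sign_law(1) by blast
  have S': "S \<subseteq> {..<n}" using S by auto
  have fin: "finite S" using S finite_subset by blast
  obtain good where "sensing ?\<mu> q n m p F S Lam good"
    using sensing_exists[OF ok S' q sign_law(2)] by blast
  then interpret sensing ?\<mu> q n m p F S Lam good .
  define s where "s = real (card S)"
  have s1: "s \<ge> 1" using ne fin by (simp add: s_def Suc_le_eq card_gt_0_iff)
  have ns: "real n - s \<ge> 1" using card by (simp add: s_def)
  define l where "l = ln (6 * (s + 1) * (real n - s) / \<epsilon>)"
  define L where "L = ln (6 * real n / \<epsilon>)"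
  define W where "W = Max ((\<lambda>j. Lam (S \<union> {j})) ` ({0..<n} - S))"
  have sb: "sample_bound n S Lam \<epsilon> = W * l * L" by (simp add: sample_bound_def W_def l_def L_def s_def)
  have a1: "6 * (s + 1) * (real n - s) \<ge> 12"
    using s1 ns mult_mono[of 2 "s + 1" 1 "real n - s"] by (simp add: mult.assoc del: distrib_left_numeral)
  have a2: "6 * real n \<ge> 12" using s1 ns by linarith
  have div: "x / \<epsilon> \<ge> x" if "x \<ge> 12" for x
    using \<epsilon> that by (simp add: le_divide_eq mult_left_le)
  have l: "l \<ge> 12 / 5" unfolding l_def by (rule ln_ge_12_5) (use div[OF a1] a1 in linarith)
  have L: "L \<ge> 12 / 5" unfolding L_def by (rule ln_ge_12_5) (use div[OF a2] a2 in linarith)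
  have el: "exp (- l) = \<epsilon> / (6 * (s + 1) * (real n - s))"
    unfolding l_def using a1 \<epsilon> by (simp add: exp_minus)
  have eL: "exp (- L) = \<epsilon> / (6 * real n)" unfolding L_def using a2 \<epsilon> by (simp add: exp_minus)
  define P where "P = nat \<lceil>l\<rceil>"
  have P: "l \<le> real P" "real P \<le> l + 1" "P > 0" using l unfolding P_def by linarith+
  \<comment> \<open>Then d/(1-d) = 1/(2 \<kappa> L), so the sign tail at threshold 1/sqrt \<kappa>
    has exponent exactly L. V below is scaled so that P V / d is the base 8P/(25 l) of
    \<open>power_le_exp_neg\<close>.\<close>
  define d where "d = 1 / (1 + 2 * \<kappa> * L)"
  define V where "V = 8 / 25 * d / l"
  have kL: "\<kappa> * L \<ge> 12 / 5" using \<kappa> L mult_mono[of 1 \<kappa> "12/5" L] by simp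
  have d: "0 < d" "d < 1" "d \<le> 1 / 4" using kL by (auto simp: d_def field_simps)
  have V: "V \<ge> 0" using d l by (simp add: V_def)
  have Rb: "0 \<le> R j" "R j \<le> 1 / (19 * \<kappa> * l * L)" if j: "j \<in> {..<n} - S" for j
  proof -
    have Lp: "Lam (S \<union> {j}) > 0" by (rule Lam_pos[OF j])
    have LW: "Lam (S \<union> {j}) \<le> W" unfolding W_def using j by (intro Max_ge) auto
    have "19 * \<kappa> * (Lam (S \<union> {j}) * l * L) \<le> 19 * \<kappa> * (W * l * L)"
      using LW \<kappa> l L by (intro mult_left_mono mult_right_mono) auto
    then have "Lam (S \<union> {j}) * (19 * \<kappa> * l * L) \<le> real m" using m unfolding sb by (simp add: mult_ac)
    moreover have "19 * \<kappa> * l * L > 0" using \<kappa> l L by simp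
    ultimately show "R j \<le> 1 / (19 * \<kappa> * l * L)" using nm(2) by (simp add: R_def field_simps)
    show "0 \<le> R j" using Lp by (simp add: R_def)
  qed
  let ?D = "{..<n} - S"
  have cD: "real (card ?D) = real n - s"
    using S' fin card_mono[OF finite_lessThan S'] by (simp add: card_Diff_subset s_def of_nat_diff)
  have "real (card ?D) * (real (card S + 1) * (real P * V / d) ^ P + 4 * exp (- ((1 / sqrt \<kappa>)\<^sup>2 / (2 * (d / (1 - d)))))) \<le> \<epsilon>"
  proof -
    have "real P * V / d = 8 / 25 * real P / l" using d by (simp add: V_def)
    then have p1: "(real P * V / d) ^ P \<le> \<epsilon> / (6 * (s + 1) * (real n - s))"
      using power_le_exp_neg[OF l P(1,2)] by (simp only: el)
    have dd: "d / (1 - d) = 1 / (2 * \<kappa> * L)"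
      using kL \<kappa> L by (simp add: d_def field_simps)
    have p2: "exp (- ((1 / sqrt \<kappa>)\<^sup>2 / (2 * (d / (1 - d))))) = \<epsilon> / (6 * real n)"
      unfolding dd eL[symmetric] using \<kappa> by (simp add: power_divide)
    have "real (card ?D) * (real (card S + 1) * (real P * V / d) ^ P + 4 * exp (- ((1 / sqrt \<kappa>)\<^sup>2 / (2 * (d / (1 - d))))))
      \<le> (real n - s) * ((s + 1) * (\<epsilon> / (6 * (s + 1) * (real n - s))) + 4 * (\<epsilon> / (6 * real n)))"
    proof -
      have t1: "(s + 1) * (real P * V / d) ^ P \<le> (s + 1) * (\<epsilon> / (6 * (s + 1) * (real n - s)))"
        using s1 by (intro mult_left_mono p1) auto
      have cs: "real (card S + 1) = s + 1" by (simp add: s_def)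
      show ?thesis unfolding cD p2 cs
        by (intro mult_left_mono add_mono t1 order_refl) (use ns in linarith)
    qed
    \<comment> \<open>The 6 inside the logarithms leaves 1/6 for the moments and at most 4/6 for the
      four one-sided tails.\<close>
    also have "\<dots> = \<epsilon> / 6 + (real n - s) / real n * (4 * \<epsilon> / 6)"
    proof -
      have "D * (c * (\<epsilon> / (6 * c * D)) + 4 * (\<epsilon> / (6 * N))) = \<epsilon> / 6 + D / N * (4 * \<epsilon> / 6)"
        if "D > 0" "c > 0" "N > 0" for D c N :: real using that by (simp add: field_simps)
      from this[of "real n - s" "s + 1" "real n"] show ?thesis using ns s1 by auto
    qed
    also have "\<dots> \<le> \<epsilon> / 6 + 1 * (4 * \<epsilon> / 6)"
      using ns s1 \<epsilon> by (intro add_left_mono mult_right_mono) auto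
    also have "\<dots> \<le> \<epsilon>" using \<epsilon> by simp
    finally show ?thesis .
  qed
  note small = this
  have "\<exists>E\<in>sets (Om \<Otimes>\<^sub>M \<Sigma>). measure (Om \<Otimes>\<^sub>M \<Sigma>) E \<ge> 1 - \<epsilon> \<and>
    (\<forall>x\<in>E. (\<forall>l\<in>{1..m}. fst x l \<in> good l) \<and> (\<forall>i\<in>S. cmod (snd x i) = 1) \<and>
      (\<forall>j\<in>?D. fpow P j (fst x) < d ^ P \<and> cmod (dev j (fst x) (snd x)) < 1 / sqrt \<kappa>))"
  proof (rule good_event[OF P(3) d(1,2) _ V, of "1 / sqrt \<kappa>" "3 / 2"])
    fix j assume j: "j \<in> ?D"
    show "R j * (2 + 1 / (4 * (3 / 2))) \<le> V * (1 - (2 * real P - 1) * R j * (3 / 2))"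
      unfolding V_def d_def by (rule numeric_bounds(1)[OF \<kappa> l L P(1,2) Rb[OF j]])
    show "(2 * real P - 1) * R j * (3 / 2) < 1"
      by (rule numeric_bounds(2)[OF \<kappa> l L P(1,2) Rb[OF j]])
  qed (use \<kappa> small in auto)
  then obtain E where E: "E \<in> sets (Om \<Otimes>\<^sub>M \<Sigma>)" "measure (Om \<Otimes>\<^sub>M \<Sigma>) E \<ge> 1 - \<epsilon>"
    and E3: "\<forall>x\<in>E. (\<forall>l\<in>{1..m}. fst x l \<in> good l) \<and> (\<forall>i\<in>S. cmod (snd x i) = 1) \<and>
      (\<forall>j\<in>?D. fpow P j (fst x) < d ^ P \<and> cmod (dev j (fst x) (snd x)) < 1 / sqrt \<kappa>)"
    by blast
  have J: "joint_law m F S rc = Om \<Otimes>\<^sub>M \<Sigma>" unfolding joint_law_def Om_def PiM_F' ..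
  have "\<exists>b d. d \<le> 1 / 2 \<and>
       dual_certificate (dim_row (sensing_matrix n m (fst x))) n (ent (sensing_matrix n m (fst x))) S (snd x) b d \<and>
       (\<forall>j\<in>?D.
         cmod (\<Sum>k\<in>S. gram (dim_row (sensing_matrix n m (fst x))) (ent (sensing_matrix n m (fst x))) j k * b k) < 1 / sqrt \<kappa> \<and>
         nrm (dim_row (sensing_matrix n m (fst x))) (\<lambda>r. ent (sensing_matrix n m (fst x)) r j) \<le> 2)" if x: "x \<in> E" for x
  proof -
    have ev: "\<forall>l\<in>{1..m}. fst x l \<in> good l" "\<forall>i\<in>S. cmod (snd x i) = 1" "\<forall>j\<in>?D. fpow P j (fst x) < d ^ P"
      "\<forall>j\<in>?D. cmod (dev j (fst x) (snd x)) < 1 / sqrt \<kappa>" using E3 x by blast+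
    have "sqrt d \<le> sqrt ((1 / 2)\<^sup>2)" using d by (intro real_sqrt_le_mono) (simp add: power2_eq_square)
    then have "sqrt d \<le> 1 / 2" by simp
    moreover obtain b where "dual_certificate (dim_row (sensing_matrix n m (fst x))) n (ent (sensing_matrix n m (fst x))) S (snd x) b (sqrt d)"
      "\<forall>j\<in>?D. (\<Sum>k\<in>S. gram (dim_row (sensing_matrix n m (fst x))) (ent (sensing_matrix n m (fst x))) j k * b k) = dev j (fst x) (snd x) \<and>
        nrm (dim_row (sensing_matrix n m (fst x))) (\<lambda>r. ent (sensing_matrix n m (fst x)) r j) \<le> 2"
      using certificate_exists[OF P(3) d(1,2) card ev(1,2,3)] by blast
    ultimately show ?thesis using ev(4) by (intro exI[of _ b] exI[of _ "sqrt d"]) simp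
  qed
  then show ?thesis unfolding J using E(1,2) by blast
qed

section \<open>From the certificate to minimizers of the two programs\<close>

lemma joint_law_carrier:
  assumes ok: "setting_ok n m p F S Lam" and x: "x \<in> space (joint_law m F S rc)"
  shows "sensing_matrix n m (fst x) \<in> carrier_mat (dim_row (sensing_matrix n m (fst x))) n"
proof -
  have "fst x l \<in> carrier_mat (p l) n" if "l \<in> {1..m}" for l
  proof -
    have "fst x l \<in> space (F l)"
      using x that by (auto simp: joint_law_def space_pair_measure space_PiM PiE_iff)
    then show ?thesis using ok that by (auto simp: setting_ok_def)
  qed
  then show ?thesis using ok by (intro sensing_matrix_gram(1)[of m "fst x" p]) (auto simp: setting_ok_def)
qed

lemma signal_carrier: "signal n S r \<sigma> \<in> carrier_vec n"
  by (simp add: signal_def)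

lemma l1norm_eq: "v \<in> carrier_vec n \<Longrightarrow> l1norm v = (\<Sum>i<n. cmod (v $ i))"
  by (auto simp: l1norm_def)

lemma lin_diff:
  assumes "A \<in> carrier_mat N n" "z \<in> carrier_vec n" "x \<in> carrier_vec n" "t < N"
  shows "lin {..<n} (ent A) (\<lambda>i. z $ i - x $ i) t = (A *\<^sub>v z) $ t - (A *\<^sub>v x) $ t"
  using assms mult_mat_vec_index_lin[OF assms(1)] by (simp add: lin_def right_diff_distrib sum_subtractf)

lemma residual_eq:
  assumes "A \<in> carrier_mat N n" "e \<in> carrier_vec N"
  shows "(A *\<^sub>v x + e) - A *\<^sub>v x = (e :: complex Matrix.vec)"
  using assms by (intro eq_vecI) auto

text \<open>Formulated for any feasible z of no larger l1 norm, so that it yields both the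
  minimality of the signal and its uniqueness.\<close>

lemma exact_case:
  assumes A: "A \<in> carrier_mat N n" and cert: "dual_certificate N n (ent A) S \<sigma> b d" and r: "\<forall>i\<in>S. r i > 0"
    and u: "\<forall>j\<in>{..<n} - S. cmod (\<Sum>k\<in>S. gram N (ent A) j k * b k) < 1"
    and z: "z \<in> carrier_vec n" "A *\<^sub>v z = A *\<^sub>v signal n S r \<sigma>" "l1norm z \<le> l1norm (signal n S r \<sigma>)"
  shows "z = signal n S r \<sigma>"
proof -
  interpret dual_certificate N n "ent A" S \<sigma> b d by (rule cert)
  let ?x = "signal n S r \<sigma>"
  define h where "h i = z $ i - ?x $ i" for i
  have x: "?x $ i = (if i \<in> S then of_real (r i) * \<sigma> i else 0)" if "i < n" for i
    using that by (simp add: signal_def)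
  have "h i = 0" if i: "i < n" for i
  proof (rule unique_recovery[of r h])
    show "lin {..<n} (ent A) h t = 0" if "t < N" for t
      using lin_diff[OF A z(1) signal_carrier[of n S r \<sigma>] that] by (simp add: z(2) h_def[abs_def])
    have "(\<Sum>i<n. cmod ((if i \<in> S then of_real (r i) * \<sigma> i else 0) + h i)) = l1norm z"
      unfolding l1norm_eq[OF z(1)] by (intro sum.cong refl) (simp add: h_def x)
    moreover have "(\<Sum>i<n. cmod (if i \<in> S then of_real (r i) * \<sigma> i else 0)) = l1norm ?x"
      unfolding l1norm_eq[OF signal_carrier] by (intro sum.cong refl) (simp add: x)
    ultimately show "(\<Sum>i<n. cmod ((if i \<in> S then of_real (r i) * \<sigma> i else 0) + h i)) \<le>
      (\<Sum>i<n. cmod (if i \<in> S then of_real (r i) * \<sigma> i else 0))" using z(3) by simp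
    show "cmod (local.u j) < 1" if "j < n" "j \<notin> S" for j using u that by (simp add: local.u_def)
  qed (use r i in auto)
  then show ?thesis using z(1) by (intro eq_vecI) (auto simp: h_def signal_def)
qed

text \<open>The true signal is feasible, so the minimizer has no larger l1 norm; both residuals are
  at most \<eta>, so their difference A h has norm at most 2\<eta>.\<close>

lemma noisy_case:
  assumes A: "A \<in> carrier_mat N n" and cert: "dual_certificate N n (ent A) S \<sigma> b d" and r: "\<forall>i\<in>S. r i > 0"
    and d2: "d \<le> 1 / 2"
    and u: "\<forall>j\<in>{..<n} - S. cmod (\<Sum>k\<in>S. gram N (ent A) j k * b k) < 1 / 2 \<and> nrm N (\<lambda>t. ent A t j) \<le> 2"
    and e: "e \<in> carrier_vec N" "l2norm e \<le> \<eta>"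
    and z: "qBP_minimizer A (A *\<^sub>v signal n S r \<sigma> + e) \<eta> z"
  shows "l2norm (signal n S r \<sigma> - z) \<le> (4 + 40 * sqrt (real (card S))) * \<eta>"
proof -
  interpret dual_certificate N n "ent A" S \<sigma> b d by (rule cert)
  let ?x = "signal n S r \<sigma>" and ?y = "A *\<^sub>v signal n S r \<sigma> + e"
  have z1: "z \<in> carrier_vec n" "l2norm (?y - A *\<^sub>v z) \<le> \<eta>" using z A by (auto simp: qBP_minimizer_def)
  have "?y - A *\<^sub>v ?x = e" using A e(1) by (rule residual_eq)
  then have z3: "l1norm z \<le> l1norm ?x" using z A e signal_carrier[of n S r \<sigma>] by (auto simp: qBP_minimizer_def)
  define h where "h i = z $ i - ?x $ i" for i
  have x: "?x $ i = (if i \<in> S then of_real (r i) * \<sigma> i else 0)" if "i < n" for i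
    using that by (simp add: signal_def)
  have "nrm n h \<le> (4 + 40 * sqrt (real (card S))) * \<eta>"
  proof (rule stable_recovery[of r h])
    show "nrm N (lin {..<n} (ent A) h) \<le> 2 * \<eta>"
    proof -
      have "nrm N (lin {..<n} (ent A) h) = nrm N (\<lambda>t. e $ t + (- ((?y - A *\<^sub>v z) $ t)))"
        unfolding nrm_def
      proof (rule L2_set_cong[OF refl])
        fix t assume "t \<in> {..<N}"
        then have t: "t < N" by simp
        show "cmod (lin {..<n} (ent A) h t) = cmod (e $ t + (- ((?y - A *\<^sub>v z) $ t)))"
          using lin_diff[OF A z1(1) signal_carrier[of n S r \<sigma>] t] t A e by (simp add: h_def[abs_def])
      qed
      also have "\<dots> \<le> nrm N (\<lambda>t. e $ t) + nrm N (\<lambda>t. - ((?y - A *\<^sub>v z) $ t))" by (rule nrm_triangle)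
      also have "nrm N (\<lambda>t. - ((?y - A *\<^sub>v z) $ t)) = l2norm (?y - A *\<^sub>v z)"
        using A by (simp add: l2norm_eq_nrm nrm_def)
      also have "nrm N (\<lambda>t. e $ t) = l2norm e" using e by (simp add: l2norm_eq_nrm)
      finally show ?thesis using e(2) z1(2) by simp
    qed
    have "(\<Sum>i<n. cmod ((if i \<in> S then of_real (r i) * \<sigma> i else 0) + h i)) = l1norm z"
      unfolding l1norm_eq[OF z1(1)] by (intro sum.cong refl) (simp add: h_def x)
    moreover have "(\<Sum>i<n. cmod (if i \<in> S then of_real (r i) * \<sigma> i else 0)) = l1norm ?x"
      unfolding l1norm_eq[OF signal_carrier] by (intro sum.cong refl) (simp add: x)
    ultimately show "(\<Sum>i<n. cmod ((if i \<in> S then of_real (r i) * \<sigma> i else 0) + h i)) \<le>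
      (\<Sum>i<n. cmod (if i \<in> S then of_real (r i) * \<sigma> i else 0))" using z3 by simp
    show "cmod (local.u j) \<le> 1 / 2" if "j < n" "j \<notin> S" for j
      using u that by (simp add: local.u_def less_imp_le)
    show "nrm N (\<lambda>t. ent A t j) \<le> 2" if "j < n" "j \<notin> S" for j using u that by simp
  qed (use r d2 in auto)
  moreover have "l2norm (?x - z) = nrm n h"
  proof -
    have "l2norm (?x - z) = nrm n (\<lambda>i. (?x - z) $ i)" using z1(1) by (simp add: l2norm_eq_nrm)
    also have "\<dots> = nrm n h"
      unfolding nrm_def using z1(1) by (intro L2_set_cong refl) (simp add: h_def norm_minus_commute)
    finally show ?thesis .
  qed
  ultimately show ?thesis by simp
qed

lemma l1norm_le_0: "z \<in> carrier_vec n \<Longrightarrow> l1norm z \<le> l1norm (signal n {} r \<sigma>) \<Longrightarrow> z = signal n {} r \<sigma>"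
proof -
  assume z: "z \<in> carrier_vec n" "l1norm z \<le> l1norm (signal n {} r \<sigma>)"
  have "l1norm (signal n {} r \<sigma>) = 0" unfolding l1norm_def signal_def by simp
  then have "(\<Sum>i<n. cmod (z $ i)) \<le> 0" using z(2) unfolding l1norm_eq[OF z(1)] by simp
  then have "(\<Sum>i<n. cmod (z $ i)) = 0" using sum_nonneg[of "{..<n}" "\<lambda>i. cmod (z $ i)"] by simp
  then have "\<forall>i<n. z $ i = 0" by (subst (asm) sum_nonneg_eq_0_iff) auto
  then show ?thesis using z(1) by (intro eq_vecI) (auto simp: signal_def)
qed

lemma prob_joint_law:
  assumes ok: "setting_ok n m p F S Lam" shows "prob_space (joint_law m F S rc)"
proof -
  have q: "prob_space (if rc then rademacher else steinhaus)"
    using sign_law(1)[of rc] subgaussian.prob_\<mu> by blast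
  have "PiM {1..m} F = PiM {1..m} (\<lambda>l. if l \<in> {1..m} then F l else F 1)" by (rule PiM_cong) auto
  moreover have "prob_space (PiM {1..m} (\<lambda>l. if l \<in> {1..m} then F l else F 1))"
    using ok by (intro prob_space_PiM) (auto simp: setting_ok_def)
  ultimately have a: "prob_space (PiM {1..m} F)" by simp
  show ?thesis unfolding joint_law_def
    by (intro prob_space_pair a prob_space_PiM q)
qed

text \<open>Common frame for both recovery statements. For empty S the whole space serves as the
  event, since the logarithmic estimates behind the certificate may fail there.\<close>

lemma recovery_event:
  assumes ok: "setting_ok n m p F S Lam" and S: "S \<subseteq> {0..<n}" and card: "card S < n"
    and \<epsilon>: "0 < \<epsilon>" "\<epsilon> < 1" and \<kappa>: "\<kappa> \<ge> 1" and m: "real m \<ge> 19 * \<kappa> * sample_bound n S Lam \<epsilon>"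
    and hyp: "\<And>x. x \<in> space (joint_law m F S rc) \<Longrightarrow> S = {} \<Longrightarrow> Q x"
      "\<And>x b d. x \<in> space (joint_law m F S rc) \<Longrightarrow> d \<le> 1 / 2 \<Longrightarrow>
       dual_certificate (dim_row (sensing_matrix n m (fst x))) n (ent (sensing_matrix n m (fst x))) S (snd x) b d \<Longrightarrow>
       (\<forall>j\<in>{..<n} - S.
         cmod (\<Sum>k\<in>S. gram (dim_row (sensing_matrix n m (fst x))) (ent (sensing_matrix n m (fst x))) j k * b k) < 1 / sqrt \<kappa> \<and>
         nrm (dim_row (sensing_matrix n m (fst x))) (\<lambda>r. ent (sensing_matrix n m (fst x)) r j) \<le> 2) \<Longrightarrow> Q x"
  shows "\<exists>E\<in>sets (joint_law m F S rc). measure (joint_law m F S rc) E \<ge> 1 - \<epsilon> \<and> (\<forall>x\<in>E. Q x)"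
proof (cases "S = {}")
  case True
  then show ?thesis
    using prob_space.prob_space[OF prob_joint_law[OF ok, of rc]] hyp(1) \<epsilon>
    by (intro bexI[of _ "space (joint_law m F S rc)"]) auto
next
  case False
  from certificate_event[OF ok S card False \<epsilon> \<kappa> m, of rc] obtain E where E:
    "E \<in> sets (joint_law m F S rc)" "measure (joint_law m F S rc) E \<ge> 1 - \<epsilon>"
    and c: "\<And>x. x \<in> E \<Longrightarrow> \<exists>b d. d \<le> 1 / 2 \<and>
       dual_certificate (dim_row (sensing_matrix n m (fst x))) n (ent (sensing_matrix n m (fst x))) S (snd x) b d \<and>
       (\<forall>j\<in>{..<n} - S.
         cmod (\<Sum>k\<in>S. gram (dim_row (sensing_matrix n m (fst x))) (ent (sensing_matrix n m (fst x))) j k * b k) < 1 / sqrt \<kappa> \<and>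
         nrm (dim_row (sensing_matrix n m (fst x))) (\<lambda>r. ent (sensing_matrix n m (fst x)) r j) \<le> 2)"
    by blast
  have "Q x" if x: "x \<in> E" for x
  proof -
    have "x \<in> space (joint_law m F S rc)" using sets.sets_into_space[OF E(1)] x by blast
    then show ?thesis using c[OF x] hyp(2) by blast
  qed
  then show ?thesis using E by blast
qed

text \<open>76 = 19 * 4: with \<kappa> = 4 the dual vector stays below 1/2 off S, the slack needed
  for stability. The event is fixed before the noise, so the estimate holds for all admissible e at
  once.\<close>

lemma noisy_event:
  assumes ok: "setting_ok n m p F S Lam" and S: "S \<subseteq> {0..<n}" and card: "card S < n" and r: "\<forall>i\<in>S. r i > 0"
    and \<eta>: "\<eta> \<ge> 0" and \<epsilon>: "0 < \<epsilon>" "\<epsilon> < 1" and m: "real m \<ge> 76 * sample_bound n S Lam \<epsilon>"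
  shows "\<exists>E \<in> sets (joint_law m F S rc). measure (joint_law m F S rc) E \<ge> 1 - \<epsilon> \<and>
         (\<forall>\<omega> \<in> E. let A = sensing_matrix n m (fst \<omega>); x = signal n S r (snd \<omega>) in
            \<forall>e \<in> carrier_vec (dim_row A). l2norm e \<le> \<eta> \<longrightarrow>
              (\<forall>xs. qBP_minimizer A (A *\<^sub>v x + e) \<eta> xs \<longrightarrow>
                 l2norm (x - xs) \<le> (4 + 40 * sqrt (real (card S))) * \<eta>))"
proof (rule recovery_event[OF ok S card \<epsilon>, of 4])
  fix \<omega> assume \<omega>: "\<omega> \<in> space (joint_law m F S rc)"
  let ?A = "sensing_matrix n m (fst \<omega>)" and ?x = "signal n S r (snd \<omega>)"
  have A: "?A \<in> carrier_mat (dim_row ?A) n" by (rule joint_law_carrier[OF ok \<omega>])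
  show "let A = ?A; x = ?x in \<forall>e \<in> carrier_vec (dim_row A). l2norm e \<le> \<eta> \<longrightarrow>
     (\<forall>xs. qBP_minimizer A (A *\<^sub>v x + e) \<eta> xs \<longrightarrow> l2norm (x - xs) \<le> (4 + 40 * sqrt (real (card S))) * \<eta>)"
    if "S = {}"
    unfolding Let_def
  proof (intro ballI allI impI)
    fix e xs assume e1: "e \<in> carrier_vec (dim_row ?A)" "l2norm e \<le> \<eta>" and q: "qBP_minimizer ?A (?A *\<^sub>v ?x + e) \<eta> xs"
    have "(?A *\<^sub>v ?x + e) - ?A *\<^sub>v ?x = e" using A e1(1) by (rule residual_eq)
    have "dim_col ?A = n" using A by (rule carrier_matD(2))
    note dim = this
    have y: "l2norm ((?A *\<^sub>v ?x + e) - ?A *\<^sub>v ?x) \<le> \<eta>"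
      using e1(2) \<open>(?A *\<^sub>v ?x + e) - ?A *\<^sub>v ?x = e\<close> by (simp only:)
    note qq = q[unfolded qBP_minimizer_def dim]
    have xs: "xs \<in> carrier_vec n" by (rule conjunct1[OF qq])
    have "l1norm xs \<le> l1norm ?x"
      by (rule conjunct2[OF conjunct2[OF qq], rule_format, OF signal_carrier y])
    then have "l1norm xs \<le> l1norm (signal n {} r (snd \<omega>))" by (simp only: \<open>S = {}\<close>)
    from l1norm_le_0[OF xs this] have "xs = ?x" by (simp only: \<open>S = {}\<close>)
    have "l2norm (?x - xs) = 0" unfolding \<open>xs = ?x\<close> by (simp add: l2norm_def signal_def)
    then show "l2norm (?x - xs) \<le> (4 + 40 * sqrt (real (card S))) * \<eta>" using \<eta> by simp
  qed
  show "let A = ?A; x = ?x in \<forall>e \<in> carrier_vec (dim_row A). l2norm e \<le> \<eta> \<longrightarrow>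
     (\<forall>xs. qBP_minimizer A (A *\<^sub>v x + e) \<eta> xs \<longrightarrow> l2norm (x - xs) \<le> (4 + 40 * sqrt (real (card S))) * \<eta>)"
    if "d \<le> 1 / 2" "dual_certificate (dim_row ?A) n (ent ?A) S (snd \<omega>) b d"
      "\<forall>j\<in>{..<n} - S. cmod (\<Sum>k\<in>S. gram (dim_row ?A) (ent ?A) j k * b k) < 1 / sqrt 4 \<and> nrm (dim_row ?A) (\<lambda>r. ent ?A r j) \<le> 2"
    for b d
    unfolding Let_def
  proof (intro ballI allI impI)
    fix e xs assume e: "e \<in> carrier_vec (dim_row ?A)" "l2norm e \<le> \<eta>"
      and q: "qBP_minimizer ?A (?A *\<^sub>v ?x + e) \<eta> xs"
    have "1 / sqrt 4 = (1 / 2 :: real)" by simp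
    with that(3) have "\<forall>j\<in>{..<n} - S. cmod (\<Sum>k\<in>S. gram (dim_row ?A) (ent ?A) j k * b k) < 1 / 2
        \<and> nrm (dim_row ?A) (\<lambda>r. ent ?A r j) \<le> 2" by (simp only:)
    from noisy_case[OF A that(2) r that(1) this e q]
    show "l2norm (?x - xs) \<le> (4 + 40 * sqrt (real (card S))) * \<eta>" .
  qed
qed (use m in simp_all)

lemma exact_event:
  assumes ok: "setting_ok n m p F S Lam" and S: "S \<subseteq> {0..<n}" and card: "card S < n" and r: "\<forall>i\<in>S. r i > 0"
    and \<epsilon>: "0 < \<epsilon>" "\<epsilon> < 1" and m: "real m \<ge> 19 * sample_bound n S Lam \<epsilon>"
  shows "\<exists>E \<in> sets (joint_law m F S rc). measure (joint_law m F S rc) E \<ge> 1 - \<epsilon> \<and>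
         (\<forall>\<omega> \<in> E. let A = sensing_matrix n m (fst \<omega>); x = signal n S r (snd \<omega>) in
            BP_minimizer A (A *\<^sub>v x) x \<and> (\<forall>z. BP_minimizer A (A *\<^sub>v x) z \<longrightarrow> z = x))"
proof (rule recovery_event[OF ok S card \<epsilon>, of 1])
  fix \<omega> assume \<omega>: "\<omega> \<in> space (joint_law m F S rc)"
  let ?A = "sensing_matrix n m (fst \<omega>)" and ?x = "signal n S r (snd \<omega>)"
  have A: "?A \<in> carrier_mat (dim_row ?A) n" by (rule joint_law_carrier[OF ok \<omega>])
  \<comment> \<open>If every feasible vector of no larger norm is the signal, a feasible vector of
    smaller norm would be the signal itself, which is absurd; hence the signal is a
    minimizer.\<close>
  have *: "let A = ?A; x = ?x in BP_minimizer A (A *\<^sub>v x) x \<and> (\<forall>z. BP_minimizer A (A *\<^sub>v x) z \<longrightarrow> z = x)"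
    if u: "\<And>z. z \<in> carrier_vec n \<Longrightarrow> ?A *\<^sub>v z = ?A *\<^sub>v ?x \<Longrightarrow> l1norm z \<le> l1norm ?x \<Longrightarrow> z = ?x"
    unfolding Let_def
  proof (intro conjI allI impI)
    have c: "dim_col ?A = n" using A by auto
    show "BP_minimizer ?A (?A *\<^sub>v ?x) ?x"
      unfolding BP_minimizer_def c
    proof (intro conjI ballI impI refl signal_carrier)
      fix z assume z: "z \<in> carrier_vec n" "?A *\<^sub>v z = ?A *\<^sub>v ?x"
      show "l1norm ?x \<le> l1norm z"
      proof (rule ccontr)
        assume "\<not> l1norm ?x \<le> l1norm z"
        with u[OF z] show False by simp
      qed
    qed
    fix z assume "BP_minimizer ?A (?A *\<^sub>v ?x) z"
    then show "z = ?x" unfolding BP_minimizer_def c using signal_carrier by (intro u) auto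
  qed
  show "let A = ?A; x = ?x in BP_minimizer A (A *\<^sub>v x) x \<and> (\<forall>z. BP_minimizer A (A *\<^sub>v x) z \<longrightarrow> z = x)"
    if "S = {}"
  proof (rule *)
    fix z assume z: "z \<in> carrier_vec n" "l1norm z \<le> l1norm ?x"
    from z(2) have "l1norm z \<le> l1norm (signal n {} r (snd \<omega>))" by (simp only: \<open>S = {}\<close>)
    from l1norm_le_0[OF z(1) this] show "z = ?x" by (simp only: \<open>S = {}\<close>)
  qed
  show "let A = ?A; x = ?x in BP_minimizer A (A *\<^sub>v x) x \<and> (\<forall>z. BP_minimizer A (A *\<^sub>v x) z \<longrightarrow> z = x)"
    if "d \<le> 1 / 2" "dual_certificate (dim_row ?A) n (ent ?A) S (snd \<omega>) b d"
      "\<forall>j\<in>{..<n} - S. cmod (\<Sum>k\<in>S. gram (dim_row ?A) (ent ?A) j k * b k) < 1 / sqrt 1 \<and> nrm (dim_row ?A) (\<lambda>r. ent ?A r j) \<le> 2"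
    for b d
    by (rule *, rule exact_case[OF A that(2) r]) (use that(3) in auto)
qed (use m in simp_all)

theorem mainTheorem4:
  "\<exists>c1 C1 C2 :: real. c1 > 0 \<and> C1 > 0 \<and> C2 > 0 \<and>
   (\<forall>n m p F S Lam (r :: nat \<Rightarrow> real) real_case (\<eta>::real) (\<epsilon>::real).
      setting_ok n m p F S Lam \<and> S \<subseteq> {0..<n} \<and> card S < n \<and>
      (\<forall>i \<in> S. r i > 0) \<and> \<eta> \<ge> 0 \<and> 0 < \<epsilon> \<and> \<epsilon> < 1 \<and>
      real m \<ge> c1 * sample_bound n S Lam \<epsilon> \<longrightarrow>
      (\<exists>E \<in> sets (joint_law m F S real_case).
         measure (joint_law m F S real_case) E \<ge> 1 - \<epsilon> \<and>
         (\<forall>\<omega> \<in> E. let A = sensing_matrix n m (fst \<omega>); x = signal n S r (snd \<omega>) in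
            \<forall>e \<in> carrier_vec (dim_row A). l2norm e \<le> \<eta> \<longrightarrow>
              (\<forall>xs. qBP_minimizer A (A *\<^sub>v x + e) \<eta> xs \<longrightarrow>
                 l2norm (x - xs) \<le> (C1 + C2 * sqrt (real (card S))) * \<eta>)))) \<and>
   (\<forall>n m p F S Lam (r :: nat \<Rightarrow> real) real_case (\<epsilon>::real).
      setting_ok n m p F S Lam \<and> S \<subseteq> {0..<n} \<and> card S < n \<and>
      (\<forall>i \<in> S. r i > 0) \<and> 0 < \<epsilon> \<and> \<epsilon> < 1 \<and>
      real m \<ge> 19 * sample_bound n S Lam \<epsilon> \<longrightarrow>
      (\<exists>E \<in> sets (joint_law m F S real_case).
         measure (joint_law m F S real_case) E \<ge> 1 - \<epsilon> \<and>
         (\<forall>\<omega> \<in> E. let A = sensing_matrix n m (fst \<omega>); x = signal n S r (snd \<omega>) in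
            BP_minimizer A (A *\<^sub>v x) x \<and>
            (\<forall>z. BP_minimizer A (A *\<^sub>v x) z \<longrightarrow> z = x))))"
\<comment> \<open>76 is the constant of \<open>noisy_event\<close>; 4 and 40 come from
  \<open>stable_recovery\<close>.\<close>
proof (rule exI[of _ 76], rule exI[of _ 4], rule exI[of _ 40], intro conjI)
qed (simp_all only: zero_less_numeral, (intro allI impI, elim conjE, rule noisy_event exact_event; assumption)+)

end
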